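(* Let $F$ be a $4$-regular graph, let $D$ be a directed version of $F$, let $\mathbf o$ be a transitional orientation of $F$, and let $\Gamma$ be a cycle spanning set of $F-E$, where $E\subseteq E(F)$ contains at most one edge from each connected component of $F$. Then $\mathrm{CM}(F,\Gamma,D)\cdot\Delta_{D,\mathbf o}$ is a representation of $Q(F)$. This representation is strict when $|E|=c(F)$.
   Context: Graphs: $G=(V,H,E,\epsilon)$ with finite sets of vertices $V$ and half-edges $H$, a partition $E$ of $H$ into unordered pairs (edges), and $\epsilon:H\to V$; loops and multiple edges allowed. $c(G)$ is the number of connected components; $G-E'$ deletes the edges of $E'$. A directed version orders each edge as (tail, head). A single transition is an unordered pair of distinct half-edges incident with a common vertex; a directed single transition is such an ordered pair. A closed walk is a sequence $((h_1,h_2),\dots,(h_{n-1},h_n))$ of directed single transitions with $\{h_2,h_3\},\{h_4,h_5\},\dots,\{h_n,h_1\}$ edges, up to cyclic shift. $\sigma(D,W)\in\mathbb Z^{E}$ counts, at each edge, traversals by $W$ along its direction in $D$ minus traversals against it. A circuit is a nonempty closed walk using each half-edge at most once, with orientation forgotten. The cycle space of $D$ is the right null space over $\mathbb Q$ of its vertex-edge incidence matrix. A cycle basis is a set $B$ of closed walks such that the $\sigma(D,W)$, $W\in B$, are pairwise distinct and form a basis of the cycle space; a cycle spanning set is a set of closed walks containing a cycle basis. $\mathrm{CM}(G,\Gamma,D)$ is the $\Gamma\times E(G)$ matrix with row $\sigma(D,W)$ for $W\in\Gamma$. $F$ is $4$-regular if every vertex is incident with exactly $4$ half-edges. A transition at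 $v$ is a partition of the four half-edges at $v$ into two single transitions; $\mathfrak T(F)$ is the set of transitions. A circuit partition $P$ is a set of circuits such that every half-edge lies in exactly one single transition of exactly one circuit of $P$; $\tau(P)$ is the set of transitions both of whose single transitions occur in circuits of $P$; each set containing exactly one transition at every vertex equals $\tau(P)$ for a unique $P$. A transitional orientation $\mathbf o$ assigns to each transition $t$ one of its two single transitions $\mathbf o(t)$. $\Delta_{D,\mathbf o}$ is the $E(F)\times\mathfrak T(F)$ matrix over $\mathbb Q$ whose $(e,t)$ entry is $1$ if $e\cap\mathbf o(t)=\{h\}$ with $h$ the tail of $e$ in $D$, $-1$ if $e\cap\mathbf o(t)=\{h\}$ with $h$ the head, and $0$ otherwise. Multimatroids: for a partition $\Omega$ of a finite set $U$ (skew classes), a transversal meets every skew class in exactly one element; a subtransversal is a subset of a transversal. A multimatroid $(U,\Omega,r)$ has $r$ from subtransversals to $\mathbb N$ such that on each subtransversal $S$, $r$ is a matroid rank function, and for $x\ne y$ in a skew class disjoint from $S$, $\max\{r(S\cup\{x\}),r(S\cup\{y\})\}>r(S)$. A representation is a matrix with columns indexed by $U$ such that the rank of the columns in any subtransversal $S$ equals $r(S)$; it is strict if the matrix rank equals $\max r$. The Eulerian $3$-matroid $Q(F)$ is the unique multimatroid $(\mathfrak T(F),\Omega,r)$ whose skew classes are the sets of three transitions at each vertex and such that for every transversal $T=\tau(P)$, $r(T)=|V(F)|-(|P|-c(F))$. *)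

theory Defs
  imports Complex_Main "HOL-Library.Function_Algebras"
begin

record ('v,'h) graph =
  verts  :: "'v set"
  hedges :: "'h set"
  edges  :: "'h set set"
  inc    :: "'h \<Rightarrow> 'v"

definition wf_graph :: "('v,'h) graph \<Rightarrow> bool" where
  "wf_graph G \<longleftrightarrow> finite (verts G) \<and> finite (hedges G)
     \<and> (\<forall>h\<in>hedges G. inc G h \<in> verts G)
     \<and> (\<forall>e\<in>edges G. e \<subseteq> hedges G \<and> card e = 2)
     \<and> (\<forall>e1\<in>edges G. \<forall>e2\<in>edges G. e1 \<noteq> e2 \<longrightarrow> e1 \<inter> e2 = {})
     \<and> \<Union>(edges G) = hedges G"

definition hat :: "('v,'h) graph \<Rightarrow> 'v \<Rightarrow> 'h set" where
  "hat G v = {h \<in> hedges G. inc G h = v}"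

definition four_regular :: "('v,'h) graph \<Rightarrow> bool" where
  "four_regular G \<longleftrightarrow> (\<forall>v\<in>verts G. card (hat G v) = 4)"

definition del_edges :: "('v,'h) graph \<Rightarrow> 'h set set \<Rightarrow> ('v,'h) graph" where
  "del_edges G X = G\<lparr> hedges := hedges G - \<Union>(X \<inter> edges G), edges := edges G - X \<rparr>"

definition adj :: "('v,'h) graph \<Rightarrow> ('v \<times> 'v) set" where
  "adj G = {(u,v). \<exists>e\<in>edges G. \<exists>h\<in>e. \<exists>h'\<in>e. u = inc G h \<and> v = inc G h'}"

definition conn :: "('v,'h) graph \<Rightarrow> ('v \<times> 'v) set" where
  "conn G = Id_on (verts G) \<union> (adj G)\<^sup>+"

definition ncomp :: "('v,'h) graph \<Rightarrow> nat" where
  "ncomp G = card (verts G // conn G)"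

text \<open>A directed version of \<open>G\<close> is given by the set of tail half-edges: every
  edge contains exactly one tail; the other half-edge is the head.\<close>
definition directed_version :: "('v,'h) graph \<Rightarrow> 'h set \<Rightarrow> bool" where
  "directed_version G T \<longleftrightarrow> T \<subseteq> hedges G \<and> (\<forall>e\<in>edges G. card (e \<inter> T) = 1)"

definition dst :: "('v,'h) graph \<Rightarrow> 'h \<times> 'h \<Rightarrow> bool" where
  "dst G p \<longleftrightarrow> fst p \<in> hedges G \<and> snd p \<in> hedges G \<and> fst p \<noteq> snd p
                 \<and> inc G (fst p) = inc G (snd p)"

definition cwalk_list :: "('v,'h) graph \<Rightarrow> ('h \<times> 'h) list \<Rightarrow> bool" where
  "cwalk_list G w \<longleftrightarrow> (\<forall>i<length w. dst G (w!i)
       \<and> {snd (w!i), fst (w!((i+1) mod length w))} \<in> edges G)"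

text \<open>Closed walks are taken up to cyclic shift: a closed walk is the set of all
  cyclic shifts of a representing list.\<close>
definition rotations :: "'a list \<Rightarrow> 'a list set" where
  "rotations w = {rotate k w | k. True}"

definition closed_walk :: "('v,'h) graph \<Rightarrow> ('h \<times> 'h) list set \<Rightarrow> bool" where
  "closed_walk G W \<longleftrightarrow> (\<exists>w. cwalk_list G w \<and> W = rotations w)"

definition rev_walk :: "('h \<times> 'h) list \<Rightarrow> ('h \<times> 'h) list" where
  "rev_walk w = rev (map (\<lambda>(a,b). (b,a)) w)"

definition hlist :: "('h \<times> 'h) list \<Rightarrow> 'h list" where
  "hlist w = concat (map (\<lambda>(a,b). [a,b]) w)"

text \<open>A circuit: a nonempty closed walk using each half-edge at most once, with
  orientation forgotten (all cyclic shifts of the walk and of its reversal).\<close>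
definition circuit :: "('v,'h) graph \<Rightarrow> ('h \<times> 'h) list set \<Rightarrow> bool" where
  "circuit G C \<longleftrightarrow> (\<exists>w. cwalk_list G w \<and> w \<noteq> [] \<and> distinct (hlist w)
       \<and> C = rotations w \<union> rotations (rev_walk w))"

definition sts :: "('h \<times> 'h) list set \<Rightarrow> 'h set set" where
  "sts C = {{a,b} | a b. \<exists>w\<in>C. (a,b) \<in> set w}"

text \<open>\<sigma>(D,W): traversals of edge e in direction of D minus traversals against it.
  Traversal i of the list goes from half-edge \<open>snd (w!i)\<close> to \<open>fst (w!(i+1))\<close>.\<close>
definition sigma_list :: "'h set \<Rightarrow> ('h \<times> 'h) list \<Rightarrow> 'h set \<Rightarrow> rat" where
  "sigma_list T w e =
     of_nat (card {i. i < length w \<and> e = {snd (w!i), fst (w!((i+1) mod length w))}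
                     \<and> snd (w!i) \<in> T})
   - of_nat (card {i. i < length w \<and> e = {snd (w!i), fst (w!((i+1) mod length w))}
                     \<and> snd (w!i) \<notin> T})"

definition sigma :: "'h set \<Rightarrow> ('h \<times> 'h) list set \<Rightarrow> 'h set \<Rightarrow> rat" where
  "sigma T W = sigma_list T (SOME w. w \<in> W)"

definition qscale :: "rat \<Rightarrow> ('a \<Rightarrow> rat) \<Rightarrow> ('a \<Rightarrow> rat)" where
  "qscale c f = (\<lambda>x. c * f x)"

text \<open>Vertex-edge incidence matrix entry of the directed graph (loops give 0).\<close>
definition incmat :: "('v,'h) graph \<Rightarrow> 'h set \<Rightarrow> 'v \<Rightarrow> 'h set \<Rightarrow> rat" where
  "incmat G T v e =
     of_nat (card {h \<in> e - T. inc G h = v}) - of_nat (card {h \<in> e \<inter> T. inc G h = v})"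

definition cycle_space :: "('v,'h) graph \<Rightarrow> 'h set \<Rightarrow> ('h set \<Rightarrow> rat) set" where
  "cycle_space G T = {x. (\<forall>e. e \<notin> edges G \<longrightarrow> x e = 0)
      \<and> (\<forall>v\<in>verts G. (\<Sum>e\<in>edges G. incmat G T v e * x e) = 0)}"

definition cycle_basis :: "('v,'h) graph \<Rightarrow> 'h set \<Rightarrow> ('h \<times> 'h) list set set \<Rightarrow> bool" where
  "cycle_basis G T B \<longleftrightarrow> (\<forall>W\<in>B. closed_walk G W) \<and> inj_on (sigma T) B
     \<and> \<not> module.dependent qscale (sigma T ` B)
     \<and> module.span qscale (sigma T ` B) = cycle_space G T"

definition cycle_spanning_set :: "('v,'h) graph \<Rightarrow> 'h set \<Rightarrow> ('h \<times> 'h) list set set \<Rightarrow> bool" where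
  "cycle_spanning_set G T \<Gamma> \<longleftrightarrow> (\<forall>W\<in>\<Gamma>. closed_walk G W) \<and> (\<exists>B\<subseteq>\<Gamma>. cycle_basis G T B)"

definition CM :: "'h set \<Rightarrow> ('h \<times> 'h) list set \<Rightarrow> 'h set \<Rightarrow> rat" where
  "CM T W e = sigma T W e"

definition transitions_at :: "('v,'h) graph \<Rightarrow> 'v \<Rightarrow> 'h set set set" where
  "transitions_at G v = {{{a,b},{c,d}} | a b c d. distinct [a,b,c,d] \<and> {a,b,c,d} = hat G v}"

definition transitions :: "('v,'h) graph \<Rightarrow> 'h set set set" where
  "transitions G = (\<Union>v\<in>verts G. transitions_at G v)"

definition circuit_partition :: "('v,'h) graph \<Rightarrow> ('h \<times> 'h) list set set \<Rightarrow> bool" where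
  "circuit_partition G P \<longleftrightarrow> (\<forall>C\<in>P. circuit G C)
     \<and> (\<forall>h\<in>hedges G. \<exists>!p. p \<in> {(C,s). C \<in> P \<and> s \<in> sts C \<and> h \<in> s})"

definition tau :: "('v,'h) graph \<Rightarrow> ('h \<times> 'h) list set set \<Rightarrow> 'h set set set" where
  "tau G P = {t \<in> transitions G. \<forall>s\<in>t. \<exists>C\<in>P. s \<in> sts C}"

definition transitional_orientation :: "('v,'h) graph \<Rightarrow> ('h set set \<Rightarrow> 'h set) \<Rightarrow> bool" where
  "transitional_orientation G ori \<longleftrightarrow> (\<forall>t\<in>transitions G. ori t \<in> t)"

definition Delta :: "'h set \<Rightarrow> ('h set set \<Rightarrow> 'h set) \<Rightarrow> 'h set \<Rightarrow> 'h set set \<Rightarrow> rat" where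
  "Delta T ori e t =
     (if \<exists>h. e \<inter> ori t = {h} \<and> h \<in> T then 1
      else if \<exists>h. e \<inter> ori t = {h} \<and> h \<notin> T then -1 else 0)"

definition CM_Delta :: "('v,'h) graph \<Rightarrow> 'h set \<Rightarrow> ('h set set \<Rightarrow> 'h set)
     \<Rightarrow> ('h \<times> 'h) list set \<Rightarrow> 'h set set \<Rightarrow> rat" where
  "CM_Delta F T ori W t = (\<Sum>e\<in>edges F. CM T W e * Delta T ori e t)"

definition transversal :: "'u set set \<Rightarrow> 'u set \<Rightarrow> bool" where
  "transversal \<Omega> X \<longleftrightarrow> X \<subseteq> \<Union>\<Omega> \<and> (\<forall>\<omega>\<in>\<Omega>. card (X \<inter> \<omega>) = 1)"

definition subtransversal :: "'u set set \<Rightarrow> 'u set \<Rightarrow> bool" where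
  "subtransversal \<Omega> X \<longleftrightarrow> (\<exists>T. transversal \<Omega> T \<and> X \<subseteq> T)"

definition matroid_rank_on :: "'u set \<Rightarrow> ('u set \<Rightarrow> nat) \<Rightarrow> bool" where
  "matroid_rank_on S r \<longleftrightarrow>
     (\<forall>X\<subseteq>S. r X \<le> card X)
   \<and> (\<forall>X Y. X \<subseteq> Y \<and> Y \<subseteq> S \<longrightarrow> r X \<le> r Y)
   \<and> (\<forall>X Y. X \<subseteq> S \<and> Y \<subseteq> S \<longrightarrow> r (X \<union> Y) + r (X \<inter> Y) \<le> r X + r Y)"

definition multimatroid :: "'u set \<Rightarrow> 'u set set \<Rightarrow> ('u set \<Rightarrow> nat) \<Rightarrow> bool" where
  "multimatroid U \<Omega> r \<longleftrightarrow> finite U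
     \<and> (\<forall>\<omega>\<in>\<Omega>. \<omega> \<noteq> {}) \<and> \<Union>\<Omega> = U
     \<and> (\<forall>\<omega>1\<in>\<Omega>. \<forall>\<omega>2\<in>\<Omega>. \<omega>1 \<noteq> \<omega>2 \<longrightarrow> \<omega>1 \<inter> \<omega>2 = {})
     \<and> (\<forall>S. subtransversal \<Omega> S \<longrightarrow> matroid_rank_on S r)
     \<and> (\<forall>S. \<forall>\<omega>\<in>\<Omega>. \<forall>x\<in>\<omega>. \<forall>y\<in>\<omega>. subtransversal \<Omega> S \<and> S \<inter> \<omega> = {} \<and> x \<noteq> y
           \<longrightarrow> max (r (S \<union> {x})) (r (S \<union> {y})) > r S)"

definition Q_skew :: "('v,'h) graph \<Rightarrow> 'h set set set set" where
  "Q_skew F = {transitions_at F v | v. v \<in> verts F}"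

text \<open>The rank function of the Eulerian 3-matroid Q(F), as the unique multimatroid rank
  function with the prescribed values on transversals (normalised to 0 off subtransversals).\<close>
definition Q_rank :: "('v,'h) graph \<Rightarrow> 'h set set set \<Rightarrow> nat" where
  "Q_rank F = (THE r. multimatroid (transitions F) (Q_skew F) r
      \<and> (\<forall>T P. transversal (Q_skew F) T \<and> circuit_partition F P \<and> tau F P = T
             \<longrightarrow> int (r T) = int (card (verts F)) - (int (card P) - int (ncomp F)))
      \<and> (\<forall>X. \<not> subtransversal (Q_skew F) X \<longrightarrow> r X = 0))"

definition col_rank :: "'w set \<Rightarrow> ('w \<Rightarrow> 'u \<Rightarrow> rat) \<Rightarrow> 'u set \<Rightarrow> nat" where
  "col_rank R M S = vector_space.dim qscale ((\<lambda>u. (\<lambda>w. if w \<in> R then M w u else 0)) ` S)"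

definition represents :: "'u set set \<Rightarrow> ('u set \<Rightarrow> nat) \<Rightarrow> 'w set \<Rightarrow> ('w \<Rightarrow> 'u \<Rightarrow> rat) \<Rightarrow> bool" where
  "represents \<Omega> r R M \<longleftrightarrow> (\<forall>S. subtransversal \<Omega> S \<longrightarrow> col_rank R M S = r S)"

definition strict_rep :: "'u set \<Rightarrow> 'u set set \<Rightarrow> ('u set \<Rightarrow> nat) \<Rightarrow> 'w set \<Rightarrow> ('w \<Rightarrow> 'u \<Rightarrow> rat) \<Rightarrow> bool" where
  "strict_rep U \<Omega> r R M \<longleftrightarrow> represents \<Omega> r R M
     \<and> col_rank R M U = Max {r S | S. subtransversal \<Omega> S}"

end

(* For a transversal X, a linear relation among the columns t in X amounts, by orthogonality of the
   cycle space and the row space of the incidence matrix, to a function kappa on half-edges that is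
   constant on edges and on the single transitions of X: the coefficient of t is the difference of
   the values of kappa on the two single transitions of t. An edge of E could only be crossed with a
   jump, which is excluded by parity, because E has at most one edge per component. Such functions
   are the functions on the circuits of P with tau P = X, and they give the zero relation iff they
   are constant on the components of F; hence the relations have dimension |P| - c(F).
   If two transitions at v were both dependent on a subtransversal avoiding v, the two resulting
   functions would contradict parity at v, so column rank is a multimatroid rank function. Such a
   function is determined by its values on transversals, hence it is that of Q(F).
   For strictness, the columns of a transversal of rank |V| span all columns: the absolute value of a
   cycle vector orthogonal to them is again such a kappa, hence constant on components, and it is
   zero on E, which meets every component. *)

theory Submission
  imports Defs "HOL-Combinatorics.Cycles"
begin

subsection \<open>Linear algebra\<close>

text \<open>Everything is moved from edges to half-edges. A directed edge contributes a difference
  of values at its two ends, so a relation says that \<open>C h + \<pi> (inc F h)\<close> agrees at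
  both ends of every edge outside \<open>E\<close>: here \<pi> collects the coefficients of a
  combination of incidence rows, and \<open>C h\<close> is the coefficient of the transition whose
  chosen pair contains \<open>h\<close>, or 0. This sum is the origin of \<kappa>. The edges and the
  single transitions of a transversal are two perfect matchings of the same set, hence two
  involutions without fixed points. Each parity contradiction exhibits a finite set that one
  matching pairs up completely and the other pairs up except for one half-edge. A definite
  description for the rank of Q(F) demands existence and uniqueness. The column rank itself is the
  witness for existence. Uniqueness demands a circuit partition for every transversal, which is why
  orbits of the product of the two involutions are turned into circuits.\<close>

context vector_space
begin

lemma span_Int_disjoint_independent:
  assumes "independent (A \<union> B)" "A \<inter> B = {}" "x \<in> span A" "x \<in> span B"
  shows "x = 0"
proof -
  have sp: "x \<in> span (A \<union> B)" using assms(3) span_mono[of A "A \<union> B"] by blast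
  have "representation (A \<union> B) x = representation A x" "representation (A \<union> B) x = representation B x"
    using assms by (auto intro!: representation_extend)
  then have "representation (A \<union> B) x b = 0" for b
    using representation_ne_zero[of A x b] representation_ne_zero[of B x b] assms(2) by auto
  then show ?thesis
    using sum_nonzero_representation_eq[OF assms(1) sp] by simp
qed

text \<open>Bases \<open>I\<close>, \<open>J\<close>, \<open>K\<close> of the intersection, of
  \<open>S\<close> and of the union are chosen as a chain. Since \<open>K\<close> adds nothing to
  \<open>J\<close> inside \<open>S\<close>, the vectors of \<open>K - J\<close> lie in
  \<open>T\<close>, and together with \<open>I\<close> they are independent there. Only an
  inequality holds, because \<open>S \<inter> T\<close> intersects generating sets and not
  spans.\<close>

lemma dim_submodular:
  assumes "finite S" "finite T"
  shows "dim (S \<union> T) + dim (S \<inter> T) \<le> dim S + dim T"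
proof -
  obtain I where I: "I \<subseteq> S \<inter> T" "independent I" "S \<inter> T \<subseteq> span I"
    using maximal_independent_subset by blast
  obtain J where J: "I \<subseteq> J" "J \<subseteq> S" "independent J" "S \<subseteq> span J"
    using maximal_independent_subset_extend[of I S] I by blast
  obtain K where K: "J \<subseteq> K" "K \<subseteq> S \<union> T" "independent K" "S \<union> T \<subseteq> span K"
    using maximal_independent_subset_extend[of J "S \<union> T"] J by blast
  have fin: "finite K" "finite J" "finite I"
    using assms I J K by (auto intro: finite_subset)
  have "K \<inter> S \<subseteq> J"
  proof
    fix x assume x: "x \<in> K \<inter> S"
    show "x \<in> J"
    proof (rule ccontr)
      assume "x \<notin> J"
      then have "J \<subseteq> K - {x}" using K by auto
      then have "x \<in> span (K - {x})" using J(4) x span_mono by blast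
      then show False using K(3) x dependent_def by blast
    qed
  qed
  then have sub: "I \<union> (K - J) \<subseteq> T" using I J K by auto
  have "independent (I \<union> (K - J))" using K(3) J K(1) by (elim independent_mono) auto
  then have "card (I \<union> (K - J)) \<le> dim T"
    using sub assms(2)
    by (metis basis_card_eq_dim card_mono finite_subset maximal_independent_subset_extend)
  moreover have "card (I \<union> (K - J)) = card I + (card K - card J)"
    using fin J K by (subst card_Un_disjoint) (auto simp: card_Diff_subset)
  moreover have "card J \<le> card K" using fin K by (simp add: card_mono)
  moreover have "dim (S \<inter> T) = card I" "dim S = card J" "dim (S \<union> T) = card K"
    using I J K basis_card_eq_dim by metis+
  ultimately show ?thesis by linarith
qed

lemma dim_mono_finite:
  assumes "S \<subseteq> span T" "finite T"
  shows "dim S \<le> dim T"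
proof -
  obtain B where B: "B \<subseteq> T" "independent B" "T \<subseteq> span B" "card B = dim T"
    using basis_exists by blast
  have "S \<subseteq> span B" using assms(1) B(3) span_minimal[OF B(3) subspace_span] by blast
  then show ?thesis using dim_le_card[of S B] B assms(2) finite_subset by metis
qed

lemma dim_insert_eq_imp_in_span:
  assumes "finite S" "dim (insert x S) = dim S"
  shows "x \<in> span S"
proof (rule ccontr)
  assume x: "x \<notin> span S"
  obtain B where B: "B \<subseteq> S" "independent B" "S \<subseteq> span B" "card B = dim S"
    using basis_exists by blast
  have "span B = span S" using B by (metis span_eq span_superset subset_trans)
  then have "x \<notin> span B" using x by simp
  then have "independent (insert x B)" "x \<notin> B" using independent_insertI[OF _ B(2)] span_base by blast+
  moreover have "insert x S \<subseteq> span (insert x B)"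
    using B(3) span_mono[of B "insert x B"] by (auto intro: span_base)
  moreover have "insert x B \<subseteq> insert x S" using B by auto
  ultimately have "card (insert x B) = dim (insert x S)" by (metis basis_card_eq_dim)
  moreover have "finite B" using B assms finite_subset by blast
  ultimately show False using assms(2) B(4) \<open>x \<notin> B\<close> by simp
qed

text \<open>Columns form a family, and equal columns collapse in the image set. Full rank excludes
  this, so a relation between indexed columns can be read as one between distinct vectors.\<close>

lemma dim_image_eq_card_imp_inj_independent:
  assumes "finite I" "dim (f ` I) = card I"
  shows "inj_on f I \<and> independent (f ` I)"
proof -
  have "dim (f ` I) \<le> card (f ` I)" using assms(1) by (intro dim_le_card') simp
  then have c: "card (f ` I) = card I" using card_image_le[OF assms(1), of f] assms(2) by simp
  obtain B where B: "B \<subseteq> f ` I" "independent B" "f ` I \<subseteq> span B" "card B = dim (f ` I)"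
    using basis_exists by blast
  have "B = f ` I" using B c assms by (intro card_subset_eq) auto
  then show ?thesis using B c assms eq_card_imp_inj_on by blast
qed

end

context vector_space_pair
begin

text \<open>A basis \<open>A\<close> of the kernel is extended to a basis \<open>C\<close> of
  \<open>K\<close>; \<open>L\<close> is injective on the span of \<open>C - A\<close>, because that
  span meets the span of \<open>A\<close> only in 0. Finiteness enters through \<open>B\<close>
  alone, as the ambient function spaces may have infinite dimension.\<close>

lemma rank_nullity:
  assumes L: "Vector_Spaces.linear s1 s2 L" and K: "vs1.subspace K" and fin: "finite B" "K \<subseteq> vs1.span B"
  shows "vs1.dim K = vs2.dim (L ` K) + vs1.dim {x \<in> K. L x = 0}"
proof -
  define N where "N = {x \<in> K. L x = 0}"
  obtain A where A: "A \<subseteq> N" "vs1.independent A" "N \<subseteq> vs1.span A"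
    using vs1.maximal_independent_subset by blast
  have "A \<subseteq> K" using A N_def by auto
  then obtain C where C: "A \<subseteq> C" "C \<subseteq> K" "vs1.independent C" "K \<subseteq> vs1.span C"
    using vs1.maximal_independent_subset_extend[of A K] A by blast
  define D where "D = C - A"
  have finC: "finite C" using vs1.independent_span_bound[OF fin(1) C(3)] C fin by auto
  have CAD: "C = A \<union> D" "A \<inter> D = {}" using C D_def by auto
  have ind: "vs1.independent D" using C(3) D_def vs1.independent_mono by auto
  have spD: "vs1.span D \<subseteq> K" using D_def C(2) K by (intro vs1.span_minimal) auto
  have inj: "inj_on L (vs1.span D)"
  proof (rule inj_onI)
    fix x y assume xy: "x \<in> vs1.span D" "y \<in> vs1.span D" "L x = L y"
    then have d: "x - y \<in> vs1.span D" by (simp add: vs1.span_diff)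
    moreover have "L (x - y) = 0" using xy linear_diff[OF L] by simp
    ultimately have "x - y \<in> vs1.span A" using spD A N_def by auto
    then have "x - y = 0" using vs1.span_Int_disjoint_independent[of A D "x - y"] d C(3)[unfolded CAD(1)] CAD(2) by blast
    then show "x = y" by (simp only: right_minus_eq)
  qed
  have "vs2.independent (L ` D)" using linear_independent_injective_image[OF L ind inj] .
  moreover have "L ` D \<subseteq> L ` K" using C D_def by auto
  moreover have "L ` K \<subseteq> vs2.span (L ` D)"
  proof -
    have "L ` A \<subseteq> {0}" using A N_def by auto
    then have "L ` C \<subseteq> vs2.span (L ` D)" using CAD vs2.span_zero
      by (auto intro: vs2.span_base)
    then have "vs2.span (L ` C) \<subseteq> vs2.span (L ` D)" by (simp add: vs2.span_minimal)
    then show ?thesis using C(4) linear_span_image[OF L, of C] by blast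
  qed
  ultimately have "card (L ` D) = vs2.dim (L ` K)" by (metis vs2.basis_card_eq_dim)
  moreover have "card (L ` D) = card D"
    using inj vs1.span_superset by (metis card_image inj_on_subset)
  moreover have "card A = vs1.dim N" using A by (metis vs1.basis_card_eq_dim)
  moreover have "card C = vs1.dim K" using C by (metis vs1.basis_card_eq_dim)
  moreover have "card C = card A + card D"
    using CAD finC by (metis card_Un_disjoint finite_Un)
  ultimately show ?thesis using N_def by simp
qed

end

section \<open>Spaces of rational-valued functions\<close>

interpretation qv: vector_space qscale
  by unfold_locales (auto simp: qscale_def fun_eq_iff algebra_simps)

interpretation qv2: vector_space_pair qscale qscale ..

lemma linear_qscaleI:
  assumes "\<And>x y. L (x + y) = L x + L y" "\<And>c x. L (qscale c x) = qscale c (L x)"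
  shows "Vector_Spaces.linear qscale qscale L"
  using assms by (simp add: Vector_Spaces.linear_iff qv.vector_space_axioms)

lemma qscale_apply [simp]: "qscale c f x = c * f x"
  by (simp add: qscale_def)

lemma sum_fun_apply: "(\<Sum>i\<in>I. f i) x = (\<Sum>i\<in>I. f i x)"
  for f :: "'i \<Rightarrow> 'a \<Rightarrow> 'b::comm_monoid_add"
  by (induction I rule: infinite_finite_induct) auto

text \<open>Three choices of \<open>g\<close> occur: the circuit of a half-edge, the component of a
  half-edge, and the identity on a transversal. Vanishing outside a finite \<open>H\<close> makes
  the dimension finite, namely the number of values of \<open>g\<close> on \<open>H\<close>; the
  indicators of the fibres are a basis.\<close>

definition factor_space :: "'a set \<Rightarrow> ('a \<Rightarrow> 'j) \<Rightarrow> ('a \<Rightarrow> rat) set" where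
  "factor_space H g = {\<kappa>. (\<forall>h. h \<notin> H \<longrightarrow> \<kappa> h = 0) \<and> (\<exists>\<phi>. \<forall>h\<in>H. \<kappa> h = \<phi> (g h))}"

lemma factor_space_basis:
  assumes "finite H"
  obtains B where "finite B" "card B = card (g ` H)" "qv.independent B" "qv.span B = factor_space H g"
proof
  define u :: "'b \<Rightarrow> 'a \<Rightarrow> rat" where "u j = (\<lambda>h. if h \<in> H \<and> g h = j then 1 else 0)" for j
  define B where "B = u ` g ` H"
  have inj: "inj_on u (g ` H)"
  proof (rule inj_onI)
    fix i j assume "i \<in> g ` H" "j \<in> g ` H" "u i = u j"
    then obtain h where "h \<in> H" "g h = i" "u i h = u j h" by auto
    then show "i = j" by (auto simp: u_def split: if_splits)
  qed
  have sum_u: "(\<Sum>j\<in>g ` H. qscale (c j) (u j)) = (\<lambda>h. if h \<in> H then c (g h) else 0)" for c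
  proof
    fix h
    show "(\<Sum>j\<in>g ` H. qscale (c j) (u j)) h = (if h \<in> H then c (g h) else 0)"
    proof (cases "h \<in> H")
      case True
      have "(\<Sum>j\<in>g ` H. c j * u j h) = (\<Sum>j\<in>{g h}. c j * u j h)"
        using True assms by (intro sum.mono_neutral_right) (auto simp: u_def)
      then show ?thesis using True by (simp add: sum_fun_apply u_def)
    qed (simp add: sum_fun_apply u_def)
  qed
  show fin: "finite B" using assms by (simp add: B_def)
  show "card B = card (g ` H)" using inj by (simp add: B_def card_image)
  show "qv.independent B"
  proof (rule qv.independent_if_scalars_zero[OF fin])
    fix c b assume z: "(\<Sum>x\<in>B. qscale (c x) x) = 0" and b: "b \<in> B"
    then have "(\<Sum>j\<in>g ` H. qscale (c (u j)) (u j)) = 0"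
      using inj by (simp add: B_def sum.reindex)
    then have *: "(\<lambda>h. if h \<in> H then c (u (g h)) else 0) = 0"
      unfolding sum_u[of "\<lambda>j. c (u j)"] .
    from b obtain h where "h \<in> H" "b = u (g h)" by (auto simp: B_def)
    then show "c b = 0" using fun_cong[OF *, of h] by simp
  qed
  show "qv.span B = factor_space H g"
  proof
    have "qv.subspace (factor_space H g)"
    proof (rule qv.subspaceI)
      show "0 \<in> factor_space H g" by (auto simp: factor_space_def)
    next
      fix x y assume "x \<in> factor_space H g" "y \<in> factor_space H g"
      then obtain p q where "\<forall>h\<in>H. x h = p (g h)" "\<forall>h\<in>H. y h = q (g h)"
        "\<forall>h. h \<notin> H \<longrightarrow> x h = 0" "\<forall>h. h \<notin> H \<longrightarrow> y h = 0" by (auto simp: factor_space_def)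
      then show "x + y \<in> factor_space H g"
        unfolding factor_space_def by (auto intro!: exI[of _ "\<lambda>j. p j + q j"])
    next
      fix c x assume "x \<in> factor_space H g"
      then obtain p where "\<forall>h\<in>H. x h = p (g h)" "\<forall>h. h \<notin> H \<longrightarrow> x h = 0"
        by (auto simp: factor_space_def)
      then show "qscale c x \<in> factor_space H g"
        unfolding factor_space_def by (auto intro!: exI[of _ "\<lambda>j. c * p j"])
    qed
    moreover have "B \<subseteq> factor_space H g"
      by (auto simp: B_def u_def factor_space_def)
    ultimately show "qv.span B \<subseteq> factor_space H g" by (simp add: qv.span_minimal)
    show "factor_space H g \<subseteq> qv.span B"
    proof
      fix \<kappa> assume "\<kappa> \<in> factor_space H g"
      then obtain p where "\<forall>h\<in>H. \<kappa> h = p (g h)" "\<forall>h. h \<notin> H \<longrightarrow> \<kappa> h = 0"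
        by (auto simp: factor_space_def)
      then have "\<kappa> = (\<Sum>j\<in>g ` H. qscale (p j) (u j))" unfolding sum_u by auto
      moreover have "(\<Sum>j\<in>g ` H. qscale (p j) (u j)) \<in> qv.span B"
        by (intro qv.span_sum qv.span_scale qv.span_base) (simp add: B_def)
      ultimately show "\<kappa> \<in> qv.span B" by simp
    qed
  qed
qed

lemma dim_factor_space: "finite H \<Longrightarrow> qv.dim (factor_space H g) = card (g ` H)"
  using factor_space_basis[of H g] by (metis qv.dim_span_eq_card_independent)

lemma subspace_factor_space: "finite H \<Longrightarrow> qv.subspace (factor_space H g)"
  using factor_space_basis[of H g] by (metis qv.subspace_span)

lemma factor_space_rank_nullity:
  assumes "finite H" "Vector_Spaces.linear qscale qscale L"
  shows "card (g ` H) = qv.dim (L ` factor_space H g) + qv.dim {\<kappa> \<in> factor_space H g. L \<kappa> = 0}"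
proof -
  obtain B where "finite B" "qv.span B = factor_space H g"
    using factor_space_basis[OF assms(1), of g] by metis
  then show ?thesis
    using qv2.rank_nullity[OF assms(2) subspace_factor_space[OF assms(1), of g], of B]
      dim_factor_space[OF assms(1), of g] by simp
qed

lemma in_span_image_iff:
  fixes f :: "'i \<Rightarrow> 'a \<Rightarrow> rat"
  assumes "finite I"
  shows "x \<in> qv.span (f ` I) \<longleftrightarrow> (\<exists>c. x = (\<Sum>i\<in>I. qscale (c i) (f i)))"
proof
  have "qv.subspace {x. \<exists>c. x = (\<Sum>i\<in>I. qscale (c i) (f i))}"
  proof (rule qv.subspaceI; clarify)
    show "\<exists>c. 0 = (\<Sum>i\<in>I. qscale (c i) (f i))" by (rule exI[of _ "\<lambda>_. 0"]) simp
  next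
    fix c d :: "'i \<Rightarrow> rat"
    show "\<exists>e. (\<Sum>i\<in>I. qscale (c i) (f i)) + (\<Sum>i\<in>I. qscale (d i) (f i)) = (\<Sum>i\<in>I. qscale (e i) (f i))"
      by (rule exI[of _ "\<lambda>i. c i + d i"]) (simp add: qv.scale_left_distrib sum.distrib)
  next
    fix k and c :: "'i \<Rightarrow> rat"
    show "\<exists>e. qscale k (\<Sum>i\<in>I. qscale (c i) (f i)) = (\<Sum>i\<in>I. qscale (e i) (f i))"
      by (rule exI[of _ "\<lambda>i. k * c i"]) (simp add: qv.scale_sum_right)
  qed
  moreover have "f ` I \<subseteq> {x. \<exists>c. x = (\<Sum>i\<in>I. qscale (c i) (f i))}"
  proof clarify
    fix i assume i: "i \<in> I"
    have "(\<Sum>j\<in>I. qscale (if j = i then 1 else 0) (f j)) = (\<Sum>j\<in>I. if j = i then f j else 0)"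
      by (intro sum.cong) auto
    then show "\<exists>c. f i = (\<Sum>j\<in>I. qscale (c j) (f j))"
      using i assms by (intro exI[of _ "\<lambda>j. if j = i then 1 else 0"]) simp
  qed
  ultimately have "qv.span (f ` I) \<subseteq> {x. \<exists>c. x = (\<Sum>i\<in>I. qscale (c i) (f i))}"
    by (rule qv.span_minimal[rotated])
  then show "x \<in> qv.span (f ` I) \<Longrightarrow> \<exists>c. x = (\<Sum>i\<in>I. qscale (c i) (f i))" by blast
next
  assume "\<exists>c. x = (\<Sum>i\<in>I. qscale (c i) (f i))"
  then obtain c where x: "x = (\<Sum>i\<in>I. qscale (c i) (f i))" by blast
  show "x \<in> qv.span (f ` I)"
    unfolding x by (intro qv.span_sum qv.span_scale qv.span_base imageI)
qed

text \<open>Duality, by induction on the rows. If row \<open>j\<close> vanishes wherever the rows of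
  \<open>I\<close> do, it gets coefficient 0. Otherwise some \<open>w\<close> lies in the kernel of
  \<open>I\<close> but not in that of row \<open>j\<close>, and every kernel vector of
  \<open>I\<close> can be corrected by a multiple of \<open>w\<close> to a kernel vector of all
  rows.\<close>

lemma functional_in_row_space:
  fixes A :: "'i \<Rightarrow> 'x \<Rightarrow> rat"
  assumes "finite I" "finite X"
    and "\<And>z. (\<And>i. i \<in> I \<Longrightarrow> (\<Sum>x\<in>X. A i x * z x) = 0) \<Longrightarrow> (\<Sum>x\<in>X. y x * z x) = 0"
  shows "\<exists>\<pi>. \<forall>x\<in>X. y x = (\<Sum>i\<in>I. \<pi> i * A i x)"
  using assms(1,3)
proof (induction I arbitrary: y)
  case empty
  have "y x = 0" if x: "x \<in> X" for x
  proof -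
    have "(\<Sum>a\<in>X. y a * (if a = x then 1 else 0)) = 0" by (rule empty.prems) simp
    moreover have "(\<Sum>a\<in>X. y a * (if a = x then 1 else 0)) = (\<Sum>a\<in>X. if a = x then y a else 0)"
      by (intro sum.cong) auto
    ultimately show ?thesis using x assms(2) by simp
  qed
  then show ?case by simp
next
  case (insert j I)
  show ?case
  proof (cases "\<exists>w. (\<forall>i\<in>I. (\<Sum>x\<in>X. A i x * w x) = 0) \<and> (\<Sum>x\<in>X. A j x * w x) \<noteq> 0")
    case False
    then have "\<exists>\<pi>. \<forall>x\<in>X. y x = (\<Sum>i\<in>I. \<pi> i * A i x)"
      using insert.prems by (intro insert.IH) blast
    then obtain \<pi> where "\<forall>x\<in>X. y x = (\<Sum>i\<in>I. \<pi> i * A i x)" by blast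
    moreover have "(\<Sum>i\<in>I. (\<pi>(j := 0)) i * A i x) = (\<Sum>i\<in>I. \<pi> i * A i x)" for x
      using insert.hyps by (intro sum.cong) auto
    ultimately show ?thesis using insert.hyps by (intro exI[of _ "\<pi>(j := 0)"]) simp
  next
    case True
    then obtain w where w: "\<forall>i\<in>I. (\<Sum>x\<in>X. A i x * w x) = 0" "(\<Sum>x\<in>X. A j x * w x) \<noteq> 0" by blast
    define a where "a = (\<Sum>x\<in>X. A j x * w x)"
    define b where "b = (\<Sum>x\<in>X. y x * w x)"
    \<comment> \<open>Evaluation at \<open>w\<close>, where only row \<open>j\<close> survives,
      forces the coefficient \<open>b / a\<close>.\<close>
    have "\<exists>\<pi>. \<forall>x\<in>X. y x - b / a * A j x = (\<Sum>i\<in>I. \<pi> i * A i x)"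
    proof (rule insert.IH)
      fix z assume z: "\<And>i. i \<in> I \<Longrightarrow> (\<Sum>x\<in>X. A i x * z x) = 0"
      define t where "t = (\<Sum>x\<in>X. A j x * z x)"
      have lin: "(\<Sum>x\<in>X. f x * (z x - t / a * w x)) = (\<Sum>x\<in>X. f x * z x) - t / a * (\<Sum>x\<in>X. f x * w x)" for f
        by (simp add: right_diff_distrib sum_subtractf sum_distrib_left algebra_simps)
      have "(\<Sum>x\<in>X. y x * (z x - t / a * w x)) = 0"
      proof (rule insert.prems)
        fix i assume "i \<in> insert j I"
        then show "(\<Sum>x\<in>X. A i x * (z x - t / a * w x)) = 0"
          unfolding lin using z w by (auto simp: a_def[symmetric] t_def[symmetric])
      qed
      then have "(\<Sum>x\<in>X. y x * z x) = t / a * b" unfolding lin b_def[symmetric] by simp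
      moreover have "(\<Sum>x\<in>X. (y x - b / a * A j x) * z x) = (\<Sum>x\<in>X. y x * z x) - b / a * t"
        by (simp add: left_diff_distrib sum_subtractf sum_distrib_left mult.assoc t_def)
      ultimately show "(\<Sum>x\<in>X. (y x - b / a * A j x) * z x) = 0" by simp
    qed
    then obtain \<pi> where p: "\<forall>x\<in>X. y x - b / a * A j x = (\<Sum>i\<in>I. \<pi> i * A i x)" by blast
    moreover have "(\<Sum>i\<in>I. (\<pi>(j := b / a)) i * A i x) = (\<Sum>i\<in>I. \<pi> i * A i x)" for x
      using insert.hyps by (intro sum.cong) auto
    ultimately show ?thesis
      using insert.hyps by (intro exI[of _ "\<pi>(j := b / a)"]) (simp add: algebra_simps)
  qed
qed

text \<open>The image of an intersection is contained in the intersection of the images, possibly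
  properly when vectors repeat; this is the direction in which submodularity is preserved.\<close>

lemma matroid_rank_on_dim_image:
  assumes "finite S"
  shows "matroid_rank_on S (\<lambda>X. qv.dim (f ` X))"
  unfolding matroid_rank_on_def
proof (intro conjI allI impI; (elim conjE)?)
  fix X assume "X \<subseteq> S"
  then have "finite X" using assms finite_subset by blast
  then show "qv.dim (f ` X) \<le> card X"
    using qv.dim_le_card'[of "f ` X"] card_image_le[of X f] by simp
next
  fix X Y assume "X \<subseteq> Y" "Y \<subseteq> S"
  then show "qv.dim (f ` X) \<le> qv.dim (f ` Y)"
    using finite_subset[OF _ assms, of Y] by (intro qv.dim_mono_finite) (auto intro!: qv.span_base)
next
  fix X Y assume XY: "X \<subseteq> S" "Y \<subseteq> S"
  then have fin: "finite X" "finite Y" using assms finite_subset by blast+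
  have "qv.dim (f ` (X \<inter> Y)) \<le> qv.dim (f ` X \<inter> f ` Y)"
    using fin by (intro qv.dim_mono_finite) (auto intro!: qv.span_base)
  then show "qv.dim (f ` (X \<union> Y)) + qv.dim (f ` (X \<inter> Y)) \<le> qv.dim (f ` X) + qv.dim (f ` Y)"
    using qv.dim_submodular[of "f ` X" "f ` Y"] fin by (simp add: image_Un)
qed

subsection \<open>Multimatroids\<close>

lemma transversal_card:
  assumes "finite \<Omega>" "\<forall>\<omega>1\<in>\<Omega>. \<forall>\<omega>2\<in>\<Omega>. \<omega>1 \<noteq> \<omega>2 \<longrightarrow> \<omega>1 \<inter> \<omega>2 = {}" "transversal \<Omega> X"
  shows "card X = card \<Omega>"
proof -
  have "X = (\<Union>\<omega>\<in>\<Omega>. X \<inter> \<omega>)" using assms(3) by (auto simp: transversal_def)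
  moreover have "card (\<Union>\<omega>\<in>\<Omega>. X \<inter> \<omega>) = (\<Sum>\<omega>\<in>\<Omega>. card (X \<inter> \<omega>))"
  proof (rule card_UN_disjoint[OF assms(1)])
    show "\<forall>\<omega>\<in>\<Omega>. finite (X \<inter> \<omega>)"
      using assms(3) by (auto simp: transversal_def intro: card_ge_0_finite)
    show "\<forall>i\<in>\<Omega>. \<forall>j\<in>\<Omega>. i \<noteq> j \<longrightarrow> X \<inter> i \<inter> (X \<inter> j) = {}" using assms(2) by blast
  qed
  ultimately show ?thesis using assms(3) by (simp add: transversal_def)
qed

lemma transversal_exchange:
  assumes "\<forall>\<omega>1\<in>\<Omega>. \<forall>\<omega>2\<in>\<Omega>. \<omega>1 \<noteq> \<omega>2 \<longrightarrow> \<omega>1 \<inter> \<omega>2 = {}" "transversal \<Omega> X" "\<omega> \<in> \<Omega>" "x \<in> \<omega>"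
  shows "transversal \<Omega> (insert x (X - \<omega>))"
  unfolding transversal_def
proof (intro conjI ballI)
  show "insert x (X - \<omega>) \<subseteq> \<Union> \<Omega>" using assms by (auto simp: transversal_def)
next
  fix \<omega>' assume w: "\<omega>' \<in> \<Omega>"
  show "card (insert x (X - \<omega>) \<inter> \<omega>') = 1"
  proof (cases "\<omega>' = \<omega>")
    case True
    then have "insert x (X - \<omega>) \<inter> \<omega>' = {x}" using assms by auto
    then show ?thesis by simp
  next
    case False
    then have "\<omega>' \<inter> \<omega> = {}" using assms(1,3) w by simp
    then have "insert x (X - \<omega>) \<inter> \<omega>' = X \<inter> \<omega>'" using assms by auto
    then show ?thesis using assms w by (simp add: transversal_def)
  qed
qed

lemma subtransversal_insert:
  assumes "\<forall>\<omega>1\<in>\<Omega>. \<forall>\<omega>2\<in>\<Omega>. \<omega>1 \<noteq> \<omega>2 \<longrightarrow> \<omega>1 \<inter> \<omega>2 = {}" "subtransversal \<Omega> S" "\<omega> \<in> \<Omega>" "x \<in> \<omega>"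
    "S \<inter> \<omega> = {}"
  shows "subtransversal \<Omega> (insert x S)"
proof -
  obtain X where "transversal \<Omega> X" "S \<subseteq> X" using assms by (auto simp: subtransversal_def)
  then show ?thesis
    using transversal_exchange[OF assms(1) _ assms(3,4), of X] assms(5)
    unfolding subtransversal_def by blast
qed

lemma subtransversal_full:
  assumes "subtransversal \<Omega> S" "\<forall>\<omega>\<in>\<Omega>. S \<inter> \<omega> \<noteq> {}"
  shows "transversal \<Omega> S"
proof -
  obtain X where X: "transversal \<Omega> X" "S \<subseteq> X" using assms by (auto simp: subtransversal_def)
  have "X \<subseteq> S"
  proof
    fix x assume x: "x \<in> X"
    then obtain \<omega> where w: "\<omega> \<in> \<Omega>" "x \<in> \<omega>" using X by (auto simp: transversal_def)
    then have "card (X \<inter> \<omega>) = 1" using X by (auto simp: transversal_def)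
    then obtain y where y: "X \<inter> \<omega> = {y}" by (auto simp: card_1_singleton_iff)
    obtain z where z: "z \<in> S" "z \<in> \<omega>" using assms(2) w by auto
    then have "z \<in> X \<inter> \<omega>" "x \<in> X \<inter> \<omega>" using x w X(2) by auto
    then show "x \<in> S" using z unfolding y by simp
  qed
  then show ?thesis using X by auto
qed

lemma transversal_exists:
  assumes "\<forall>\<omega>1\<in>\<Omega>. \<forall>\<omega>2\<in>\<Omega>. \<omega>1 \<noteq> \<omega>2 \<longrightarrow> \<omega>1 \<inter> \<omega>2 = {}" "\<forall>\<omega>\<in>\<Omega>. \<omega> \<noteq> {}"
  obtains X where "transversal \<Omega> X"
proof -
  define f where "f \<omega> = (SOME x. x \<in> \<omega>)" for \<omega> :: "'a set"
  have f: "f \<omega> \<in> \<omega>" if "\<omega> \<in> \<Omega>" for \<omega>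
    using assms(2) that unfolding f_def by (simp add: some_in_eq)
  have "f ` \<Omega> \<inter> \<omega> = {f \<omega>}" if w: "\<omega> \<in> \<Omega>" for \<omega>
  proof
    show "f ` \<Omega> \<inter> \<omega> \<subseteq> {f \<omega>}"
    proof
      fix x assume "x \<in> f ` \<Omega> \<inter> \<omega>"
      then obtain \<omega>' where w': "\<omega>' \<in> \<Omega>" "x = f \<omega>'" "x \<in> \<omega>" by auto
      then have "\<omega>' \<inter> \<omega> \<noteq> {}" using f[OF w'(1)] by auto
      then have "\<omega>' = \<omega>" using assms(1) w w'(1) by auto
      then show "x \<in> {f \<omega>}" using w' by simp
    qed
  qed (use f w in auto)
  then have "transversal \<Omega> (f ` \<Omega>)" using f by (auto simp: transversal_def)
  then show ?thesis using that by blast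
qed

lemma multimatroidD:
  assumes "multimatroid U \<Omega> r"
  shows "finite U" "\<Union>\<Omega> = U" "\<forall>\<omega>1\<in>\<Omega>. \<forall>\<omega>2\<in>\<Omega>. \<omega>1 \<noteq> \<omega>2 \<longrightarrow> \<omega>1 \<inter> \<omega>2 = {}"
    "subtransversal \<Omega> S \<Longrightarrow> matroid_rank_on S r"
    "\<lbrakk>\<omega> \<in> \<Omega>; x \<in> \<omega>; y \<in> \<omega>; subtransversal \<Omega> S; S \<inter> \<omega> = {}; x \<noteq> y\<rbrakk>
      \<Longrightarrow> r S < max (r (S \<union> {x})) (r (S \<union> {y}))"
  using assms unfolding multimatroid_def by simp_all

context
  fixes U :: "'u set" and \<Omega> :: "'u set set" and r :: "'u set \<Rightarrow> nat"
  assumes mm: "multimatroid U \<Omega> r"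
    and two: "\<forall>\<omega>\<in>\<Omega>. \<exists>x\<in>\<omega>. \<exists>y\<in>\<omega>. x \<noteq> y"
begin

lemma multimatroid_rank_insert_le:
  assumes "subtransversal \<Omega> (insert x S)"
  shows "r S \<le> r (insert x S)" "r (insert x S) \<le> Suc (r S)"
proof -
  have "matroid_rank_on (insert x S) r" using multimatroidD(4)[OF mm assms] .
  then have *: "\<forall>X\<subseteq>insert x S. r X \<le> card X" "\<forall>X Y. X \<subseteq> Y \<and> Y \<subseteq> insert x S \<longrightarrow> r X \<le> r Y"
    "\<forall>X Y. X \<subseteq> insert x S \<and> Y \<subseteq> insert x S \<longrightarrow> r (X \<union> Y) + r (X \<inter> Y) \<le> r X + r Y"
    unfolding matroid_rank_on_def by simp_all
  show "r S \<le> r (insert x S)" using *(2)[rule_format, of S "insert x S"] by blast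
  have "r (S \<union> {x}) + r (S \<inter> {x}) \<le> r S + r {x}" using *(3)[rule_format, of S "{x}"] by blast
  moreover have "r {x} \<le> 1" using *(1)[rule_format, of "{x}"] by simp
  ultimately show "r (insert x S) \<le> Suc (r S)" by simp
qed

lemma multimatroid_rank_grows:
  assumes S: "subtransversal \<Omega> S" and w: "\<omega> \<in> \<Omega>" "S \<inter> \<omega> = {}"
  obtains x where "x \<in> \<omega>" "subtransversal \<Omega> (insert x S)" "r (insert x S) = Suc (r S)"
proof -
  note disj = multimatroidD(3)[OF mm]
  obtain x y where xy: "x \<in> \<omega>" "y \<in> \<omega>" "x \<noteq> y" using two w by blast
  have "max (r (S \<union> {x})) (r (S \<union> {y})) > r S"
    using multimatroidD(5)[OF mm w(1) xy(1,2) S w(2) xy(3)] .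
  then obtain z where z: "z \<in> \<omega>" "r (insert z S) > r S"
    using xy by (auto simp: max_def split: if_splits)
  have "subtransversal \<Omega> (insert z S)" by (rule subtransversal_insert[OF disj S w(1) z(1) w(2)])
  then show ?thesis using that z multimatroid_rank_insert_le[of z S] by simp
qed

text \<open>A largest subtransversal of full rank meets every skew class, since a missed class would
  offer an element that raises the rank. For strictness, the columns of such a transversal are later
  shown to span all columns.\<close>

lemma multimatroid_full_rank_transversal:
  obtains X where "transversal \<Omega> X" "r X = card X"
proof -
  define Q where "Q S \<longleftrightarrow> subtransversal \<Omega> S \<and> r S = card S" for S
  note disj = multimatroidD(3)[OF mm] and U = multimatroidD(1,2)[OF mm]
  obtain X0 where X0: "transversal \<Omega> X0"
  proof (rule transversal_exists[OF disj])
    show "\<forall>\<omega>\<in>\<Omega>. \<omega> \<noteq> {}" using two by auto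
  qed
  have sub: "S \<subseteq> U" if "subtransversal \<Omega> S" for S
    using that U by (auto simp: subtransversal_def transversal_def)
  have e: "subtransversal \<Omega> {}" using X0 by (auto simp: subtransversal_def)
  then have "matroid_rank_on {} r" using multimatroidD(4)[OF mm] by blast
  then have "r {} \<le> card ({} :: 'u set)" by (simp add: matroid_rank_on_def)
  then have "Q {}" using e by (simp add: Q_def)
  moreover have "\<forall>S. Q S \<longrightarrow> card S < Suc (card U)" using sub U by (auto simp: Q_def less_Suc_eq_le intro: card_mono)
  ultimately have "\<exists>S. Q S \<and> (\<forall>S'. Q S' \<longrightarrow> card S' \<le> card S)"
    by (rule ex_has_greatest_nat)
  then obtain S where S: "Q S" "\<And>S'. Q S' \<Longrightarrow> card S' \<le> card S" by blast
  have sS: "subtransversal \<Omega> S" "r S = card S" using S(1) by (simp_all add: Q_def)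
  have "S \<inter> \<omega> \<noteq> {}" if w: "\<omega> \<in> \<Omega>" for \<omega>
  proof
    assume d: "S \<inter> \<omega> = {}"
    obtain x where x: "x \<in> \<omega>" "subtransversal \<Omega> (insert x S)" "r (insert x S) = Suc (r S)"
      using multimatroid_rank_grows[OF sS(1) w d] .
    have "finite S" "x \<notin> S" using finite_subset[OF sub[OF sS(1)] U(1)] d x(1) by auto
    then have "Q (insert x S)" "card (insert x S) > card S" using x sS by (auto simp: Q_def)
    then show False using S(2)[of "insert x S"] by simp
  qed
  then have "transversal \<Omega> S" using subtransversal_full[OF sS(1)] by blast
  then show ?thesis using that sS by blast
qed

end

text \<open>Every skew class missed by a subtransversal has an element raising the rank by exactly one,
  so ranks are determined from the transversals downwards.\<close>
lemma multimatroid_rank_le: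
  assumes mm: "multimatroid U \<Omega> r1" "multimatroid U \<Omega> r2"
    and two: "\<forall>\<omega>\<in>\<Omega>. \<exists>x\<in>\<omega>. \<exists>y\<in>\<omega>. x \<noteq> y"
    and eq: "\<And>X. transversal \<Omega> X \<Longrightarrow> r1 X \<le> r2 X"
    and S: "subtransversal \<Omega> S"
  shows "r1 S \<le> r2 S"
  using S
proof (induction "card {\<omega>\<in>\<Omega>. S \<inter> \<omega> = {}}" arbitrary: S rule: less_induct)
  case less
  have "finite U" "\<Union>\<Omega> = U" using multimatroidD(1,2)[OF mm(1)] .
  then have fin: "finite \<Omega>" by (metis finite_UnionD)
  show ?case
  proof (cases "\<forall>\<omega>\<in>\<Omega>. S \<inter> \<omega> \<noteq> {}")
    case True
    then show ?thesis using eq subtransversal_full less.prems by blast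
  next
    case False
    then obtain \<omega> where w: "\<omega> \<in> \<Omega>" "S \<inter> \<omega> = {}" by blast
    \<comment> \<open>\<open>x\<close> is chosen for \<open>r1\<close>, where it gains exactly one,
      while \<open>r2\<close> can gain at most one. So the comparison passes down from
      \<open>insert x S\<close> to \<open>S\<close>.\<close>
    obtain x where x: "x \<in> \<omega>" "subtransversal \<Omega> (insert x S)" "r1 (insert x S) = Suc (r1 S)"
      using multimatroid_rank_grows[OF mm(1) two less.prems w] by blast
    have "\<omega> \<in> {\<omega>\<in>\<Omega>. S \<inter> \<omega> = {}}" "\<omega> \<notin> {\<omega>\<in>\<Omega>. insert x S \<inter> \<omega> = {}}" using w x by auto
    then have "{\<omega>\<in>\<Omega>. insert x S \<inter> \<omega> = {}} \<subset> {\<omega>\<in>\<Omega>. S \<inter> \<omega> = {}}" by blast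
    then have "card {\<omega>\<in>\<Omega>. insert x S \<inter> \<omega> = {}} < card {\<omega>\<in>\<Omega>. S \<inter> \<omega> = {}}"
      using fin by (intro psubset_card_mono) auto
    then have "r1 (insert x S) \<le> r2 (insert x S)" using less.hyps x by blast
    then show ?thesis
      using x multimatroid_rank_insert_le(2)[OF mm(2) two x(2)] by simp
  qed
qed

subsection \<open>Pairings\<close>

text \<open>One notion for three objects: the edges on the half-edges of a graph, the single
  transitions of a transversal, and the two single transitions of one transition on the half-edges
  at its vertex.\<close>

definition pairing :: "'h set \<Rightarrow> 'h set set \<Rightarrow> bool" where
  "pairing H M \<longleftrightarrow> (\<forall>s\<in>M. card s = 2) \<and> (\<forall>s\<in>M. \<forall>s'\<in>M. s \<noteq> s' \<longrightarrow> s \<inter> s' = {}) \<and> \<Union>M = H"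

definition mate :: "'h set set \<Rightarrow> 'h \<Rightarrow> 'h" where
  "mate M h = (THE h'. {h, h'} \<in> M \<and> h \<noteq> h')"

lemma pairingD:
  assumes "pairing H M"
  shows "s \<in> M \<Longrightarrow> card s = 2" "\<lbrakk>s \<in> M; s' \<in> M; h \<in> s; h \<in> s'\<rbrakk> \<Longrightarrow> s = s'"
    "\<lbrakk>s \<in> M; h \<in> s\<rbrakk> \<Longrightarrow> h \<in> H" "h \<in> H \<Longrightarrow> \<exists>s\<in>M. h \<in> s"
  using assms unfolding pairing_def by auto

lemma mate_eqI:
  assumes "pairing H M" "{h, h'} \<in> M"
  shows "mate M h = h'"
  unfolding mate_def
proof (rule the_equality)
  show "{h, h'} \<in> M \<and> h \<noteq> h'" using assms pairingD(1)[OF assms(1,2)] by auto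
next
  fix k assume "{h, k} \<in> M \<and> h \<noteq> k"
  then have "{h, k} = {h, h'}" using pairingD(2)[OF assms(1) _ assms(2), of "{h, k}" h] by simp
  then show "k = h'" by (auto simp: doubleton_eq_iff)
qed

context
  fixes H :: "'h set" and M :: "'h set set"
  assumes P: "pairing H M"
begin

lemma pair_eq_mate:
  assumes "s \<in> M" "h \<in> s"
  shows "s = {h, mate M h}"
proof -
  have "card s = 2" using pairingD(1)[OF P assms(1)] .
  then obtain k where "s = {h, k}" using assms(2) by (auto simp: card_2_iff)
  then show ?thesis using mate_eqI[OF P, of h k] assms by simp
qed

lemma mate_pair_in: "h \<in> H \<Longrightarrow> {h, mate M h} \<in> M"
  using pairingD(4)[OF P, of h] pair_eq_mate by force

lemma mate_neq: "h \<in> H \<Longrightarrow> mate M h \<noteq> h"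
  using pairingD(1)[OF P mate_pair_in, of h] by auto

lemma mate_in: "h \<in> H \<Longrightarrow> mate M h \<in> H"
  using pairingD(3)[OF P mate_pair_in] by blast

lemma mate_mate: "h \<in> H \<Longrightarrow> mate M (mate M h) = h"
  using mate_pair_in[of h] by (intro mate_eqI[OF P]) (simp add: insert_commute)

text \<open>\<open>mate M\<close> is an involution without fixed points, so the set splits into
  pairs. Both parity contradictions rest on this count: no jump across a deleted edge, and no two
  redundant transitions at one vertex.\<close>

lemma even_card_mate_closed:
  assumes "finite A" "A \<subseteq> H" "\<And>h. h \<in> A \<Longrightarrow> mate M h \<in> A"
  shows "even (card A)"
  using assms
proof (induction A rule: finite_psubset_induct)
  case (psubset A)
  show ?case
  proof (cases "A = {}")
    case False
    then obtain a where a: "a \<in> A" by blast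
    let ?B = "A - {a, mate M a}"
    have aH: "a \<in> H" "mate M a \<in> A" "mate M a \<noteq> a"
      using a psubset.prems(1) psubset.prems(2)[OF a] mate_neq by blast+
    have "mate M h \<in> ?B" if h: "h \<in> ?B" for h
    proof -
      have "mate M (mate M h) = h" "mate M (mate M a) = a" using h aH psubset.prems(1) mate_mate by blast+
      moreover have "mate M h \<in> A" using h psubset.prems(2) by blast
      ultimately show ?thesis using h by auto
    qed
    moreover have "?B \<subset> A" "?B \<subseteq> H" using a psubset.prems(1) by auto
    ultimately have "even (card ?B)" by (intro psubset.IH)
    moreover have "card {a, mate M a} = 2" using aH by simp
    moreover have "card ?B = card A - card {a, mate M a}"
      using a aH psubset.hyps by (intro card_Diff_subset) auto
    moreover have "card {a, mate M a} \<le> card A"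
      using a aH psubset.hyps by (intro card_mono) auto
    ultimately show ?thesis by simp
  qed simp
qed

end

subsection \<open>Graphs and the cycle space\<close>

lemma sum_cyclic_shift:
  fixes g :: "nat \<Rightarrow> rat"
  shows "(\<Sum>i<n. g ((i + 1) mod n)) = (\<Sum>i<n. g i)"
proof (cases n)
  case (Suc k)
  have "(\<Sum>i<Suc k. g ((i + 1) mod Suc k)) = (\<Sum>i<k. g (Suc i)) + g 0"
    by (simp add: sum.lessThan_Suc)
  then show ?thesis unfolding Suc by (simp only: sum.lessThan_Suc_shift add.commute)
qed simp

text \<open>The sign changes under the edge matching, so multiplication by it turns edge quantities
  that depend on the direction into antisymmetric functions on half-edges.\<close>

definition sgnh :: "'h set \<Rightarrow> 'h \<Rightarrow> rat" where
  "sgnh T h = (if h \<in> T then 1 else - 1)"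

context
  fixes G :: "('v,'h) graph"
  assumes wf: "wf_graph G"
begin

lemma pairing_edges: "pairing (hedges G) (edges G)"
  using wf unfolding wf_graph_def pairing_def by simp

lemma wf_graph_finite: "finite (verts G)" "finite (hedges G)" "finite (edges G)"
proof -
  show "finite (verts G)" and f: "finite (hedges G)" using wf by (simp_all add: wf_graph_def)
  have "edges G \<subseteq> Pow (hedges G)" using wf by (auto simp: wf_graph_def)
  then show "finite (edges G)" using f by (meson finite_Pow_iff finite_subset)
qed

lemma inc_in_verts: "h \<in> hedges G \<Longrightarrow> inc G h \<in> verts G"
  using wf by (simp add: wf_graph_def)

lemma sym_adj: "sym (adj G)"
  by (auto simp: adj_def sym_def)

lemma adj_mate: "h \<in> hedges G \<Longrightarrow> (inc G h, inc G (mate (edges G) h)) \<in> adj G"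
  unfolding adj_def using mate_pair_in[OF pairing_edges, of h]
  by (intro CollectI case_prodI bexI[of _ "{h, mate (edges G) h}"] bexI[of _ h] bexI[of _ "mate (edges G) h"]) auto

lemma adjE:
  assumes "(u, v) \<in> adj G"
  obtains h h' where "h \<in> hedges G" "h' \<in> hedges G" "u = inc G h" "v = inc G h'" "h' = h \<or> h' = mate (edges G) h"
proof -
  obtain e h h' where e: "e \<in> edges G" "h \<in> e" "h' \<in> e" "u = inc G h" "v = inc G h'"
    using assms by (auto simp: adj_def)
  have "h' = h \<or> h' = mate (edges G) h" using pair_eq_mate[OF pairing_edges e(1,2)] e(3) by blast
  then show ?thesis
    by (rule that[OF pairingD(3)[OF pairing_edges e(1,2)] pairingD(3)[OF pairing_edges e(1,3)] e(4,5)])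
qed

lemma equiv_conn: "equiv (verts G) (conn G)"
proof (rule equivI)
  have "adj G \<subseteq> verts G \<times> verts G" by (auto elim!: adjE intro: inc_in_verts)
  then have "(adj G)\<^sup>+ \<subseteq> verts G \<times> verts G" by (rule trancl_subset_Sigma)
  then show sub: "conn G \<subseteq> verts G \<times> verts G" by (auto simp: conn_def)
  show "refl_on (verts G) (conn G)" by (auto simp: refl_on_def conn_def)
  have "sym ((adj G)\<^sup>+)" using sym_adj by (rule sym_trancl)
  then show "sym (conn G)" by (auto simp: conn_def sym_def)
  show "trans (conn G)"
  proof (rule transI)
    fix x y z assume "(x, y) \<in> conn G" "(y, z) \<in> conn G"
    then have "x = y \<or> (x, y) \<in> (adj G)\<^sup>+" "y = z \<or> (y, z) \<in> (adj G)\<^sup>+" "(x, y) \<in> conn G" "(y, z) \<in> conn G"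
      by (auto simp: conn_def)
    then show "(x, z) \<in> conn G" using trancl_trans[of x y "adj G" z] by (auto simp: conn_def)
  qed
qed

lemma conn_mate: "h \<in> hedges G \<Longrightarrow> (inc G h, inc G (mate (edges G) h)) \<in> conn G"
  using adj_mate by (auto simp: conn_def)

lemma conn_invariant:
  assumes "(u, v) \<in> conn G" and "\<And>h. h \<in> hedges G \<Longrightarrow> f (inc G (mate (edges G) h)) = f (inc G h)"
  shows "f u = f v"
proof -
  have step: "f u = f v" if "(u, v) \<in> adj G" for u v
    using that by (rule adjE) (use assms(2) in auto)
  have "f u = f v" if "(u, v) \<in> (adj G)\<^sup>+" for u v
    using that by (induction rule: trancl_induct) (use step in auto)
  then show ?thesis using assms(1) by (auto simp: conn_def)
qed

context
  fixes T :: "'h set"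
  assumes dir: "directed_version G T"
begin

lemma tail_mate_iff:
  assumes "h \<in> hedges G"
  shows "mate (edges G) h \<in> T \<longleftrightarrow> h \<notin> T"
proof -
  let ?k = "mate (edges G) h"
  have "card ({h, ?k} \<inter> T) = 1"
    using dir mate_pair_in[OF pairing_edges assms] by (auto simp: directed_version_def)
  moreover have "?k \<noteq> h" using mate_neq[OF pairing_edges assms] .
  moreover have "{h, ?k} \<inter> T = (if h \<in> T then {h} else {}) \<union> (if ?k \<in> T then {?k} else {})" by auto
  ultimately show ?thesis by (auto split: if_splits)
qed

lemma sgnh_mate: "h \<in> hedges G \<Longrightarrow> sgnh T (mate (edges G) h) = - sgnh T h"
  using tail_mate_iff by (simp add: sgnh_def)

lemma edge_tailE:
  assumes "e \<in> edges G"
  obtains h where "h \<in> hedges G" "h \<in> T" "mate (edges G) h \<notin> T" "e = {h, mate (edges G) h}"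
proof -
  have "card (e \<inter> T) = 1" using dir assms by (simp add: directed_version_def)
  then obtain h where "h \<in> e" "h \<in> T" by (metis IntE card_1_singletonE insertI1)
  moreover have "h \<in> hedges G" using pairingD(3)[OF pairing_edges assms \<open>h \<in> e\<close>] .
  ultimately show ?thesis
    using that pair_eq_mate[OF pairing_edges assms] tail_mate_iff by blast
qed

text \<open>The minus sign arises because heads count positively in \<open>incmat\<close>, while
  \<open>sgnh\<close> is positive on tails. At a loop both half-edges lie at the same vertex and
  cancel.\<close>

lemma incmat_eq_sum:
  assumes "e \<in> edges G"
  shows "incmat G T v e = (\<Sum>h\<in>e. if inc G h = v then - sgnh T h else 0)"
proof -
  obtain h where h: "h \<in> T" "mate (edges G) h \<notin> T" "e = {h, mate (edges G) h}" "h \<in> hedges G"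
    using edge_tailE[OF assms] by metis
  define k where "k = mate (edges G) h"
  have ne: "h \<noteq> k" using h k_def by auto
  have "{x \<in> e - T. inc G x = v} = (if inc G k = v then {k} else {})"
    "{x \<in> e \<inter> T. inc G x = v} = (if inc G h = v then {h} else {})" using h k_def by auto
  then have "incmat G T v e = (if inc G k = v then 1 else 0) - (if inc G h = v then 1 else 0)"
    unfolding incmat_def by simp
  then show ?thesis using h ne by (simp add: sgnh_def k_def[symmetric])
qed

lemma sum_edges_half_edges:
  fixes g :: "'h set \<Rightarrow> rat"
  shows "(\<Sum>e\<in>edges G. g e * (\<Sum>h\<in>e. f h)) = (\<Sum>h\<in>hedges G. g {h, mate (edges G) h} * f h)"
proof -
  have U: "hedges G = \<Union>(edges G)" using pairing_edges by (simp add: pairing_def)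
  have "(\<Sum>h\<in>\<Union>(edges G). g {h, mate (edges G) h} * f h)
      = (\<Sum>e\<in>edges G. \<Sum>h\<in>e. g {h, mate (edges G) h} * f h)"
  proof (subst sum.Union_disjoint)
    show "\<forall>e\<in>edges G. finite e" using pairingD(1)[OF pairing_edges] by (metis card.infinite zero_neq_numeral)
    show "\<forall>e\<in>edges G. \<forall>e'\<in>edges G. e \<noteq> e' \<longrightarrow> e \<inter> e' = {}"
      using pairing_edges by (simp add: pairing_def)
  qed simp
  also have "\<dots> = (\<Sum>e\<in>edges G. \<Sum>h\<in>e. g e * f h)"
    using pair_eq_mate[OF pairing_edges] by (intro sum.cong) auto
  finally show ?thesis unfolding U by (simp add: sum_distrib_left)
qed

text \<open>Kirchhoff's law for a closed walk: each traversal counts +1 where it arrives and -1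
  where it leaves, and it leaves from the vertex at which the preceding traversal arrived. The sum
  telescopes cyclically.\<close>

lemma sigma_list_in_cycle_space:
  assumes w: "cwalk_list G w"
  shows "sigma_list T w \<in> cycle_space G T"
proof -
  define n where "n = length w"
  \<comment> \<open>\<open>x i\<close> is the half-edge through which traversal \<open>i\<close>
    leaves, \<open>y i\<close> the one through which it arrives.\<close>
  define x where "x i = snd (w ! i)" for i
  define y where "y i = fst (w ! ((i + 1) mod n))" for i
  have step: "{x i, y i} \<in> edges G" "x i \<in> hedges G" "y i = mate (edges G) (x i)"
    "inc G (x i) = inc G (fst (w ! i))" if "i < n" for i
  proof -
    show e: "{x i, y i} \<in> edges G" and "x i \<in> hedges G" "inc G (x i) = inc G (fst (w ! i))"
      using w that by (auto simp: cwalk_list_def n_def x_def y_def dst_def)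
    show "y i = mate (edges G) (x i)" using mate_eqI[OF pairing_edges e] by simp
  qed
  have cnt: "(\<Sum>i<n. if Q i then 1 else 0 :: rat) = of_nat (card {i. i < n \<and> Q i})" for Q
  proof -
    have "{i. i < n \<and> Q i} = {..<n} \<inter> {i. Q i}" by auto
    then show ?thesis by (simp add: sum.If_cases)
  qed
  have sl: "sigma_list T w e = (\<Sum>i<n. if e = {x i, y i} then sgnh T (x i) else 0)" for e
  proof -
    have "(\<Sum>i<n. if e = {x i, y i} then sgnh T (x i) else 0)
        = (\<Sum>i<n. if e = {x i, y i} \<and> x i \<in> T then 1 else 0) - (\<Sum>i<n. if e = {x i, y i} \<and> x i \<notin> T then 1 else 0)"
      unfolding sum_subtractf[symmetric] by (intro sum.cong) (auto simp: sgnh_def)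
    also have "\<dots> = of_nat (card {i. i < n \<and> e = {x i, y i} \<and> x i \<in> T})
        - of_nat (card {i. i < n \<and> e = {x i, y i} \<and> x i \<notin> T})"
      unfolding cnt ..
    finally show ?thesis by (simp add: sigma_list_def n_def x_def y_def)
  qed
  have "sigma_list T w e = 0" if "e \<notin> edges G" for e
    unfolding sl using step(1) that by (intro sum.neutral) auto
  moreover have "(\<Sum>e\<in>edges G. incmat G T v e * sigma_list T w e) = 0" for v
  proof -
    have "(\<Sum>e\<in>edges G. incmat G T v e * sigma_list T w e)
        = (\<Sum>i<n. \<Sum>e\<in>edges G. incmat G T v e * (if e = {x i, y i} then sgnh T (x i) else 0))"
      unfolding sl sum_distrib_left by (rule sum.swap)
    also have "\<dots> = (\<Sum>i<n. incmat G T v {x i, y i} * sgnh T (x i))"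
    proof (rule sum.cong[OF refl])
      fix i assume "i \<in> {..<n}"
      then have "{x i, y i} \<in> edges G" using step by simp
      then have "(\<Sum>e\<in>edges G. if e = {x i, y i} then incmat G T v e * sgnh T (x i) else 0)
        = incmat G T v {x i, y i} * sgnh T (x i)" using wf_graph_finite by simp
      moreover have "(\<Sum>e\<in>edges G. incmat G T v e * (if e = {x i, y i} then sgnh T (x i) else 0))
         = (\<Sum>e\<in>edges G. if e = {x i, y i} then incmat G T v e * sgnh T (x i) else 0)"
        by (intro sum.cong) auto
      ultimately show "(\<Sum>e\<in>edges G. incmat G T v e * (if e = {x i, y i} then sgnh T (x i) else 0))
        = incmat G T v {x i, y i} * sgnh T (x i)" by simp
    qed
    \<comment> \<open>The direction enters twice, through \<open>incmat\<close> and through the sign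
      of the traversal, and the square of the sign is 1. What remains is arrival minus
      departure.\<close>
    also have "\<dots> = (\<Sum>i<n. (if inc G (y i) = v then 1 else 0) - (if inc G (fst (w ! i)) = v then 1 else 0))"
    proof (rule sum.cong[OF refl])
      fix i assume "i \<in> {..<n}"
      then have i: "{x i, y i} \<in> edges G" "x i \<in> hedges G" "y i = mate (edges G) (x i)"
        "inc G (x i) = inc G (fst (w ! i))" using step by auto
      have ne: "y i \<noteq> x i" using mate_neq[OF pairing_edges i(2)] i(3) by simp
      have "sgnh T (y i) = - sgnh T (x i)" "sgnh T (x i) * sgnh T (x i) = 1"
        using sgnh_mate[OF i(2)] i(3) by (simp_all add: sgnh_def)
      then show "incmat G T v {x i, y i} * sgnh T (x i)
         = (if inc G (y i) = v then 1 else 0) - (if inc G (fst (w ! i)) = v then 1 else 0)"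
        unfolding incmat_eq_sum[OF i(1)] using ne i(4) by (simp add: algebra_simps)
    qed
    also have "\<dots> = 0"
    proof -
      let ?g = "\<lambda>j. (if inc G (fst (w ! j)) = v then 1 else 0) :: rat"
      have "(\<Sum>i<n. ?g ((i + 1) mod n)) = (\<Sum>i<n. ?g i)" by (rule sum_cyclic_shift)
      then show ?thesis by (simp add: sum_subtractf y_def)
    qed
    finally show ?thesis .
  qed
  ultimately show ?thesis by (simp add: cycle_space_def)
qed

end

lemma cwalk_list_rotate:
  assumes "cwalk_list G w"
  shows "cwalk_list G (rotate k w)"
  unfolding cwalk_list_def
proof (intro allI impI)
  fix i assume i: "i < length (rotate k w)"
  let ?n = "length w"
  have i': "i < ?n" "0 < ?n" using i by auto
  have 1: "rotate k w ! i = w ! ((k + i) mod ?n)" using i' by (simp add: nth_rotate)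
  have "rotate k w ! ((i + 1) mod ?n) = w ! ((k + (i + 1) mod ?n) mod ?n)"
    using i' by (simp add: nth_rotate)
  also have "(k + (i + 1) mod ?n) mod ?n = ((k + i) mod ?n + 1) mod ?n"
    by (simp add: mod_simps)
  finally have 2: "rotate k w ! ((i + 1) mod ?n) = w ! (((k + i) mod ?n + 1) mod ?n)" .
  show "dst G (rotate k w ! i) \<and>
        {snd (rotate k w ! i), fst (rotate k w ! ((i + 1) mod length (rotate k w)))} \<in> edges G"
    using assms i' unfolding cwalk_list_def length_rotate 1 2 by simp
qed

text \<open>\<open>sigma\<close> evaluates an arbitrarily chosen representative of the cyclic class;
  it is again a walk because rotation preserves walks.\<close>

lemma closed_walk_representative:
  assumes "closed_walk G W"
  shows "cwalk_list G (SOME w. w \<in> W)"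
proof -
  obtain w where w: "cwalk_list G w" "W = rotations w" using assms by (auto simp: closed_walk_def)
  then have "w \<in> W" by (auto simp: rotations_def intro!: exI[of _ 0])
  then have "(SOME w. w \<in> W) \<in> W" by (rule someI)
  then show ?thesis using w cwalk_list_rotate by (auto simp: rotations_def)
qed

lemma sigma_in_cycle_space:
  assumes "directed_version G T" "closed_walk G W"
  shows "sigma T W \<in> cycle_space G T"
  unfolding sigma_def using sigma_list_in_cycle_space[OF assms(1)] closed_walk_representative[OF assms(2)] .

text \<open>\<open>CM\<close> is formed with the tails of \<open>F\<close>, the spanning hypothesis
  with those of the graph after deletion. A walk leaves only through half-edges of its own graph, so
  both count alike.\<close>

lemma sigma_restrict_tails:
  assumes "closed_walk G W"
  shows "sigma (T \<inter> hedges G) W = sigma T W"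
proof
  fix e
  define w where "w = (SOME w. w \<in> W)"
  have "cwalk_list G w" using closed_walk_representative[OF assms] by (simp add: w_def)
  then have s: "snd (w ! i) \<in> hedges G" if "i < length w" for i
    using that by (simp add: cwalk_list_def dst_def)
  show "sigma (T \<inter> hedges G) W e = sigma T W e"
    unfolding sigma_def w_def[symmetric] sigma_list_def
    using s by (intro arg_cong2[of _ _ _ _ "(-)"] arg_cong[of _ _ of_nat] arg_cong[of _ _ card]) auto
qed

end

subsection \<open>Transitions of a 4-regular graph\<close>

locale four_regular_graph =
  fixes F :: "('v,'h) graph"
  assumes wf: "wf_graph F" and reg: "four_regular F"
begin

abbreviation "H \<equiv> hedges F"
abbreviation "V \<equiv> verts F"
abbreviation m :: "'h \<Rightarrow> 'h" where "m \<equiv> mate (edges F)"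

lemmas m_neq = mate_neq[OF pairing_edges[OF wf]]
  and m_in = mate_in[OF pairing_edges[OF wf]]
  and m_m = mate_mate[OF pairing_edges[OF wf]]
  and m_edge = mate_pair_in[OF pairing_edges[OF wf]]

lemma in_hat_iff: "h \<in> hat F v \<longleftrightarrow> h \<in> H \<and> inc F h = v"
  by (simp add: hat_def)

lemma hat_four:
  assumes "v \<in> V"
  obtains a b c d where "distinct [a, b, c, d]" "hat F v = {a, b, c, d}"
proof -
  have "card (hat F v) = 4" using reg assms by (simp add: four_regular_def)
  then have "finite (hat F v)" by (metis card.infinite zero_neq_numeral)
  then obtain xs where xs: "set xs = hat F v" "distinct xs" using finite_distinct_list by blast
  then have "length xs = 4" using \<open>card (hat F v) = 4\<close> distinct_card by metis
  then obtain a b c d where "xs = [a, b, c, d]"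
    by (auto simp: numeral_eq_Suc length_Suc_conv)
  then show ?thesis using that[of a b c d] xs by simp
qed

lemma hat_nonempty: "v \<in> V \<Longrightarrow> hat F v \<noteq> {}"
  using hat_four by force

lemma transitions_atE:
  assumes "t \<in> transitions_at F v"
  obtains a b c d where "distinct [a, b, c, d]" "hat F v = {a, b, c, d}" "t = {{a, b}, {c, d}}"
  using assms unfolding transitions_at_def by blast

lemma pairing_transition:
  assumes "t \<in> transitions_at F v"
  shows "pairing (hat F v) t"
proof -
  obtain a b c d where "distinct [a, b, c, d]" "hat F v = {a, b, c, d}" "t = {{a, b}, {c, d}}"
    using transitions_atE[OF assms] .
  then show ?thesis unfolding pairing_def by auto
qed

lemma Union_transition: "t \<in> transitions_at F v \<Longrightarrow> \<Union>t = hat F v"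
  using pairing_transition by (simp add: pairing_def)

text \<open>Four half-edges split into two pairs in a way fixed by the partner of any one of them,
  the other pair being the complement. Hence different transitions at a vertex give each half-edge
  different partners.\<close>

lemma transition_eq_mate:
  assumes "t \<in> transitions_at F v" "h \<in> hat F v"
  shows "t = {{h, mate t h}, hat F v - {h, mate t h}}"
proof -
  obtain a b c d where t: "distinct [a, b, c, d]" "hat F v = {a, b, c, d}" "t = {{a, b}, {c, d}}"
    using transitions_atE[OF assms(1)] .
  obtain s where s: "s \<in> t" "h \<in> s" using pairingD(4)[OF pairing_transition[OF assms(1)] assms(2)] by blast
  have "s = {h, mate t h}" using pair_eq_mate[OF pairing_transition[OF assms(1)] s] .
  then consider "{h, mate t h} = {a, b}" | "{h, mate t h} = {c, d}" using s(1) t(3) by auto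
  then show ?thesis
  proof cases
    case 1
    have "hat F v - {a, b} = {c, d}" using t by auto
    then show ?thesis unfolding 1 using t(3) by simp
  next
    case 2
    have "hat F v - {c, d} = {a, b}" using t by auto
    then show ?thesis unfolding 2 using t(3) by (simp add: insert_commute)
  qed
qed

lemma transition_eqI:
  assumes "t \<in> transitions_at F v" "t' \<in> transitions_at F v" "h \<in> hat F v" "mate t h = mate t' h"
  shows "t = t'"
  using transition_eq_mate[OF assms(1,3)] transition_eq_mate[OF assms(2,3)] assms(4) by simp

lemma transitions_at_vertex_unique:
  assumes "t \<in> transitions_at F v" "t \<in> transitions_at F w" "v \<in> V"
  shows "v = w"
proof -
  have "hat F v = hat F w" using Union_transition[OF assms(1)] Union_transition[OF assms(2)] by simp
  then show ?thesis using hat_nonempty[OF assms(3)] by (auto simp: hat_def)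
qed

lemma transitions_at_two:
  assumes "v \<in> V"
  shows "\<exists>x\<in>transitions_at F v. \<exists>y\<in>transitions_at F v. x \<noteq> y"
proof -
  obtain a b c d where t: "distinct [a, b, c, d]" "hat F v = {a, b, c, d}" using hat_four[OF assms] .
  have mem: "{{a, b}, {c, d}} \<in> transitions_at F v" if "distinct [a, b, c, d]" "hat F v = {a, b, c, d}" for a b c d
    unfolding transitions_at_def
    by (rule CollectI, rule exI[of _ a], rule exI[of _ b], rule exI[of _ c], rule exI[of _ d]) (use that in simp)
  have "{{a, b}, {c, d}} \<in> transitions_at F v" using t by (rule mem)
  moreover have "distinct [a, c, b, d]" "hat F v = {a, c, b, d}" using t by auto
  then have "{{a, c}, {b, d}} \<in> transitions_at F v" by (rule mem)
  moreover have "{{a, b}, {c, d}} \<noteq> {{a, c}, {b, d}}"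
  proof
    assume eq: "{{a, b}, {c, d}} = {{a, c}, {b, d}}"
    have "{a, b} \<in> {{a, b}, {c, d}}" by simp
    then have "{a, b} = {a, c} \<or> {a, b} = {b, d}" unfolding eq by simp
    then show False using t(1) by (simp add: doubleton_eq_iff)
  qed
  ultimately show ?thesis by (intro bexI)
qed

lemma Q_skew_disjoint:
  "\<forall>\<omega>1\<in>Q_skew F. \<forall>\<omega>2\<in>Q_skew F. \<omega>1 \<noteq> \<omega>2 \<longrightarrow> \<omega>1 \<inter> \<omega>2 = {}"
proof (intro ballI impI)
  fix \<omega>1 \<omega>2 assume "\<omega>1 \<in> Q_skew F" "\<omega>2 \<in> Q_skew F" and ne: "\<omega>1 \<noteq> \<omega>2"
  then obtain v w where vw: "v \<in> V" "w \<in> V" "\<omega>1 = transitions_at F v" "\<omega>2 = transitions_at F w"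
    by (auto simp: Q_skew_def)
  show "\<omega>1 \<inter> \<omega>2 = {}"
  proof (rule ccontr)
    assume "\<omega>1 \<inter> \<omega>2 \<noteq> {}"
    then obtain t where "t \<in> transitions_at F v" "t \<in> transitions_at F w" using vw by auto
    then have "v = w" using transitions_at_vertex_unique vw(1) by blast
    then show False using vw ne by simp
  qed
qed

lemma Q_skew_Union: "\<Union>(Q_skew F) = transitions F"
  by (auto simp: Q_skew_def transitions_def)

lemma Q_skew_two: "\<forall>\<omega>\<in>Q_skew F. \<exists>x\<in>\<omega>. \<exists>y\<in>\<omega>. x \<noteq> y"
  using transitions_at_two by (auto simp: Q_skew_def)

lemma Q_skew_nonempty: "\<forall>\<omega>\<in>Q_skew F. \<omega> \<noteq> {}"
  using Q_skew_two by fastforce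

lemma finite_Q_skew: "finite (Q_skew F)"
  unfolding Q_skew_def using wf_graph_finite(1)[OF wf] by (simp add: setcompr_eq_image)

lemma finite_transitions: "finite (transitions F)"
proof -
  have "transitions F \<subseteq> Pow (Pow H)"
  proof
    fix t assume "t \<in> transitions F"
    then obtain v where "t \<in> transitions_at F v" by (auto simp: transitions_def)
    then have "\<Union>t \<subseteq> H" using Union_transition by (auto simp: hat_def)
    then show "t \<in> Pow (Pow H)" by blast
  qed
  then show ?thesis using wf_graph_finite(2)[OF wf] by (meson finite_Pow_iff finite_subset)
qed

lemma card_Q_skew: "card (Q_skew F) = card V"
proof -
  have "inj_on (transitions_at F) V"
  proof (rule inj_onI)
    fix v w assume vw: "v \<in> V" "w \<in> V" "transitions_at F v = transitions_at F w"
    obtain t where "t \<in> transitions_at F v" using transitions_at_two[OF vw(1)] by blast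
    then show "v = w" using vw transitions_at_vertex_unique by metis
  qed
  moreover have "Q_skew F = transitions_at F ` V" by (auto simp: Q_skew_def)
  ultimately show ?thesis by (simp add: card_image)
qed

lemma card_transversal: "transversal (Q_skew F) X \<Longrightarrow> card X = card V"
  using transversal_card[OF finite_Q_skew Q_skew_disjoint] card_Q_skew by simp

context
  fixes X :: "'h set set set"
  assumes X: "transversal (Q_skew F) X"
begin

lemma transversal_sub: "X \<subseteq> transitions F"
  using X Q_skew_Union by (simp add: transversal_def)

lemma transversal_finite: "finite X"
  using transversal_sub finite_transitions finite_subset by blast

lemma transversal_at:
  assumes "v \<in> V"
  obtains t where "X \<inter> transitions_at F v = {t}"
proof -
  have "transitions_at F v \<in> Q_skew F" using assms by (auto simp: Q_skew_def)
  then have "card (X \<inter> transitions_at F v) = 1" using X by (simp add: transversal_def)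
  then show ?thesis using that by (metis card_1_singletonE)
qed

lemma transversal_transition:
  assumes "h \<in> H"
  obtains t where "t \<in> X" "t \<in> transitions_at F (inc F h)" "h \<in> \<Union>t"
proof -
  obtain t where "X \<inter> transitions_at F (inc F h) = {t}"
    using transversal_at[OF inc_in_verts[OF wf assms]] .
  then have "t \<in> X" "t \<in> transitions_at F (inc F h)" by auto
  then show ?thesis using that Union_transition assms by (simp add: in_hat_iff)
qed

lemma transversal_transition_at:
  assumes "t \<in> X" "h \<in> \<Union>t"
  shows "t \<in> transitions_at F (inc F h)" "h \<in> H" "inc F h \<in> V"
proof -
  obtain v where v: "v \<in> V" "t \<in> transitions_at F v"
    using transversal_sub assms(1) by (auto simp: transitions_def)
  then have "h \<in> hat F v" using Union_transition assms(2) by blast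
  then show "t \<in> transitions_at F (inc F h)" "h \<in> H" "inc F h \<in> V" using v by (simp_all add: in_hat_iff)
qed

lemma transversal_transition_unique:
  assumes "t \<in> X" "t' \<in> X" "h \<in> \<Union>t" "h' \<in> \<Union>t'" "inc F h = inc F h'"
  shows "t = t'"
proof -
  obtain s where s: "X \<inter> transitions_at F (inc F h) = {s}"
    using transversal_at[OF transversal_transition_at(3)[OF assms(1,3)]] .
  have "t \<in> X \<inter> transitions_at F (inc F h)" "t' \<in> X \<inter> transitions_at F (inc F h)"
    using transversal_transition_at(1)[OF assms(1,3)] transversal_transition_at(1)[OF assms(2,4)] assms(1,2,5)
    by simp_all
  then show ?thesis unfolding s by simp
qed

text \<open>A transversal thus becomes a second perfect matching of the half-edges beside the edges;
  alternating between the two traces the circuits.\<close>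

lemma pairing_transversal: "pairing H (\<Union>X)"
  unfolding pairing_def
proof (intro conjI ballI impI)
  fix s assume "s \<in> \<Union>X"
  then obtain t where t: "t \<in> X" "s \<in> t" by blast
  then obtain v where "t \<in> transitions_at F v" using transversal_sub by (auto simp: transitions_def)
  then show "card s = 2" using pairingD(1)[OF pairing_transition] t by blast
next
  fix s s' assume "s \<in> \<Union>X" "s' \<in> \<Union>X" and ne: "s \<noteq> s'"
  then obtain t t' where t: "t \<in> X" "s \<in> t" "t' \<in> X" "s' \<in> t'" by blast
  show "s \<inter> s' = {}"
  proof (rule ccontr)
    assume "s \<inter> s' \<noteq> {}"
    then obtain h where h: "h \<in> s" "h \<in> s'" by blast
    then have "h \<in> \<Union>t" "h \<in> \<Union>t'" using t by auto
    then have "t = t'" "t \<in> transitions_at F (inc F h)"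
      using transversal_transition_unique[OF t(1,3)] transversal_transition_at(1)[OF t(1)] by auto
    then have "s = s'" using pairingD(2)[OF pairing_transition, of t _ s s' h] t h by blast
    then show False using ne by simp
  qed
next
  show "\<Union>(\<Union>X) = H"
  proof
    show "\<Union>(\<Union>X) \<subseteq> H" using transversal_transition_at(2) by blast
    show "H \<subseteq> \<Union>(\<Union>X)"
    proof
      fix h assume "h \<in> H"
      then obtain t where "t \<in> X" "h \<in> \<Union>t" using transversal_transition by blast
      then show "h \<in> \<Union>(\<Union>X)" by blast
    qed
  qed
qed

lemma mate_transversal_transition:
  assumes "t \<in> X" "h \<in> \<Union>t"
  shows "mate (\<Union>X) h = mate t h" "mate (\<Union>X) h \<in> \<Union>t"
proof -
  note pt = pairing_transition[OF transversal_transition_at(1)[OF assms]]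
  have h: "h \<in> hat F (inc F h)" using transversal_transition_at(2)[OF assms] by (simp add: in_hat_iff)
  have *: "{h, mate t h} \<in> t" using mate_pair_in[OF pt h] .
  then have "{h, mate t h} \<in> \<Union>X" using assms(1) by blast
  then show eq: "mate (\<Union>X) h = mate t h" using mate_eqI[OF pairing_transversal] by blast
  show "mate (\<Union>X) h \<in> \<Union>t" unfolding eq using * by blast
qed

lemma inc_mate_transversal:
  assumes "h \<in> H"
  shows "inc F (mate (\<Union>X) h) = inc F h"
proof -
  obtain t where t: "t \<in> X" "t \<in> transitions_at F (inc F h)" "h \<in> \<Union>t" using transversal_transition[OF assms] .
  then show ?thesis
    using mate_transversal_transition(2)[OF t(1,3)] Union_transition[OF t(2)] by (simp add: in_hat_iff)
qed

end

end

subsection \<open>Linear dependencies between columns\<close>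

locale four_regular_representation = four_regular_graph F
  for F :: "('v,'h) graph" +
  fixes T :: "'h set" and ori :: "'h set set \<Rightarrow> 'h set" and E :: "'h set set"
    and \<Gamma> :: "('h \<times> 'h) list set set"
  assumes dir: "directed_version F T"
    and orient: "transitional_orientation F ori"
    and E_sub: "E \<subseteq> edges F"
    and E_uniq: "\<forall>e1\<in>E. \<forall>e2\<in>E. (\<exists>h1\<in>e1. \<exists>h2\<in>e2. (inc F h1, inc F h2) \<in> conn F) \<longrightarrow> e1 = e2"
    and spanning: "cycle_spanning_set (del_edges F E) (T \<inter> hedges (del_edges F E)) \<Gamma>"
begin

abbreviation "G' \<equiv> del_edges F E"
abbreviation "Z \<equiv> cycle_space G' (T \<inter> hedges G')"

text \<open>The product of an edge vector with the column \<open>t\<close> of \<open>Delta\<close>.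
  For \<open>z = sigma T W\<close> it is the entry of the matrix product at \<open>W\<close> and
  \<open>t\<close>; a free \<open>z\<close> allows whole cycle vectors in place of walks.\<close>

definition pairing_value :: "('h set \<Rightarrow> rat) \<Rightarrow> 'h set set \<Rightarrow> rat" where
  "pairing_value z t = (\<Sum>e\<in>edges F. z e * Delta T ori e t)"

definition column :: "'h set set \<Rightarrow> ('h \<times> 'h) list set \<Rightarrow> rat" where
  "column t = (\<lambda>W. if W \<in> \<Gamma> then CM_Delta F T ori W t else 0)"

lemma del_edges_simps: "verts G' = V" "edges G' = edges F - E" "inc G' = inc F" "hedges G' = H - \<Union>E"
  using Int_absorb2[OF E_sub] by (simp_all add: del_edges_def)

lemma edge_in_hedges_del:
  assumes "e \<in> edges F - E"
  shows "e \<subseteq> hedges G'"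
proof
  fix h assume h: "h \<in> e"
  have "h \<notin> e'" if "e' \<in> E" for e'
  proof
    assume "h \<in> e'"
    then have "e = e'" using pairingD(2)[OF pairing_edges[OF wf], of e e' h] assms h that E_sub by auto
    then show False using assms that by simp
  qed
  moreover have "h \<in> H" using pairingD(3)[OF pairing_edges[OF wf], of e h] assms h by simp
  ultimately show "h \<in> hedges G'" by (auto simp: del_edges_simps)
qed

lemma wf_del: "wf_graph G'"
proof -
  have "h \<in> \<Union>(edges F - E)" if "h \<in> hedges G'" for h
  proof -
    have h: "h \<in> H" "h \<notin> \<Union>E" using that by (simp_all add: del_edges_simps)
    have "{h, m h} \<in> edges F - E" using m_edge[OF h(1)] h(2) by auto
    then show ?thesis by blast
  qed
  then have U: "\<Union>(edges F - E) = hedges G'" using edge_in_hedges_del by blast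
  have 1: "finite V" "finite (hedges G')" "\<forall>h\<in>hedges G'. inc F h \<in> V"
    using wf_graph_finite[OF wf] inc_in_verts[OF wf] by (simp_all add: del_edges_simps)
  have 2: "\<forall>e\<in>edges F - E. e \<subseteq> hedges G' \<and> card e = 2"
    using edge_in_hedges_del pairingD(1)[OF pairing_edges[OF wf]] by simp
  have 3: "\<forall>e1\<in>edges F - E. \<forall>e2\<in>edges F - E. e1 \<noteq> e2 \<longrightarrow> e1 \<inter> e2 = {}"
    using wf by (simp add: wf_graph_def)
  show ?thesis
    unfolding wf_graph_def del_edges_simps(1,2,3) using 1 2 3 U by simp
qed

lemma dir_del: "directed_version G' (T \<inter> hedges G')"
proof -
  have "card (e \<inter> (T \<inter> hedges G')) = 1" if "e \<in> edges F - E" for e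
  proof -
    have "e \<inter> (T \<inter> hedges G') = e \<inter> T" using edge_in_hedges_del[OF that] by auto
    then show ?thesis using dir that by (simp add: directed_version_def)
  qed
  then show ?thesis by (simp add: directed_version_def del_edges_simps)
qed

lemma Z_iff:
  "z \<in> Z \<longleftrightarrow> (\<forall>e. e \<notin> edges F - E \<longrightarrow> z e = 0)
     \<and> (\<forall>v\<in>V. (\<Sum>e\<in>edges F - E. incmat F T v e * z e) = 0)"
proof -
  have "incmat G' (T \<inter> hedges G') v e = incmat F T v e" if "e \<in> edges F - E" for v e
  proof -
    have "e - T \<inter> hedges G' = e - T" "e \<inter> (T \<inter> hedges G') = e \<inter> T"
      using edge_in_hedges_del[OF that] by auto
    then show ?thesis by (simp add: incmat_def del_edges_simps)
  qed
  then show ?thesis unfolding cycle_space_def del_edges_simps by simp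
qed

lemma linear_pairing_value:
  "pairing_value (x + y) t = pairing_value x t + pairing_value y t"
  "pairing_value (qscale c x) t = c * pairing_value x t"
  by (simp_all add: pairing_value_def sum.distrib sum_distrib_left algebra_simps)

text \<open>The rows indexed by \<Gamma> span exactly the cycle space: a basis lies among them, and
  every closed walk gives a cycle vector. So testing a relation on \<Gamma> amounts to testing it on
  all of \<open>Z\<close>.\<close>

lemma column_dependency_iff_cycle_space:
  assumes "finite I"
  shows "(\<Sum>t\<in>I. qscale (c t) (column t)) = 0 \<longleftrightarrow> (\<forall>z\<in>Z. (\<Sum>t\<in>I. c t * pairing_value z t) = 0)"
proof -
  obtain B where B: "B \<subseteq> \<Gamma>" "cycle_basis G' (T \<inter> hedges G') B" and cw: "\<forall>W\<in>\<Gamma>. closed_walk G' W"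
    using spanning by (auto simp: cycle_spanning_set_def)
  have sig: "sigma (T \<inter> hedges G') W = sigma T W" if "W \<in> \<Gamma>" for W
    using sigma_restrict_tails[OF wf_del] cw that by blast
  have col: "column t W = pairing_value (sigma T W) t" if "W \<in> \<Gamma>" for t W
    using that by (simp add: column_def CM_Delta_def CM_def pairing_value_def)
  have spanZ: "qv.span (sigma T ` B) = Z"
  proof -
    have "sigma (T \<inter> hedges G') ` B = sigma T ` B" using sig B(1) by (intro image_cong) auto
    then show ?thesis using B(2) by (simp add: cycle_basis_def)
  qed
  show ?thesis
  proof
    assume L: "(\<Sum>t\<in>I. qscale (c t) (column t)) = 0"
    have *: "(\<Sum>t\<in>I. c t * pairing_value (sigma T W) t) = 0" if "W \<in> \<Gamma>" for W
      using fun_cong[OF L, of W] col[OF that] by (simp add: sum_fun_apply)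
    show "\<forall>z\<in>Z. (\<Sum>t\<in>I. c t * pairing_value z t) = 0"
    proof
      fix z assume "z \<in> Z"
      then have "z \<in> qv.span (sigma T ` B)" by (simp add: spanZ)
      then show "(\<Sum>t\<in>I. c t * pairing_value z t) = 0"
      proof (induction rule: qv.span_induct_alt)
        case base
        show ?case by (simp add: pairing_value_def)
      next
        case (step k x y)
        then obtain W where "W \<in> \<Gamma>" "x = sigma T W" using B(1) by auto
        then have x0: "(\<Sum>t\<in>I. c t * pairing_value x t) = 0" using * by simp
        have "(\<Sum>t\<in>I. c t * pairing_value (qscale k x + y) t)
            = k * (\<Sum>t\<in>I. c t * pairing_value x t) + (\<Sum>t\<in>I. c t * pairing_value y t)"
          by (simp add: linear_pairing_value sum.distrib sum_distrib_left algebra_simps)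
        also have "\<dots> = 0" unfolding x0 step(2) by simp
        finally show ?case .
      qed
    qed
  next
    assume R: "\<forall>z\<in>Z. (\<Sum>t\<in>I. c t * pairing_value z t) = 0"
    show "(\<Sum>t\<in>I. qscale (c t) (column t)) = 0"
    proof
      fix W
      show "(\<Sum>t\<in>I. qscale (c t) (column t)) W = 0 W"
      proof (cases "W \<in> \<Gamma>")
        case True
        then have "sigma T W \<in> Z"
          using sigma_in_cycle_space[OF wf_del dir_del, of W] cw sig by simp
        then show ?thesis using R col[OF True] by (simp add: sum_fun_apply)
      qed (simp add: sum_fun_apply column_def)
    qed
  qed
qed

text \<open>The relation combines columns of \<open>Delta\<close> into an edge vector orthogonal to
  the cycle space, that is, into a combination of incidence rows; \<pi> holds its coefficients and
  acts as a potential on the vertices. Cycle vectors vanish on \<open>E\<close>, so the deleted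
  edges impose nothing.\<close>

lemma column_dependency_iff_potential:
  assumes "finite I"
  shows "(\<Sum>t\<in>I. qscale (c t) (column t)) = 0 \<longleftrightarrow>
    (\<exists>\<pi>. \<forall>e\<in>edges F - E. (\<Sum>t\<in>I. c t * Delta T ori e t) = (\<Sum>v\<in>V. \<pi> v * incmat F T v e))"
proof -
  let ?D = "edges F - E"
  define y where "y e = (\<Sum>t\<in>I. c t * Delta T ori e t)" for e
  have fin: "finite ?D" "finite V" using wf_graph_finite[OF wf] by auto
  have pv: "(\<Sum>t\<in>I. c t * pairing_value z t) = (\<Sum>e\<in>?D. y e * z e)" if "z \<in> Z" for z
  proof -
    have "pairing_value z t = (\<Sum>e\<in>?D. z e * Delta T ori e t)" for t
      unfolding pairing_value_def using that Z_iff wf_graph_finite[OF wf]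
      by (intro sum.mono_neutral_right) auto
    then have "(\<Sum>t\<in>I. c t * pairing_value z t) = (\<Sum>t\<in>I. \<Sum>e\<in>?D. c t * (z e * Delta T ori e t))"
      by (simp add: sum_distrib_left)
    also have "\<dots> = (\<Sum>e\<in>?D. \<Sum>t\<in>I. c t * (z e * Delta T ori e t))" by (rule sum.swap)
    finally show ?thesis by (simp add: y_def sum_distrib_right sum_distrib_left algebra_simps)
  qed
  show ?thesis
    unfolding column_dependency_iff_cycle_space[OF assms] y_def[symmetric]
  proof
    assume L: "\<forall>z\<in>Z. (\<Sum>t\<in>I. c t * pairing_value z t) = 0"
    show "\<exists>\<pi>. \<forall>e\<in>?D. y e = (\<Sum>v\<in>V. \<pi> v * incmat F T v e)"
    proof (rule functional_in_row_space[OF fin(2,1)])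
      fix z assume z: "\<And>v. v \<in> V \<Longrightarrow> (\<Sum>e\<in>?D. incmat F T v e * z e) = 0"
      define z' where "z' e = (if e \<in> ?D then z e else 0)" for e
      have "z' \<in> Z" unfolding Z_iff using z by (simp add: z'_def)
      then have "(\<Sum>e\<in>?D. y e * z' e) = 0" using L pv by simp
      then show "(\<Sum>e\<in>?D. y e * z e) = 0" by (simp add: z'_def)
    qed
  next
    assume "\<exists>\<pi>. \<forall>e\<in>?D. y e = (\<Sum>v\<in>V. \<pi> v * incmat F T v e)"
    then obtain \<pi> where p: "\<forall>e\<in>?D. y e = (\<Sum>v\<in>V. \<pi> v * incmat F T v e)" by blast
    show "\<forall>z\<in>Z. (\<Sum>t\<in>I. c t * pairing_value z t) = 0"
    proof
      fix z assume z: "z \<in> Z"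
      have "(\<Sum>e\<in>?D. y e * z e) = (\<Sum>e\<in>?D. \<Sum>v\<in>V. \<pi> v * (incmat F T v e * z e))"
        using p by (intro sum.cong) (simp_all add: sum_distrib_right mult.assoc)
      also have "\<dots> = (\<Sum>v\<in>V. \<Sum>e\<in>?D. \<pi> v * (incmat F T v e * z e))" by (rule sum.swap)
      also have "\<dots> = (\<Sum>v\<in>V. \<pi> v * (\<Sum>e\<in>?D. incmat F T v e * z e))"
        by (simp add: sum_distrib_left)
      also have "\<dots> = 0" using z Z_iff by simp
      finally show "(\<Sum>t\<in>I. c t * pairing_value z t) = 0" using pv[OF z] by simp
    qed
  qed
qed

text \<open>If both ends of an edge lie in the chosen single transition, the intersection is no
  singleton and the entry is 0; in the sum the two signs cancel. So \<open>Delta\<close> is additive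
  over half-edges.\<close>

lemma Delta_eq_sum:
  assumes "e \<in> edges F"
  shows "Delta T ori e t = (\<Sum>h\<in>e. if h \<in> ori t then sgnh T h else 0)"
proof -
  obtain h where h: "h \<in> H" "h \<in> T" "m h \<notin> T" "e = {h, m h}" using edge_tailE[OF wf dir assms] .
  define k where "k = m h"
  have e: "e = {h, k}" "h \<noteq> k" "k \<notin> T" using h m_neq[of h] by (auto simp: k_def)
  consider "h \<in> ori t" "k \<in> ori t" | "h \<in> ori t" "k \<notin> ori t" | "h \<notin> ori t" "k \<in> ori t"
    | "h \<notin> ori t" "k \<notin> ori t" by blast
  then show ?thesis
  proof cases
    case 1
    then have "e \<inter> ori t = {h, k}" using e by auto
    then have "\<not> (\<exists>x. e \<inter> ori t = {x} \<and> Q x)" for Q using e(2) by auto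
    then show ?thesis unfolding Delta_def using 1 e h by (simp add: sgnh_def)
  next
    case 2
    then have "e \<inter> ori t = {h}" using e by auto
    then show ?thesis unfolding Delta_def using 2 e h by (simp add: sgnh_def)
  next
    case 3
    then have "e \<inter> ori t = {k}" using e by auto
    then show ?thesis unfolding Delta_def using 3 e h by (simp add: sgnh_def)
  next
    case 4
    then have "e \<inter> ori t = {}" using e by auto
    then show ?thesis unfolding Delta_def using 4 e h by (simp add: sgnh_def)
  qed
qed

lemma pairing_value_eq_sum:
  "pairing_value z t = (\<Sum>h\<in>H. z {h, m h} * (if h \<in> ori t then sgnh T h else 0))"
proof -
  have "pairing_value z t = (\<Sum>e\<in>edges F. z e * (\<Sum>h\<in>e. if h \<in> ori t then sgnh T h else 0))"
    unfolding pairing_value_def using Delta_eq_sum by simp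
  then show ?thesis unfolding sum_edges_half_edges[OF wf dir] .
qed

subsection \<open>Invariant functions on half-edges\<close>

lemma conn_refl: "v \<in> V \<Longrightarrow> (v, v) \<in> conn F"
  by (auto simp: conn_def)

lemma conn_sym:
  assumes "(u, v) \<in> conn F"
  shows "(v, u) \<in> conn F"
proof -
  have "sym (conn F)" using equiv_conn[OF wf] by (simp add: equiv_def)
  then show ?thesis using assms by (rule symD)
qed

lemma conn_trans:
  assumes "(u, v) \<in> conn F" "(v, w) \<in> conn F"
  shows "(u, w) \<in> conn F"
proof -
  have "trans (conn F)" using equiv_conn[OF wf] by (simp add: equiv_def)
  then show ?thesis using assms by (rule transD)
qed

text \<open>If \<kappa> jumped at \<open>h0\<close>, its edge would lie in \<open>E\<close> and be
  the only such edge of its component. The level set of \<kappa> through \<open>h0\<close> in that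
  component is paired up by the single transitions, yet the edges pair up everything in it except
  \<open>h0\<close>.\<close>

lemma edge_invariant_across_E:
  assumes X: "transversal (Q_skew F) X"
    and p: "\<And>h. h \<in> H \<Longrightarrow> \<kappa> (mate (\<Union>X) h) = \<kappa> h"
    and e: "\<And>h. h \<in> H \<Longrightarrow> {h, m h} \<notin> E \<Longrightarrow> \<kappa> (m h) = \<kappa> h"
    and h0: "h0 \<in> H"
  shows "\<kappa> (m h0) = (\<kappa> h0 :: rat)"
proof (rule ccontr)
  assume ne: "\<kappa> (m h0) \<noteq> \<kappa> h0"
  note pX = pairing_transversal[OF X]
  define B where "B = {h \<in> H. (inc F h, inc F h0) \<in> conn F \<and> \<kappa> h = \<kappa> h0}"
  have finB: "finite B" "B \<subseteq> H" using wf_graph_finite(2)[OF wf] by (auto simp: B_def)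
  have h0B: "h0 \<in> B"
    using h0 inc_in_verts[OF wf h0] conn_refl by (simp add: B_def)
  have "even (card B)"
  proof (rule even_card_mate_closed[OF pX finB])
    fix h assume "h \<in> B"
    then show "mate (\<Union>X) h \<in> B"
      using mate_in[OF pX, of h] p[of h] inc_mate_transversal[OF X, of h] by (simp add: B_def)
  qed
  moreover have "even (card (B - {h0}))"
  proof (rule even_card_mate_closed[OF pairing_edges[OF wf]])
    show "finite (B - {h0})" "B - {h0} \<subseteq> H" using finB by auto
    fix h assume "h \<in> B - {h0}"
    then have h: "h \<in> H" "(inc F h, inc F h0) \<in> conn F" "\<kappa> h = \<kappa> h0" "h \<noteq> h0" by (auto simp: B_def)
    have E0: "{h0, m h0} \<in> E" using e[OF h0] ne by argo
    have nE: "{h, m h} \<notin> E"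
    proof
      assume E1: "{h, m h} \<in> E"
      have "\<exists>h1\<in>{h, m h}. \<exists>h2\<in>{h0, m h0}. (inc F h1, inc F h2) \<in> conn F" using h(2) by simp
      then have eq: "{h, m h} = {h0, m h0}" by (rule E_uniq[rule_format, OF E1 E0])
      have "h \<in> {h, m h}" by simp
      then have "h \<in> {h0, m h0}" unfolding eq .
      then have "h = m h0" using h(4) by simp
      then show False using ne h(3) by simp
    qed
    have "(inc F (m h), inc F h) \<in> conn F"
      using conn_sym[OF conn_mate[OF wf h(1)]] .
    then have "(inc F (m h), inc F h0) \<in> conn F" using h(2) by (rule conn_trans)
    then have "m h \<in> B" using e[OF h(1) nE] m_in[OF h(1)] h(3) by (simp add: B_def)
    moreover have "m h \<noteq> h0"
    proof
      assume mh: "m h = h0"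
      have "m h0 = h" using m_m[OF h(1)] unfolding mh .
      then show False using ne h(3) by simp
    qed
    ultimately show "m h \<in> B - {h0}" by simp
  qed
  moreover have "card B = Suc (card (B - {h0}))" using card.remove[OF finB(1) h0B] .
  ultimately show False by simp
qed

end

section \<open>Relations on a transversal as jumps of invariant functions\<close>

context four_regular_representation
begin

text \<open>Representatives of the chosen single transition of \<open>t\<close> and of the other one.\<close>
definition oh :: "'h set set \<Rightarrow> 'h" where "oh t = (SOME h. h \<in> ori t)"
definition nh :: "'h set set \<Rightarrow> 'h" where "nh t = (SOME h. h \<in> \<Union>t - ori t)"

lemma orientation_ends:
  assumes "t \<in> transitions F"
  shows "ori t \<in> t" "oh t \<in> ori t" "oh t \<in> \<Union>t" "nh t \<in> \<Union>t" "nh t \<notin> ori t"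
proof -
  show o: "ori t \<in> t" using orient assms by (simp add: transitional_orientation_def)
  obtain v where "t \<in> transitions_at F v" using assms by (auto simp: transitions_def)
  then obtain a b c d where t: "distinct [a, b, c, d]" "hat F v = {a, b, c, d}" "t = {{a, b}, {c, d}}"
    by (rule transitions_atE)
  have U: "\<Union>t = {a, b, c, d}" unfolding t(3) by auto
  have "ori t \<in> {{a, b}, {c, d}}" using equalityD1[OF t(3), THEN subsetD, OF o] .
  then consider "ori t = {a, b}" | "ori t = {c, d}" by blast
  then have ex: "\<exists>h. h \<in> ori t" "\<exists>h. h \<in> \<Union>t - ori t"
    unfolding U by (cases; use t(1) in force)+
  show oh: "oh t \<in> ori t" unfolding oh_def by (rule someI_ex[OF ex(1)])
  have "nh t \<in> \<Union>t - ori t" unfolding nh_def by (rule someI_ex[OF ex(2)])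
  then show "nh t \<in> \<Union>t" "nh t \<notin> ori t" by simp_all
  show "oh t \<in> \<Union>t" using o oh by blast
qed

lemma same_side_mate:
  assumes "t \<in> transitions_at F v" "t \<in> transitions F" "a \<in> hat F v" "h \<in> hat F v" "a \<noteq> h"
    "a \<in> ori t \<longleftrightarrow> h \<in> ori t"
  shows "h = mate t a"
proof -
  have "ori t \<in> {{a, mate t a}, hat F v - {a, mate t a}}"
    using equalityD1[OF transition_eq_mate[OF assms(1,3)], THEN subsetD, OF orientation_ends(1)[OF assms(2)]] .
  then consider "ori t = {a, mate t a}" | "ori t = hat F v - {a, mate t a}" by auto
  then show ?thesis
  proof cases
    case 1
    then show ?thesis using assms(5,6) by simp
  next
    case 2
    then show ?thesis using assms(3-6) by simp
  qed
qed

text \<open>With \<open>h\<close> the tail, the columns of \<open>Delta\<close> sum to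
  \<open>C h - C (m h)\<close>, and the potential contributes its value at the head minus that at
  the tail. The resulting equation is symmetric in \<open>h\<close> and \<open>m h\<close>, so the
  direction drops out.\<close>

lemma dependency_iff_edge_invariant:
  fixes c :: "'h set set \<Rightarrow> rat"
  assumes "finite I"
  defines "C \<equiv> \<lambda>h. \<Sum>t\<in>I. if h \<in> ori t then c t else 0"
  shows "(\<Sum>t\<in>I. qscale (c t) (column t)) = 0 \<longleftrightarrow>
    (\<exists>\<pi>. \<forall>h\<in>H. {h, m h} \<notin> E \<longrightarrow> C (m h) + \<pi> (inc F (m h)) = C h + \<pi> (inc F h))"
proof -
  have tail: "(\<Sum>t\<in>I. c t * Delta T ori {h, m h} t) = (\<Sum>v\<in>V. \<pi> v * incmat F T v {h, m h})
      \<longleftrightarrow> C (m h) + \<pi> (inc F (m h)) = C h + \<pi> (inc F h)" if h: "h \<in> H" "h \<in> T" for h \<pi>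
  proof -
    note e = m_edge[OF h(1)]
    have s: "sgnh T h = 1" "sgnh T (m h) = -1" using h sgnh_mate[OF wf dir h(1)] by (simp_all add: sgnh_def)
    have ne: "h \<noteq> m h" using m_neq[OF h(1)] by simp
    have V: "inc F h \<in> V" "inc F (m h) \<in> V" using h(1) m_in inc_in_verts[OF wf] by auto
    have "(\<Sum>t\<in>I. c t * Delta T ori {h, m h} t)
        = (\<Sum>t\<in>I. (if h \<in> ori t then c t else 0) - (if m h \<in> ori t then c t else 0))"
      unfolding Delta_eq_sum[OF e] using ne s by (intro sum.cong) auto
    then have 1: "(\<Sum>t\<in>I. c t * Delta T ori {h, m h} t) = C h - C (m h)"
      by (simp add: sum_subtractf C_def)
    have "(\<Sum>v\<in>V. \<pi> v * incmat F T v {h, m h})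
        = (\<Sum>v\<in>V. (if inc F (m h) = v then \<pi> v else 0) - (if inc F h = v then \<pi> v else 0))"
      unfolding incmat_eq_sum[OF wf dir e] using ne s by (intro sum.cong) auto
    then have 2: "(\<Sum>v\<in>V. \<pi> v * incmat F T v {h, m h}) = \<pi> (inc F (m h)) - \<pi> (inc F h)"
      using V wf_graph_finite(1)[OF wf] by (simp add: sum_subtractf)
    show ?thesis unfolding 1 2 by auto
  qed
  have "(\<forall>e\<in>edges F - E. (\<Sum>t\<in>I. c t * Delta T ori e t) = (\<Sum>v\<in>V. \<pi> v * incmat F T v e))
    \<longleftrightarrow> (\<forall>h\<in>H. {h, m h} \<notin> E \<longrightarrow> C (m h) + \<pi> (inc F (m h)) = C h + \<pi> (inc F h))" (is "?L \<longleftrightarrow> ?R") for \<pi>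
  proof
    assume L: ?L
    show ?R
    proof (intro ballI impI)
      fix h assume h: "h \<in> H" "{h, m h} \<notin> E"
      show "C (m h) + \<pi> (inc F (m h)) = C h + \<pi> (inc F h)"
      proof (cases "h \<in> T")
        case True
        have "{h, m h} \<in> edges F - E" using h m_edge by simp
        then show ?thesis using L tail[OF h(1) True, of \<pi>] by simp
      next
        case False
        have k: "m h \<in> H" "m h \<in> T" "m (m h) = h"
          using tail_mate_iff[OF wf dir h(1)] False m_in[OF h(1)] m_m[OF h(1)] by auto
        have "{m h, m (m h)} \<in> edges F - E" unfolding k(3) using h m_edge by (simp add: insert_commute)
        then show ?thesis using L tail[OF k(1,2), of \<pi>] unfolding k(3) by simp
      qed
    qed
  next
    assume R: ?R
    show ?L
    proof
      fix e assume e: "e \<in> edges F - E"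
      then obtain h where h: "h \<in> H" "h \<in> T" "e = {h, m h}" using edge_tailE[OF wf dir, of e] by auto
      have "C (m h) + \<pi> (inc F (m h)) = C h + \<pi> (inc F h)" using R h(1) e h(3) by simp
      then show "(\<Sum>t\<in>I. c t * Delta T ori e t) = (\<Sum>v\<in>V. \<pi> v * incmat F T v e)"
        using tail[OF h(1,2), of \<pi>] h(3) by simp
    qed
  qed
  then show ?thesis unfolding column_dependency_iff_potential[OF assms(1)] by simp
qed

text \<open>For a transversal \<open>X\<close>, constancy under both matchings is constancy on the
  circuits of its partition, expressed without the partition.\<close>

definition invariant :: "'h set set set \<Rightarrow> ('h \<Rightarrow> rat) \<Rightarrow> bool" where
  "invariant X \<kappa> \<longleftrightarrow> (\<forall>h\<in>H. \<kappa> (m h) = \<kappa> h) \<and> (\<forall>h\<in>H. \<kappa> (mate (\<Union>X) h) = \<kappa> h)"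

context
  fixes X :: "'h set set set"
  assumes X: "transversal (Q_skew F) X"
begin

lemma transversal_ends:
  assumes "t \<in> X"
  shows "ori t \<in> t" "oh t \<in> ori t" "oh t \<in> \<Union>t" "nh t \<in> \<Union>t" "nh t \<notin> ori t"
    "oh t \<in> H" "nh t \<in> H" "inc F (oh t) = inc F (nh t)"
proof -
  have t: "t \<in> transitions F" using transversal_sub[OF X] assms by blast
  show o: "ori t \<in> t" "oh t \<in> ori t" "oh t \<in> \<Union>t" "nh t \<in> \<Union>t" "nh t \<notin> ori t"
    using orientation_ends[OF t] .
  show "oh t \<in> H" "nh t \<in> H" using transversal_transition_at(2)[OF X assms] o by blast+
  have "t \<in> transitions_at F (inc F (nh t))" using transversal_transition_at(1)[OF X assms o(4)] .
  then have "oh t \<in> hat F (inc F (nh t))" using Union_transition o(3) by blast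
  then show "inc F (oh t) = inc F (nh t)" by (simp add: in_hat_iff)
qed

lemma transversal_same_side_mate:
  assumes "t \<in> X" "a \<in> \<Union>t" "h \<in> \<Union>t" "a \<noteq> h" "a \<in> ori t \<longleftrightarrow> h \<in> ori t"
  shows "h = mate (\<Union>X) a" "h = mate t a"
proof -
  have t: "t \<in> transitions F" using transversal_sub[OF X] assms(1) by blast
  have at: "t \<in> transitions_at F (inc F a)" using transversal_transition_at(1)[OF X assms(1,2)] .
  then have "a \<in> hat F (inc F a)" "h \<in> hat F (inc F a)" using Union_transition assms(2,3) by blast+
  then show "h = mate t a" using same_side_mate[OF at t] assms(4,5) by blast
  then show "h = mate (\<Union>X) a" using mate_transversal_transition(1)[OF X assms(1,2)] by simp
qed

lemma invariant_at:
  assumes "\<forall>h\<in>H. \<kappa> (mate (\<Union>X) h) = (\<kappa> h :: rat)" "t \<in> X" "h \<in> \<Union>t"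
  shows "\<kappa> h = (if h \<in> ori t then \<kappa> (oh t) else \<kappa> (nh t))"
proof -
  have side: "\<kappa> h = \<kappa> a" if a: "a \<in> \<Union>t" "a \<in> ori t \<longleftrightarrow> h \<in> ori t" for a
  proof (cases "a = h")
    case False
    then have "h = mate (\<Union>X) a" using transversal_same_side_mate(1)[OF assms(2) a(1) assms(3)] a(2) by simp
    then show ?thesis using assms(1) transversal_transition_at(2)[OF X assms(2) a(1)] by simp
  qed simp
  show ?thesis using side[of "oh t"] side[of "nh t"] transversal_ends[OF assms(2)] by simp
qed

lemma orientation_sum_at:
  assumes "t \<in> X" "h \<in> \<Union>t"
  shows "(\<Sum>s\<in>X. if h \<in> ori s then c s else 0) = (if h \<in> ori t then c t else (0 :: rat))"
proof -
  have "h \<notin> ori s" if "s \<in> X" "s \<noteq> t" for s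
  proof
    assume "h \<in> ori s"
    then have "h \<in> \<Union>s" using transversal_ends(1)[OF that(1)] by blast
    then have "s = t" using transversal_transition_unique[OF X that(1) assms(1) _ assms(2)] by simp
    then show False using that by simp
  qed
  then have "(\<Sum>s\<in>X. if h \<in> ori s then c s else 0) = (\<Sum>s\<in>{t}. if h \<in> ori s then c s else 0)"
    using transversal_finite[OF X] assms(1) by (intro sum.mono_neutral_right) auto
  then show ?thesis by simp
qed

text \<open>The function is \<open>C h + \<pi> (inc F h)\<close>. On the four half-edges at a vertex
  the potential is constant, and \<open>C\<close> equals \<open>c t\<close> on the chosen pair and 0
  on the other, so \<open>c t\<close> is the jump between the pairs.\<close>

lemma dependency_iff_invariant:
  "(\<Sum>t\<in>X. qscale (c t) (column t)) = 0 \<longleftrightarrow> (\<exists>\<kappa>. invariant X \<kappa> \<and> (\<forall>t\<in>X. c t = \<kappa> (oh t) - \<kappa> (nh t)))"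
    (is "?L \<longleftrightarrow> ?R")
proof -
  define C where "C h = (\<Sum>t\<in>X. if h \<in> ori t then c t else 0)" for h
  have L: "?L \<longleftrightarrow> (\<exists>\<pi>. \<forall>h\<in>H. {h, m h} \<notin> E \<longrightarrow> C (m h) + \<pi> (inc F (m h)) = C h + \<pi> (inc F h))"
    unfolding C_def using dependency_iff_edge_invariant[OF transversal_finite[OF X]] .
  have C: "C h = (if h \<in> ori t then c t else 0)" if "t \<in> X" "h \<in> \<Union>t" for h t
    unfolding C_def using orientation_sum_at[OF that] .
  show ?thesis
  proof
    assume ?L
    then obtain \<pi> where p: "\<forall>h\<in>H. {h, m h} \<notin> E \<longrightarrow> C (m h) + \<pi> (inc F (m h)) = C h + \<pi> (inc F h)"
      using L by blast
    define \<kappa> where "\<kappa> h = C h + \<pi> (inc F h)" for h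
    have pinv: "\<kappa> (mate (\<Union>X) h) = \<kappa> h" if h: "h \<in> H" for h
    proof -
      obtain t where t: "t \<in> X" "t \<in> transitions_at F (inc F h)" "h \<in> \<Union>t"
        using transversal_transition[OF X h] .
      have k: "mate (\<Union>X) h \<in> \<Union>t" using mate_transversal_transition(2)[OF X t(1,3)] .
      have o: "ori t \<in> \<Union>X" using transversal_ends(1)[OF t(1)] t(1) by blast
      note pX = pairing_transversal[OF X]
      have "mate (\<Union>X) h \<in> ori t \<longleftrightarrow> h \<in> ori t"
      proof
        assume "h \<in> ori t"
        then show "mate (\<Union>X) h \<in> ori t" using pair_eq_mate[OF pX o] by blast
      next
        assume "mate (\<Union>X) h \<in> ori t"
        then have "mate (\<Union>X) (mate (\<Union>X) h) \<in> ori t" using pair_eq_mate[OF pX o] by blast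
        then show "h \<in> ori t" using mate_mate[OF pX h] by simp
      qed
      then show ?thesis using C[OF t(1,3)] C[OF t(1) k] inc_mate_transversal[OF X h] by (simp add: \<kappa>_def)
    qed
    \<comment> \<open>The relation says nothing about edges in \<open>E\<close>; parity closes this
      gap.\<close>
    have minv: "\<kappa> (m h) = \<kappa> h" if "h \<in> H" for h
      using edge_invariant_across_E[OF X, of \<kappa>, OF pinv _ that] p by (simp add: \<kappa>_def)
    have "c t = \<kappa> (oh t) - \<kappa> (nh t)" if "t \<in> X" for t
      using transversal_ends[OF that] C[OF that, of "oh t"] C[OF that, of "nh t"] by (simp add: \<kappa>_def)
    then show ?R using pinv minv unfolding invariant_def by blast
  next
    assume ?R
    then obtain \<kappa> where k: "invariant X \<kappa>" "\<forall>t\<in>X. c t = \<kappa> (oh t) - \<kappa> (nh t)" by blast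
    \<comment> \<open>\<open>C\<close> vanishes on the pair that is not chosen, so the potential at
      the vertex has to be the value of \<kappa> on that pair.\<close>
    define \<pi> where "\<pi> v = \<kappa> (nh (THE t. t \<in> X \<and> t \<in> transitions_at F v))" for v
    have eq: "C h + \<pi> (inc F h) = \<kappa> h" if h: "h \<in> H" for h
    proof -
      obtain t where t: "t \<in> X" "t \<in> transitions_at F (inc F h)" "h \<in> \<Union>t"
        using transversal_transition[OF X h] .
      obtain s where s: "X \<inter> transitions_at F (inc F h) = {s}"
        using transversal_at[OF X inc_in_verts[OF wf h]] .
      have "(THE t. t \<in> X \<and> t \<in> transitions_at F (inc F h)) = s"
      proof (rule the_equality)
        show "s \<in> X \<and> s \<in> transitions_at F (inc F h)" using s by blast
        fix t' assume "t' \<in> X \<and> t' \<in> transitions_at F (inc F h)"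
        then have "t' \<in> {s}" using s by blast
        then show "t' = s" by simp
      qed
      moreover have "t \<in> {s}" using s t(1,2) by blast
      ultimately have "\<pi> (inc F h) = \<kappa> (nh t)" by (simp add: \<pi>_def)
      moreover have "\<kappa> h = (if h \<in> ori t then \<kappa> (oh t) else \<kappa> (nh t))"
        using invariant_at[OF _ t(1,3)] k(1) by (simp add: invariant_def)
      ultimately show ?thesis using C[OF t(1,3)] k(2) t(1) by simp
    qed
    have "C (m h) + \<pi> (inc F (m h)) = C h + \<pi> (inc F h)" if "h \<in> H" for h
      using eq[OF that] eq[OF m_in[OF that]] k(1) that by (simp add: invariant_def)
    then show ?L using L by blast
  qed
qed

lemma in_span_imp_invariant:
  assumes "x \<in> X" "S \<subseteq> X" "x \<notin> S" "column x \<in> qv.span (column ` S)"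
  obtains \<kappa> where "invariant X \<kappa>" "\<kappa> (oh x) \<noteq> \<kappa> (nh x)"
proof -
  have fin: "finite X" "finite S" using transversal_finite[OF X] assms(2) finite_subset by auto
  obtain c where c: "column x = (\<Sum>t\<in>S. qscale (c t) (column t))"
    using assms(4) in_span_image_iff[OF fin(2)] by blast
  \<comment> \<open>Moving \<open>column x\<close> to the other side gives a relation on
    \<open>X\<close> with coefficient -1 at \<open>x\<close>; this coefficient is the jump of
    \<kappa> there.\<close>
  define d where "d t = (if t = x then - 1 else if t \<in> S then c t else 0)" for t
  have "(\<Sum>t\<in>X. qscale (d t) (column t)) = (\<Sum>t\<in>insert x S. qscale (d t) (column t))"
    using fin assms(1,2) by (intro sum.mono_neutral_right) (auto simp: d_def)
  also have "\<dots> = qscale (- 1) (column x) + (\<Sum>t\<in>S. qscale (d t) (column t))"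
    using fin assms(3) by (simp add: d_def)
  also have "(\<Sum>t\<in>S. qscale (d t) (column t)) = (\<Sum>t\<in>S. qscale (c t) (column t))"
    using assms(3) by (intro sum.cong) (auto simp: d_def)
  also have "qscale (- 1) (column x) + (\<Sum>t\<in>S. qscale (c t) (column t)) = 0"
    unfolding c[symmetric] by (simp add: fun_eq_iff)
  finally obtain \<kappa> where "invariant X \<kappa>" "\<forall>t\<in>X. d t = \<kappa> (oh t) - \<kappa> (nh t)"
    using dependency_iff_invariant by blast
  moreover have "d x = - 1" by (simp add: d_def)
  ultimately show ?thesis using that[of \<kappa>] assms(1) by fastforce
qed

lemma invariant_separates:
  assumes "invariant X \<kappa>" "t \<in> X" "\<kappa> (oh t) \<noteq> \<kappa> (nh t)" "a \<in> \<Union>t" "h \<in> \<Union>t" "a \<noteq> h" "\<kappa> h = \<kappa> a"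
  shows "h = mate t a"
proof -
  have "\<forall>h\<in>H. \<kappa> (mate (\<Union>X) h) = \<kappa> h" using assms(1) by (simp add: invariant_def)
  then have "\<kappa> a = (if a \<in> ori t then \<kappa> (oh t) else \<kappa> (nh t))" "\<kappa> h = (if h \<in> ori t then \<kappa> (oh t) else \<kappa> (nh t))"
    using invariant_at assms(2,4,5) by blast+
  then have "a \<in> ori t \<longleftrightarrow> h \<in> ori t" using assms(3,7) by (simp split: if_splits)
  then show ?thesis using transversal_same_side_mate(2)[OF assms(2,4,5,6)] by simp
qed

end

text \<open>If both columns were redundant, the half-edges on which the two resulting invariant functions
  agree with their values at some \<open>a\<close> at \<open>v\<close> would be paired up by the edges, while away from \<open>v\<close>
  they are paired up by the transitions and at \<open>v\<close> only \<open>a\<close> itself is left.\<close>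
lemma column_nondegenerate:
  assumes S: "subtransversal (Q_skew F) S" and v: "v \<in> V" "S \<inter> transitions_at F v = {}"
    and xy: "x \<in> transitions_at F v" "y \<in> transitions_at F v" "x \<noteq> y"
    and sp: "column x \<in> qv.span (column ` S)" "column y \<in> qv.span (column ` S)"
  shows False
proof -
  let ?w = "transitions_at F v"
  have w: "?w \<in> Q_skew F" using v by (auto simp: Q_skew_def)
  obtain X0 where X0: "transversal (Q_skew F) X0" "S \<subseteq> X0" using S by (auto simp: subtransversal_def)
  define X where "X = insert x (X0 - ?w)"
  define Y where "Y = insert y (X0 - ?w)"
  have X: "transversal (Q_skew F) X" and Y: "transversal (Q_skew F) Y"
    unfolding X_def Y_def using transversal_exchange[OF Q_skew_disjoint X0(1) w] xy by auto
  have "x \<in> X" "S \<subseteq> X" "x \<notin> S" "y \<in> Y" "S \<subseteq> Y" "y \<notin> S" using X0 v xy by (auto simp: X_def Y_def)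
  obtain \<kappa> where k: "invariant X \<kappa>" "\<kappa> (oh x) \<noteq> \<kappa> (nh x)"
    using in_span_imp_invariant[OF X \<open>x \<in> X\<close> \<open>S \<subseteq> X\<close> \<open>x \<notin> S\<close> sp(1)] .
  obtain \<kappa>' where k': "invariant Y \<kappa>'" "\<kappa>' (oh y) \<noteq> \<kappa>' (nh y)"
    using in_span_imp_invariant[OF Y \<open>y \<in> Y\<close> \<open>S \<subseteq> Y\<close> \<open>y \<notin> S\<close> sp(2)] .
  obtain a where a: "a \<in> hat F v" using hat_nonempty[OF v(1)] by blast
  define A where "A = {h \<in> H. \<kappa> h = \<kappa> a \<and> \<kappa>' h = \<kappa>' a}"
  have finA: "finite A" using wf_graph_finite(2)[OF wf] by (simp add: A_def)
  have "even (card A)"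
  proof (rule even_card_mate_closed[OF pairing_edges[OF wf] finA])
    show "A \<subseteq> H" by (auto simp: A_def)
    fix h assume "h \<in> A"
    then show "m h \<in> A" using m_in k(1) k'(1) by (simp add: A_def invariant_def)
  qed
  moreover have "even (card (A - hat F v))"
  proof (rule even_card_mate_closed[OF pairing_transversal[OF X]])
    show "finite (A - hat F v)" "A - hat F v \<subseteq> H" using finA by (auto simp: A_def)
    fix h assume "h \<in> A - hat F v"
    then have h: "h \<in> H" "inc F h \<noteq> v" "h \<in> A" by (auto simp: A_def in_hat_iff)
    obtain t where t: "t \<in> X" "t \<in> transitions_at F (inc F h)" "h \<in> \<Union>t"
      using transversal_transition[OF X h(1)] .
    have "t \<noteq> x"
    proof
      assume "t = x"
      then have "inc F h = v" using transitions_at_vertex_unique[OF t(2) _ inc_in_verts[OF wf h(1)]] xy(1) by simp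
      then show False using h(2) by simp
    qed
    then have "t \<in> Y" using t(1) by (simp add: X_def Y_def)
    then have "mate (\<Union>X) h = mate (\<Union>Y) h"
      using mate_transversal_transition(1)[OF X t(1,3)] mate_transversal_transition(1)[OF Y _ t(3)] by simp
    moreover have "\<kappa> (mate (\<Union>X) h) = \<kappa> h" using k(1) h(1) by (simp add: invariant_def)
    moreover have "\<kappa>' (mate (\<Union>Y) h) = \<kappa>' h" using k'(1) h(1) by (simp add: invariant_def)
    ultimately have "\<kappa> (mate (\<Union>X) h) = \<kappa> h" "\<kappa>' (mate (\<Union>X) h) = \<kappa>' h" by simp_all
    then show "mate (\<Union>X) h \<in> A - hat F v"
      using h mate_in[OF pairing_transversal[OF X] h(1)] inc_mate_transversal[OF X h(1)]
      by (simp add: A_def in_hat_iff)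
  qed
  \<comment> \<open>At \<open>v\<close>, agreement of \<kappa> leaves only \<open>a\<close> and its
    partner in \<open>x\<close>, agreement of \<open>\<kappa>'\<close> only \<open>a\<close> and its
    partner in \<open>y\<close>. The partners differ since \<open>x\<close> and \<open>y\<close>
    do.\<close>
  moreover have "A \<inter> hat F v = {a}"
  proof -
    have "h = a" if "h \<in> A" "h \<in> hat F v" for h
    proof (rule ccontr)
      assume ne: "h \<noteq> a"
      have U: "\<Union>x = hat F v" "\<Union>y = hat F v" using Union_transition xy by auto
      have eqs: "\<kappa> h = \<kappa> a" "\<kappa>' h = \<kappa>' a" using that(1) by (simp_all add: A_def)
      have "h = mate x a" "h = mate y a"
        using invariant_separates[OF X k(1) \<open>x \<in> X\<close> k(2), of a h]
          invariant_separates[OF Y k'(1) \<open>y \<in> Y\<close> k'(2), of a h] a that(2) ne eqs unfolding U by auto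
      then show False using transition_eqI[OF xy(1,2) a] xy(3) by simp
    qed
    moreover have "a \<in> A" using a by (simp add: A_def in_hat_iff)
    ultimately show ?thesis using a by blast
  qed
  moreover have "card A = card (A - hat F v) + card (A \<inter> hat F v)"
  proof -
    have "A = (A - hat F v) \<union> (A \<inter> hat F v)" by blast
    then show ?thesis using finA card_Un_disjoint[of "A - hat F v" "A \<inter> hat F v"] by fastforce
  qed
  ultimately show False by simp
qed

end

subsection \<open>Circuit partitions\<close>

lemma ex1_unique: "a \<in> A \<Longrightarrow> b \<in> A \<Longrightarrow> \<exists>!p. p \<in> A \<Longrightarrow> a = b"
  by blast

lemma sts_rotations: "sts (rotations w \<union> rotations (rev_walk w)) = {{a, b} |a b. (a, b) \<in> set w}"
proof -
  have r: "set (rotate k w') = set w'" for k and w' :: "('a \<times> 'a) list" by simp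
  have rv: "set (rev_walk w) = {(b, a) |a b. (a, b) \<in> set w}" by (auto simp: rev_walk_def)
  have mem: "w \<in> rotations w" by (auto simp: rotations_def intro!: exI[of _ 0])
  show ?thesis
  proof
    show "sts (rotations w \<union> rotations (rev_walk w)) \<subseteq> {{a, b} |a b. (a, b) \<in> set w}"
    proof
      fix s assume "s \<in> sts (rotations w \<union> rotations (rev_walk w))"
      then obtain a b w' where s: "s = {a, b}" "w' \<in> rotations w \<union> rotations (rev_walk w)" "(a, b) \<in> set w'"
        by (auto simp: sts_def)
      then have "(a, b) \<in> set w \<or> (b, a) \<in> set w" using rv by (auto simp: rotations_def)
      then show "s \<in> {{a, b} |a b. (a, b) \<in> set w}" using s(1) by (auto simp: insert_commute)
    qed
    show "{{a, b} |a b. (a, b) \<in> set w} \<subseteq> sts (rotations w \<union> rotations (rev_walk w))"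
      unfolding sts_def using mem by blast
  qed
qed

context four_regular_graph
begin

context
  fixes X :: "'h set set set" and P :: "('h \<times> 'h) list set set"
  assumes X: "transversal (Q_skew F) X" and P: "circuit_partition F P" and tau: "tau F P = X"
begin

text \<open>A half-edge of \<open>s\<close> also lies in a single transition \<open>s'\<close> of
  the member of \<open>X\<close> at its vertex, and \<open>s'\<close> occurs in \<open>P\<close> by
  the definition of \<open>tau\<close>. Each half-edge lies in only one single transition of
  \<open>P\<close>, so \<open>s = s'\<close>.\<close>

lemma circuit_sts_in_transversal:
  assumes "C \<in> P" "s \<in> sts C"
  shows "s \<in> \<Union>X"
proof -
  obtain w where w: "cwalk_list F w" "C = rotations w \<union> rotations (rev_walk w)"
    using P assms(1) by (auto simp: circuit_partition_def circuit_def)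
  obtain a b where ab: "s = {a, b}" "(a, b) \<in> set w" using assms(2) unfolding w(2) sts_rotations by blast
  then have a: "a \<in> H" using w(1) by (auto simp: cwalk_list_def dst_def in_set_conv_nth)
  obtain t where t: "t \<in> X" "a \<in> \<Union>t" using transversal_transition[OF X a] by blast
  then obtain s' where s': "s' \<in> t" "a \<in> s'" by blast
  have "\<forall>s\<in>t. \<exists>C\<in>P. s \<in> sts C" using t(1) tau by (auto simp: tau_def)
  then obtain C' where C': "C' \<in> P" "s' \<in> sts C'" using s'(1) by blast
  have ex: "\<exists>!p. p \<in> {(C, s). C \<in> P \<and> s \<in> sts C \<and> a \<in> s}" using P a by (simp add: circuit_partition_def)
  have "(C, s) \<in> {(C, s). C \<in> P \<and> s \<in> sts C \<and> a \<in> s}" using assms ab(1) by simp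
  moreover have "(C', s') \<in> {(C, s). C \<in> P \<and> s \<in> sts C \<and> a \<in> s}" using C' s'(2) by simp
  ultimately have "(C, s) = (C', s')" using ex by (rule ex1_unique)
  then show ?thesis using s'(1) t(1) by blast
qed

text \<open>A circuit alternates: \<open>mate (\<Union>X)\<close> leads from \<open>x i\<close> to
  \<open>y i\<close>, and \<open>m\<close> from \<open>y i\<close> to \<open>x\<close> at the next
  index. So its half-edges are closed under both matchings, and an invariant function keeps its
  value all the way round.\<close>

lemma circuit_closed:
  assumes C: "C \<in> P"
  shows "\<Union>(sts C) \<noteq> {}" "\<Union>(sts C) \<subseteq> H"
    "h \<in> \<Union>(sts C) \<Longrightarrow> m h \<in> \<Union>(sts C)" "h \<in> \<Union>(sts C) \<Longrightarrow> mate (\<Union>X) h \<in> \<Union>(sts C)"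
    "\<lbrakk>\<And>h. h \<in> H \<Longrightarrow> f (m h) = f h; \<And>h. h \<in> H \<Longrightarrow> f (mate (\<Union>X) h) = f h;
      h \<in> \<Union>(sts C); h' \<in> \<Union>(sts C)\<rbrakk> \<Longrightarrow> f h = f h'"
proof -
  note pX = pairing_transversal[OF X]
  obtain w where w: "cwalk_list F w" "w \<noteq> []" "C = rotations w \<union> rotations (rev_walk w)"
    using P C by (auto simp: circuit_partition_def circuit_def)
  define n where "n = length w"
  define x where "x i = fst (w ! i)" for i
  define y where "y i = snd (w ! i)" for i
  have n: "0 < n" using w(2) by (simp add: n_def)
  have sts: "sts C = {{a, b} |a b. (a, b) \<in> set w}" unfolding w(3) sts_rotations ..
  have U: "h \<in> \<Union>(sts C) \<longleftrightarrow> (\<exists>i<n. h = x i \<or> h = y i)" for h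
  proof
    assume "h \<in> \<Union>(sts C)"
    then obtain a b where ab: "(a, b) \<in> set w" "h = a \<or> h = b" unfolding sts by blast
    then obtain i where i: "i < n" "w ! i = (a, b)" by (auto simp: in_set_conv_nth n_def)
    have "h = x i \<or> h = y i" unfolding x_def y_def i(2) fst_conv snd_conv by (rule ab(2))
    then show "\<exists>i<n. h = x i \<or> h = y i" using i(1) by blast
  next
    assume "\<exists>i<n. h = x i \<or> h = y i"
    then obtain i where i: "i < n" "h = x i \<or> h = y i" by blast
    have "(x i, y i) \<in> set w" using i(1) by (simp add: n_def x_def y_def)
    then have "{x i, y i} \<in> sts C" unfolding sts by blast
    then show "h \<in> \<Union>(sts C)" using i(2) by blast
  qed
  have in_H: "x i \<in> H" "y i \<in> H" "{y i, x ((i + 1) mod n)} \<in> edges F" if "i < n" for i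
    using w(1) that by (simp_all add: cwalk_list_def dst_def n_def x_def y_def)
  have my: "m (y i) = x ((i + 1) mod n)" if "i < n" for i
    using mate_eqI[OF pairing_edges[OF wf] in_H(3)[OF that]] .
  have px: "mate (\<Union>X) (x i) = y i" if "i < n" for i
  proof -
    have "(x i, y i) \<in> set w" using that by (simp add: n_def x_def y_def)
    then have "{x i, y i} \<in> sts C" unfolding sts by blast
    then have "{x i, y i} \<in> \<Union>X" using circuit_sts_in_transversal[OF C] by blast
    then show ?thesis by (rule mate_eqI[OF pX])
  qed
  have py: "mate (\<Union>X) (y i) = x i" if "i < n" for i
    using mate_mate[OF pX in_H(1)[OF that]] px[OF that] by simp
  have mx: "\<exists>j<n. m (x i) = y j" if i: "i < n" for i
  proof -
    \<comment> \<open>The cyclic predecessor of \<open>i\<close>; subtraction on naturals would stop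
      at 0, so index 0 is sent to \<open>n - 1\<close>.\<close>
    define j where "j = (if i = 0 then n - 1 else i - 1)"
    have j: "j < n" "(j + 1) mod n = i" using i n by (cases "i = 0"; simp add: j_def)+
    have "m (m (y j)) = y j" using m_m in_H(2)[OF j(1)] by blast
    then have "m (x i) = y j" unfolding my[OF j(1)] j(2) .
    then show ?thesis using j(1) by blast
  qed
  have "x 0 \<in> \<Union>(sts C)" unfolding U using n by blast
  then show "\<Union>(sts C) \<noteq> {}" by blast
  show "\<Union>(sts C) \<subseteq> H"
  proof
    fix h assume "h \<in> \<Union>(sts C)"
    then obtain i where "i < n" "h = x i \<or> h = y i" unfolding U by blast
    then show "h \<in> H" using in_H(1,2) by auto
  qed
  show "m h \<in> \<Union>(sts C)" if hU: "h \<in> \<Union>(sts C)"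
  proof -
    obtain i where i: "i < n" "h = x i \<or> h = y i" using hU unfolding U by blast
    have n': "(i + 1) mod n < n" using n by simp
    from i(2) show ?thesis
    proof
      assume hx: "h = x i"
      obtain j where "j < n" "m (x i) = y j" using mx[OF i(1)] by blast
      then show ?thesis unfolding U hx by blast
    next
      assume hy: "h = y i"
      show ?thesis unfolding U hy my[OF i(1)] using n' by blast
    qed
  qed
  show "mate (\<Union>X) h \<in> \<Union>(sts C)" if hU: "h \<in> \<Union>(sts C)"
  proof -
    obtain i where i: "i < n" "h = x i \<or> h = y i" using hU unfolding U by blast
    from i(2) show ?thesis
    proof
      assume hx: "h = x i"
      show ?thesis unfolding U hx px[OF i(1)] using i(1) by blast
    next
      assume hy: "h = y i"
      show ?thesis unfolding U hy py[OF i(1)] using i(1) by blast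
    qed
  qed
  show "f h = f h'" if fm: "\<And>h. h \<in> H \<Longrightarrow> f (m h) = f h" and fp: "\<And>h. h \<in> H \<Longrightarrow> f (mate (\<Union>X) h) = f h"
    and h: "h \<in> \<Union>(sts C)" "h' \<in> \<Union>(sts C)"
  proof -
    have y: "f (y i) = f (x i)" if "i < n" for i
      using fp[OF in_H(1)[OF that]] px[OF that] by simp
    have x: "f (x i) = f (x 0)" if "i < n" for i
      using that
    proof (induction i)
      case (Suc i)
      then have i: "i < n" by simp
      have "f (x (Suc i)) = f (y i)" using fm[OF in_H(2)[OF i]] my[OF i] Suc.prems by simp
      then show ?case using y[OF i] Suc.IH[OF i] by simp
    qed simp
    have "f k = f (x 0)" if k: "k \<in> \<Union>(sts C)" for k
    proof -
      obtain i where i: "i < n" "k = x i \<or> k = y i" using k unfolding U by blast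
      then show ?thesis using x[OF i(1)] y[OF i(1)] by auto
    qed
    then show ?thesis using h by simp
  qed
qed

text \<open>The partition is presented as the fibres of a map on half-edges, the form in which
  \<open>factor_space\<close> counts circuits.\<close>

lemma circuit_of_half_edge:
  obtains circ where "\<And>h. h \<in> H \<Longrightarrow> circ h \<in> P \<and> h \<in> \<Union>(sts (circ h))" "circ ` H = P"
    "\<And>C h. C \<in> P \<Longrightarrow> h \<in> \<Union>(sts C) \<Longrightarrow> circ h = C"
proof -
  define circ where "circ h = (SOME C. C \<in> P \<and> h \<in> \<Union>(sts C))" for h
  have ex: "\<exists>!p. p \<in> {(C, s). C \<in> P \<and> s \<in> sts C \<and> h \<in> s}" if "h \<in> H" for h
    using P that by (simp add: circuit_partition_def)
  have 1: "circ h \<in> P \<and> h \<in> \<Union>(sts (circ h))" if h: "h \<in> H" for h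
  proof -
    obtain p where "p \<in> {(C, s). C \<in> P \<and> s \<in> sts C \<and> h \<in> s}" using ex[OF h] by (rule ex1E)
    then obtain C s where "C \<in> P" "s \<in> sts C" "h \<in> s" by auto
    then have "\<exists>C. C \<in> P \<and> h \<in> \<Union>(sts C)" by blast
    then show ?thesis unfolding circ_def by (rule someI_ex)
  qed
  have 2: "circ h = C" if C: "C \<in> P" "h \<in> \<Union>(sts C)" for C h
  proof -
    have h: "h \<in> H" using circuit_closed(2)[OF C(1)] C(2) by blast
    obtain s where s: "s \<in> sts C" "h \<in> s" using C(2) by blast
    obtain s' where s': "s' \<in> sts (circ h)" "h \<in> s'" using 1[OF h] by blast
    have "(circ h, s') \<in> {(C, s). C \<in> P \<and> s \<in> sts C \<and> h \<in> s}" using 1[OF h] s' by simp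
    moreover have "(C, s) \<in> {(C, s). C \<in> P \<and> s \<in> sts C \<and> h \<in> s}" using C(1) s by simp
    ultimately have "(circ h, s') = (C, s)" using ex[OF h] by (rule ex1_unique)
    then show ?thesis by simp
  qed
  have "circ ` H = P"
  proof
    show "circ ` H \<subseteq> P" using 1 by blast
    show "P \<subseteq> circ ` H"
    proof
      fix C assume C: "C \<in> P"
      then obtain h where h: "h \<in> \<Union>(sts C)" using circuit_closed(1)[OF C] by blast
      then have "h \<in> H" using circuit_closed(2)[OF C] by blast
      then show "C \<in> circ ` H" using 2[OF C h] by blast
    qed
  qed
  then show ?thesis using that[of circ] 1 2 by blast
qed

end

end

section \<open>Circuits as orbits of the product of the two matchings\<close>

lemma distinct_concat_pairs:
  assumes "distinct xs" "inj_on f (set xs)" "\<And>x y. x \<in> set xs \<Longrightarrow> y \<in> set xs \<Longrightarrow> x \<noteq> f y"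
  shows "distinct (concat (map (\<lambda>x. [x, f x]) xs))"
  using assms
proof (induction xs)
  case (Cons a xs)
  have IH: "distinct (concat (map (\<lambda>x. [x, f x]) xs))"
    using Cons.prems by (intro Cons.IH) auto
  have "set (concat (map (\<lambda>x. [x, f x]) xs)) = set xs \<union> f ` set xs" by auto
  moreover have "a \<noteq> f a" "a \<notin> set xs" "a \<notin> f ` set xs" "f a \<notin> set xs" using Cons.prems(1,3) by fastforce+
  moreover have "f a \<notin> f ` set xs" using Cons.prems(1,2) by (auto simp: inj_on_def)
  ultimately show ?case using IH by simp
qed simp

context four_regular_graph
begin

context
  fixes X :: "'h set set set"
  assumes X: "transversal (Q_skew F) X"
begin

abbreviation p :: "'h \<Rightarrow> 'h" where "p \<equiv> mate (\<Union>X)"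

lemmas p_neq = mate_neq[OF pairing_transversal[OF X]]
  and p_in = mate_in[OF pairing_transversal[OF X]]
  and p_p = mate_mate[OF pairing_transversal[OF X]]

text \<open>One step of a walk: across the single transition, then across the edge. Fixing
  everything outside \<open>H\<close> makes it a permutation with finite support, so that its cycles
  are available.\<close>

definition next_half :: "'h \<Rightarrow> 'h" where
  "next_half h = (if h \<in> H then m (p h) else h)"

lemma next_half_permutation: "permutation next_half"
proof -
  have "bij_betw next_half H H"
  proof (rule bij_betw_byWitness[where f' = "\<lambda>h. p (m h)"])
    show "\<forall>a\<in>H. p (m (next_half a)) = a" using m_m p_in p_p by (simp add: next_half_def)
    show "\<forall>a\<in>H. next_half (p (m a)) = a" using m_in m_m p_in p_p by (simp add: next_half_def)
    show "next_half ` H \<subseteq> H" using p_in m_in by (auto simp: next_half_def)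
    show "(\<lambda>h. p (m h)) ` H \<subseteq> H" using p_in m_in by auto
  qed
  then have "next_half permutes H" by (rule bij_imp_permutes) (simp add: next_half_def)
  then show ?thesis using wf_graph_finite(2)[OF wf] permutation_permutes by blast
qed

lemma funpow_next_half_in: "h \<in> H \<Longrightarrow> (next_half ^^ i) h \<in> H"
  by (induction i) (auto simp: next_half_def intro: p_in m_in)

text \<open>Conjugating by \<open>p\<close> inverts \<open>next_half\<close>, so \<open>next_half ^^ (k + 2)\<close> sends \<open>h\<close> to \<open>p h\<close> only if
  \<open>next_half ^^ k\<close> sends \<open>next_half h\<close> to its mate.\<close>
lemma funpow_next_half_neq_mate: "h \<in> H \<Longrightarrow> (next_half ^^ k) h \<noteq> p h"
proof (induction k arbitrary: h rule: less_induct)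
  case (less k)
  consider "k = 0" | "k = 1" | j where "k = Suc (Suc j)" by (metis One_nat_def not0_implies_Suc)
  then show ?case
  proof cases
    case 1
    then show ?thesis using p_neq[OF less.prems] by simp
  next
    case 2
    then show ?thesis using m_neq[OF p_in[OF less.prems]] less.prems by (simp add: next_half_def)
  next
    case 3
    define h' where "h' = next_half h"
    define y where "y = (next_half ^^ j) h'"
    have h': "h' \<in> H" "h' = m (p h)" using less.prems p_in m_in by (simp_all add: h'_def next_half_def)
    have y: "y \<in> H" unfolding y_def by (rule funpow_next_half_in[OF h'(1)])
    have "(next_half ^^ Suc j) h = y" unfolding y_def h'_def by (simp only: funpow_Suc_right o_apply)
    then have "(next_half ^^ k) h = next_half y" unfolding 3 by (simp only: funpow.simps(2)[of "Suc j"] o_apply)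
    then have k: "(next_half ^^ k) h = m (p y)" using y by (simp add: next_half_def)
    show ?thesis
    proof
      assume "(next_half ^^ k) h = p h"
      then have "m (p y) = p h" using k by simp
      then have "m (m (p y)) = h'" using h'(2) by simp
      then have "p y = h'" using m_m[OF p_in[OF y]] by simp
      then have "p (p y) = p h'" by simp
      then have "y = p h'" using p_p[OF y] by simp
      then show False using less.IH[of j h'] h'(1) by (simp add: 3 y_def)
    qed
  qed
qed

text \<open>Followed in one direction, the walk enters its single transitions at the half-edges of
  \<open>orb h\<close> and leaves them at their images under \<open>p\<close>;
  \<open>circuit_halves\<close> joins both kinds.\<close>

definition orb :: "'h \<Rightarrow> 'h set" where "orb h = range (\<lambda>i. (next_half ^^ i) h)"
definition orbit_walk :: "'h \<Rightarrow> ('h \<times> 'h) list" where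
  "orbit_walk h = map (\<lambda>x. (x, p x)) (support next_half h)"
definition orbit_circuit :: "'h \<Rightarrow> ('h \<times> 'h) list set" where
  "orbit_circuit h = rotations (orbit_walk h) \<union> rotations (rev_walk (orbit_walk h))"
definition circuit_halves :: "'h \<Rightarrow> 'h set" where "circuit_halves h = orb h \<union> p ` orb h"

lemma set_support_orb: "set (support next_half h) = orb h"
  unfolding orb_def by (rule support_set[OF next_half_permutation])

lemma orb_sub: "h \<in> H \<Longrightarrow> orb h \<subseteq> H"
  using funpow_next_half_in by (auto simp: orb_def)

text \<open>This keeps the entries of an orbit apart from its exits, so that the walk uses no
  half-edge twice. By periodicity \<open>x\<close> is a forward power of \<open>y\<close>, whatever
  their order on the orbit, and a power never reaches the partner.\<close>

lemma orb_neq_mate: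
  assumes "h \<in> H" "x \<in> orb h" "y \<in> orb h"
  shows "x \<noteq> p y"
proof -
  obtain i j where ij: "x = (next_half ^^ i) h" "y = (next_half ^^ j) h" using assms by (auto simp: orb_def)
  define n where "n = least_power next_half h"
  have n: "0 < n" "(next_half ^^ (n * j)) h = h"
    using least_power_of_permutation(2)[OF next_half_permutation]
      least_power_dvd[OF next_half_permutation, of h "n * j"] by (simp_all add: n_def)
  have "j \<le> n * j" using n(1) by simp
  \<comment> \<open>Adding \<open>n * j\<close>, a multiple of the period that is at least
    \<open>j\<close>, keeps the subtraction on naturals exact.\<close>
  then have eq: "i + n * j = (i + (n * j - j)) + j" by (metis add.assoc le_add_diff_inverse2)
  have "(next_half ^^ (i + (n * j - j))) y = (next_half ^^ (i + (n * j - j) + j)) h"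
    unfolding ij(2) by (simp only: funpow_add o_apply)
  also have "\<dots> = (next_half ^^ (i + n * j)) h" unfolding eq ..
  also have "\<dots> = x" unfolding ij(1) using n(2) by (simp add: funpow_add)
  finally show ?thesis
    using funpow_next_half_neq_mate[of y "i + (n * j - j)"] funpow_next_half_in[OF assms(1)] ij(2) by metis
qed

lemma cwalk_orbit_walk:
  assumes h: "h \<in> H"
  shows "cwalk_list F (orbit_walk h)"
  unfolding cwalk_list_def
proof (intro allI impI)
  define n where "n = least_power next_half h"
  fix i assume "i < length (orbit_walk h)"
  then have i: "i < n" by (simp add: orbit_walk_def n_def)
  have nth: "orbit_walk h ! k = ((next_half ^^ k) h, p ((next_half ^^ k) h))" if "k < n" for k
    using that by (simp add: orbit_walk_def n_def)
  define x where "x = (next_half ^^ i) h"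
  have x: "x \<in> H" unfolding x_def by (rule funpow_next_half_in[OF h])
  have "(next_half ^^ n) h = h" unfolding n_def by (rule least_power_of_permutation(1)[OF next_half_permutation])
  then have "(next_half ^^ ((i + 1) mod n)) h = (next_half ^^ Suc i) h"
    using i by (cases "Suc i = n") auto
  then have nx: "(next_half ^^ ((i + 1) mod n)) h = m (p x)" using x by (simp add: x_def next_half_def)
  have l: "length (orbit_walk h) = n" by (simp add: orbit_walk_def n_def)
  have "(i + 1) mod n < n" using i by simp
  then have 1: "orbit_walk h ! i = (x, p x)" "fst (orbit_walk h ! ((i + 1) mod n)) = m (p x)"
    using nth[OF i] nth nx by (simp_all add: x_def)
  show "dst F (orbit_walk h ! i) \<and>
      {snd (orbit_walk h ! i), fst (orbit_walk h ! ((i + 1) mod length (orbit_walk h)))} \<in> edges F"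
    unfolding l 1 dst_def
    using x p_in[OF x] p_neq[OF x] inc_mate_transversal[OF X x] m_edge[OF p_in[OF x]] by simp
qed

lemma circuit_orbit_circuit:
  assumes h: "h \<in> H"
  shows "circuit F (orbit_circuit h)"
  unfolding circuit_def
proof (intro exI[of _ "orbit_walk h"] conjI)
  show "cwalk_list F (orbit_walk h)" by (rule cwalk_orbit_walk[OF h])
  show "orbit_walk h \<noteq> []"
    using least_power_of_permutation(2)[OF next_half_permutation, of h] by (simp add: orbit_walk_def)
  have "hlist (orbit_walk h) = concat (map (\<lambda>x. [x, p x]) (support next_half h))"
    by (simp add: hlist_def orbit_walk_def comp_def)
  moreover have "distinct (concat (map (\<lambda>x. [x, p x]) (support next_half h)))"
  proof (rule distinct_concat_pairs)
    show "distinct (support next_half h)" by (rule cycle_of_permutation[OF next_half_permutation])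
    show "inj_on p (set (support next_half h))"
      unfolding set_support_orb using orb_sub[OF h] p_p by (metis inj_onI subsetD)
    show "x \<noteq> p y" if "x \<in> set (support next_half h)" "y \<in> set (support next_half h)" for x y
      using that orb_neq_mate[OF h] unfolding set_support_orb by blast
  qed
  ultimately show "distinct (hlist (orbit_walk h))" by simp
qed (rule orbit_circuit_def)

lemma sts_orbit_circuit: "sts (orbit_circuit h) = (\<lambda>x. {x, p x}) ` orb h"
proof -
  have "set (orbit_walk h) = (\<lambda>x. (x, p x)) ` orb h"
    unfolding orbit_walk_def set_map[of "\<lambda>x. (x, p x)"] set_support_orb ..
  then show ?thesis unfolding orbit_circuit_def sts_rotations by auto
qed

lemma circuit_halves_self: "h \<in> circuit_halves h"
  unfolding circuit_halves_def orb_def by (intro UnI1 range_eqI[of _ _ 0]) simp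

lemma circuit_halves_sub: "h \<in> H \<Longrightarrow> circuit_halves h \<subseteq> H"
  using orb_sub p_in by (auto simp: circuit_halves_def)

text \<open>\<open>m\<close> carries an exit to the next entry and an entry to the preceding exit;
  the preceding entry is again in the orbit because the orbit is periodic.\<close>

lemma circuit_halves_closed:
  assumes h: "h \<in> H" and x: "x \<in> circuit_halves h"
  shows "m x \<in> circuit_halves h" "p x \<in> circuit_halves h"
proof -
  have next_in: "next_half y \<in> orb h" if yo: "y \<in> orb h" for y
  proof -
    obtain i where "y = (next_half ^^ i) h" using yo by (auto simp: orb_def)
    then have "next_half y = (next_half ^^ Suc i) h" by simp
    then show ?thesis unfolding orb_def by blast
  qed
  have prev: "\<exists>z\<in>orb h. y = next_half z" if yo: "y \<in> orb h" for y
  proof -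
    obtain i where i: "y = (next_half ^^ i) h" using yo by (auto simp: orb_def)
    define n where "n = least_power next_half h"
    have n: "0 < n" "(next_half ^^ n) h = h"
      using least_power_of_permutation[OF next_half_permutation] by (simp_all add: n_def)
    have "y = (next_half ^^ (i + n)) h" using i n(2) by (simp add: funpow_add)
    also have "i + n = Suc (i + n - 1)" using n(1) by simp
    finally have "y = next_half ((next_half ^^ (i + n - 1)) h)" by simp
    then show ?thesis unfolding orb_def by blast
  qed
  show "p x \<in> circuit_halves h"
    using x p_p orb_sub[OF h] unfolding circuit_halves_def by auto
  show "m x \<in> circuit_halves h"
  proof (cases "x \<in> orb h")
    case True
    then obtain z where z: "z \<in> orb h" "x = next_half z" using prev by blast
    then have "z \<in> H" using orb_sub[OF h] by blast
    then have "m x = p z" using z(2) m_m p_in by (simp add: next_half_def)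
    then show ?thesis using z(1) by (simp add: circuit_halves_def)
  next
    case False
    then obtain z where z: "z \<in> orb h" "x = p z" using x by (auto simp: circuit_halves_def)
    then have "z \<in> H" using orb_sub[OF h] by blast
    then have "m x = next_half z" using z(2) by (simp add: next_half_def)
    then show ?thesis using next_in[OF z(1)] by (simp add: circuit_halves_def)
  qed
qed

lemma circuit_halves_minimal:
  assumes h: "h \<in> H" and A: "h \<in> A" "A \<subseteq> H" "\<And>x. x \<in> A \<Longrightarrow> m x \<in> A" "\<And>x. x \<in> A \<Longrightarrow> p x \<in> A"
  shows "circuit_halves h \<subseteq> A"
proof -
  have "(next_half ^^ i) h \<in> A" for i
  proof (induction i)
    case (Suc i)
    then have "(next_half ^^ i) h \<in> H" using A(2) by blast
    then have "(next_half ^^ Suc i) h = m (p ((next_half ^^ i) h))" by (simp add: next_half_def)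
    then show ?case using A(3,4) Suc by simp
  qed (use A in simp)
  then show ?thesis using A(4) by (auto simp: circuit_halves_def orb_def)
qed

text \<open>Minimality is also applied to a difference: if \<open>h\<close> were missing from the
  set of \<open>x\<close>, the set of \<open>h\<close> without that of \<open>x\<close> would
  contain \<open>h\<close> and be closed under both involutions. It would then be the whole set of
  \<open>h\<close>, although it lacks \<open>x\<close>.\<close>

lemma circuit_halves_eq:
  assumes h: "h \<in> H" and x: "x \<in> circuit_halves h"
  shows "circuit_halves x = circuit_halves h"
proof -
  have xH: "x \<in> H" using circuit_halves_sub[OF h] x by blast
  have sub: "circuit_halves x \<subseteq> circuit_halves h"
    using circuit_halves_minimal[OF xH x circuit_halves_sub[OF h]] circuit_halves_closed[OF h] by blast
  have "h \<in> circuit_halves x"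
  proof (rule ccontr)
    assume "h \<notin> circuit_halves x"
    define A where "A = circuit_halves h - circuit_halves x"
    have AH: "A \<subseteq> H" using circuit_halves_sub[OF h] by (auto simp: A_def)
    have "m y \<in> A" if "y \<in> A" for y
    proof -
      have "m y \<notin> circuit_halves x"
      proof
        assume "m y \<in> circuit_halves x"
        then have "m (m y) \<in> circuit_halves x" using circuit_halves_closed[OF xH] by blast
        then show False using m_m AH that by (auto simp: A_def)
      qed
      then show ?thesis using that circuit_halves_closed[OF h] by (simp add: A_def)
    qed
    moreover have "p y \<in> A" if "y \<in> A" for y
    proof -
      have "p y \<notin> circuit_halves x"
      proof
        assume "p y \<in> circuit_halves x"
        then have "p (p y) \<in> circuit_halves x" using circuit_halves_closed[OF xH] by blast
        then show False using p_p AH that by (auto simp: A_def)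
      qed
      then show ?thesis using that circuit_halves_closed[OF h] by (simp add: A_def)
    qed
    moreover have "h \<in> A" using \<open>h \<notin> circuit_halves x\<close> circuit_halves_self by (simp add: A_def)
    ultimately have "circuit_halves h \<subseteq> A" using circuit_halves_minimal[OF h _ AH] by blast
    then show False using x circuit_halves_self[of x] by (auto simp: A_def)
  qed
  then have "circuit_halves h \<subseteq> circuit_halves x"
    using circuit_halves_minimal[OF h _ circuit_halves_sub[OF xH]] circuit_halves_closed[OF xH] by blast
  then show ?thesis using sub by blast
qed

text \<open>The circuits of all half-edges would do, but a representative per orbit avoids comparing
  circuits with different starting points.\<close>
lemma circuit_partition_exists: "\<exists>P. circuit_partition F P \<and> tau F P = X"
proof -
  define rep where "rep h = (SOME k. k \<in> H \<and> circuit_halves k = circuit_halves h)" for h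
  have rep: "rep h \<in> H" "circuit_halves (rep h) = circuit_halves h" if "h \<in> H" for h
  proof -
    have "h \<in> H \<and> circuit_halves h = circuit_halves h" using that by simp
    then have "rep h \<in> H \<and> circuit_halves (rep h) = circuit_halves h" unfolding rep_def by (rule someI)
    then show "rep h \<in> H" "circuit_halves (rep h) = circuit_halves h" by simp_all
  qed
  have rep_eq: "rep h = rep k" if "circuit_halves h = circuit_halves k" for h k
    using that by (simp add: rep_def)
  define P where "P = (\<lambda>h. orbit_circuit (rep h)) ` H"
  have sts: "s = {x, p x}" "circuit_halves x = circuit_halves h"
    if hx: "h \<in> H" "s \<in> sts (orbit_circuit (rep h))" "x \<in> s" for s h x
  proof -
    obtain y where y: "y \<in> orb (rep h)" "s = {y, p y}" using hx(2) unfolding sts_orbit_circuit by blast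
    then have yH: "y \<in> H" using orb_sub rep(1)[OF hx(1)] by blast
    have "x = y \<or> x = p y" using y(2) hx(3) by simp
    then show "s = {x, p x}" using y(2) p_p[OF yH] by (auto simp: insert_commute)
    have "y \<in> circuit_halves (rep h)" "p y \<in> circuit_halves (rep h)" using y(1) by (simp_all add: circuit_halves_def)
    then have "x \<in> circuit_halves (rep h)" using \<open>x = y \<or> x = p y\<close> by auto
    then show "circuit_halves x = circuit_halves h"
      using circuit_halves_eq[OF rep(1)[OF hx(1)]] rep(2)[OF hx(1)] by simp
  qed
  have mem: "{h, p h} \<in> sts (orbit_circuit (rep h))" if h: "h \<in> H" for h
  proof -
    have "h \<in> circuit_halves (rep h)" using rep(2)[OF h] circuit_halves_self by simp
    then obtain y where y: "y \<in> orb (rep h)" "h = y \<or> h = p y" by (auto simp: circuit_halves_def)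
    then have "y \<in> H" using orb_sub[OF rep(1)[OF h]] by blast
    then have "{h, p h} = {y, p y}" using y(2) p_p by (auto simp: insert_commute)
    then show ?thesis unfolding sts_orbit_circuit using y(1) by blast
  qed
  have "circuit_partition F P"
    unfolding circuit_partition_def
  proof (intro conjI ballI)
    fix C assume "C \<in> P"
    then show "circuit F C" using circuit_orbit_circuit rep(1) by (auto simp: P_def)
  next
    fix h assume h: "h \<in> H"
    show "\<exists>!q. q \<in> {(C, s). C \<in> P \<and> s \<in> sts C \<and> h \<in> s}"
    proof (rule ex1I[of _ "(orbit_circuit (rep h), {h, p h})"])
      show "(orbit_circuit (rep h), {h, p h}) \<in> {(C, s). C \<in> P \<and> s \<in> sts C \<and> h \<in> s}"
        using mem[OF h] h by (simp add: P_def)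
    next
      fix q assume "q \<in> {(C, s). C \<in> P \<and> s \<in> sts C \<and> h \<in> s}"
      then obtain k s where k: "k \<in> H" "q = (orbit_circuit (rep k), s)" "s \<in> sts (orbit_circuit (rep k))" "h \<in> s"
        by (auto simp: P_def)
      then show "q = (orbit_circuit (rep h), {h, p h})"
        using sts[OF k(1,3,4)] rep_eq by metis
    qed
  qed
  moreover have "tau F P = X"
  proof
    show "X \<subseteq> tau F P"
    proof
      fix t assume t: "t \<in> X"
      have "\<exists>C\<in>P. s \<in> sts C" if s: "s \<in> t" for s
      proof -
        note pX = pairing_transversal[OF X]
        have sX: "s \<in> \<Union>X" using s t by blast
        have "s \<noteq> {}" using pairingD(1)[OF pX sX] by auto
        then obtain h where h: "h \<in> s" by blast
        then have hH: "h \<in> H" using pairingD(3)[OF pX sX] by blast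
        have "s \<in> sts (orbit_circuit (rep h))" using mem[OF hH] pair_eq_mate[OF pX sX h] by simp
        then show ?thesis using hH by (auto simp: P_def)
      qed
      then show "t \<in> tau F P" using t transversal_sub[OF X] by (auto simp: tau_def)
    qed
    \<comment> \<open>A single transition of \<open>t\<close> occurring in a circuit gives
      \<open>a\<close> its partner under \<open>p\<close>, and the partner determines the transition
      at the vertex.\<close>
    show "tau F P \<subseteq> X"
    proof
      fix t assume "t \<in> tau F P"
      then have t: "t \<in> transitions F" "\<forall>s\<in>t. \<exists>C\<in>P. s \<in> sts C" by (auto simp: tau_def)
      then obtain v where v: "v \<in> V" "t \<in> transitions_at F v" by (auto simp: transitions_def)
      obtain a where a: "a \<in> hat F v" using hat_nonempty[OF v(1)] by blast
      then have aH: "a \<in> H" "inc F a = v" by (simp_all add: in_hat_iff)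
      have at: "{a, mate t a} \<in> t" using mate_pair_in[OF pairing_transition[OF v(2)] a] .
      then obtain k where k: "k \<in> H" "{a, mate t a} \<in> sts (orbit_circuit (rep k))" using t(2) by (auto simp: P_def)
      have "{a, mate t a} = {a, p a}" using sts(1)[OF k, of a] by simp
      then have eq: "mate t a = p a" using p_neq[OF aH(1)] by (auto simp: doubleton_eq_iff)
      obtain t' where t': "t' \<in> X" "t' \<in> transitions_at F v" "a \<in> \<Union>t'"
        using transversal_transition[OF X aH(1)] aH(2) by blast
      have "mate t a = mate t' a" using eq mate_transversal_transition(1)[OF X t'(1,3)] by simp
      then have "t = t'" by (rule transition_eqI[OF v(2) t'(2) a])
      then show "t \<in> X" using t'(1) by simp
    qed
  qed
  ultimately show ?thesis by blast
qed

end

end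

lemma matroid_rank_on_cong:
  assumes "\<And>X. X \<subseteq> S \<Longrightarrow> r X = r' X"
  shows "matroid_rank_on S r \<longleftrightarrow> matroid_rank_on S r'"
proof -
  have "matroid_rank_on S r'" if r: "matroid_rank_on S r" and eq: "\<And>X. X \<subseteq> S \<Longrightarrow> r X = r' X" for r r' :: "'a set \<Rightarrow> nat"
    unfolding matroid_rank_on_def
  proof (intro conjI allI impI; (elim conjE)?)
    fix X assume "X \<subseteq> S"
    moreover from this have "r X \<le> card X" using r unfolding matroid_rank_on_def by simp
    ultimately show "r' X \<le> card X" using eq[of X] by simp
  next
    fix X Y assume XY: "X \<subseteq> Y" "Y \<subseteq> S"
    then have "r X \<le> r Y" using r unfolding matroid_rank_on_def by simp
    then show "r' X \<le> r' Y" using eq[of X] eq[of Y] XY by simp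
  next
    fix X Y assume XY: "X \<subseteq> S" "Y \<subseteq> S"
    then have "r (X \<union> Y) + r (X \<inter> Y) \<le> r X + r Y" using r unfolding matroid_rank_on_def by simp
    moreover have "X \<union> Y \<subseteq> S" "X \<inter> Y \<subseteq> S" using XY by auto
    ultimately show "r' (X \<union> Y) + r' (X \<inter> Y) \<le> r' X + r' Y" using eq XY by metis
  qed
  then show ?thesis using assms by metis
qed

context four_regular_representation
begin

subsection \<open>The rank of a transversal\<close>

definition component :: "'h \<Rightarrow> 'v set" where
  "component h = conn F `` {inc F h}"

lemma component_eq_iff:
  assumes "h \<in> H" "k \<in> H"
  shows "component h = component k \<longleftrightarrow> (inc F h, inc F k) \<in> conn F"
  unfolding component_def using eq_equiv_class_iff[OF equiv_conn[OF wf]] assms inc_in_verts[OF wf] by blast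

text \<open>Every vertex carries half-edges by 4-regularity, so no component is lost when components
  are counted through half-edges.\<close>

lemma component_image: "component ` H = V // conn F"
proof
  show "component ` H \<subseteq> V // conn F"
    using inc_in_verts[OF wf] by (auto simp: component_def intro: quotientI)
  show "V // conn F \<subseteq> component ` H"
  proof
    fix c assume "c \<in> V // conn F"
    then obtain v where v: "v \<in> V" "c = conn F `` {v}" by (rule quotientE)
    obtain h where "h \<in> hat F v" using hat_nonempty[OF v(1)] by blast
    then have "h \<in> H" "component h = c" using v(2) by (simp_all add: in_hat_iff component_def)
    then show "c \<in> component ` H" by blast
  qed
qed

context
  fixes X :: "'h set set set"
  assumes X: "transversal (Q_skew F) X"
begin

text \<open>Absence of jumps makes \<kappa> equal on all four half-edges at a vertex, so it descends
  to the vertices; invariance along edges then makes it constant on components.\<close>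

lemma component_space_iff:
  "\<kappa> \<in> factor_space H component \<longleftrightarrow>
    (\<forall>h. h \<notin> H \<longrightarrow> \<kappa> h = 0) \<and> invariant X \<kappa> \<and> (\<forall>t\<in>X. \<kappa> (oh t) = \<kappa> (nh t))" (is "?L \<longleftrightarrow> ?R")
proof
  assume ?L
  then obtain \<phi> where k: "\<forall>h. h \<notin> H \<longrightarrow> \<kappa> h = 0" "\<forall>h\<in>H. \<kappa> h = \<phi> (component h)"
    by (auto simp: factor_space_def)
  have eq: "\<kappa> h = \<kappa> k" if "h \<in> H" "k \<in> H" "(inc F h, inc F k) \<in> conn F" for h k
    using component_eq_iff[OF that(1,2)] that k(2) by simp
  have "\<kappa> (m h) = \<kappa> h" if h: "h \<in> H" for h
    using eq[OF h m_in[OF h] conn_mate[OF wf h]] by simp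
  moreover have "\<kappa> (mate (\<Union>X) h) = \<kappa> h" if h: "h \<in> H" for h
    using eq[OF mate_in[OF pairing_transversal[OF X] h] h] inc_mate_transversal[OF X h]
      conn_refl[OF inc_in_verts[OF wf h]] by simp
  moreover have "\<kappa> (oh t) = \<kappa> (nh t)" if t: "t \<in> X" for t
    using eq[OF transversal_ends(6,7)[OF X t]] transversal_ends(8)[OF X t]
      conn_refl[OF inc_in_verts[OF wf transversal_ends(7)[OF X t]]] by simp
  ultimately show ?R using k(1) unfolding invariant_def by blast
next
  assume R: ?R
  define f where "f v = \<kappa> (SOME h. h \<in> hat F v)" for v
  have hat_const: "\<kappa> h = \<kappa> k" if hk: "h \<in> H" "k \<in> H" "inc F h = inc F k" for h k
  proof -
    obtain t where t: "t \<in> X" "t \<in> transitions_at F (inc F h)" "h \<in> \<Union>t"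
      using transversal_transition[OF X hk(1)] by blast
    have k: "k \<in> \<Union>t" using Union_transition[OF t(2)] hk by (simp add: in_hat_iff)
    have pinv: "\<forall>h\<in>H. \<kappa> (mate (\<Union>X) h) = \<kappa> h" using R by (simp add: invariant_def)
    have "\<kappa> x = \<kappa> (nh t)" if "x \<in> \<Union>t" for x
      using invariant_at[OF X pinv t(1) that] R t(1) by simp
    then show ?thesis using t(3) k by simp
  qed
  have f: "f (inc F h) = \<kappa> h" if h: "h \<in> H" for h
  proof -
    have "h \<in> hat F (inc F h)" using h by (simp add: in_hat_iff)
    then have "(SOME k. k \<in> hat F (inc F h)) \<in> hat F (inc F h)" by (rule someI)
    then have "(SOME k. k \<in> hat F (inc F h)) \<in> H" "inc F (SOME k. k \<in> hat F (inc F h)) = inc F h"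
      by (simp_all add: in_hat_iff)
    then show ?thesis unfolding f_def using hat_const[OF _ h] by simp
  qed
  have fm: "f (inc F (m h)) = f (inc F h)" if h: "h \<in> H" for h
    using f[OF h] f[OF m_in[OF h]] R h by (simp add: invariant_def)
  define \<phi> where "\<phi> c = f (SOME v. v \<in> c)" for c
  have "\<kappa> h = \<phi> (component h)" if h: "h \<in> H" for h
  proof -
    have "inc F h \<in> component h" using conn_refl[OF inc_in_verts[OF wf h]] by (simp add: component_def)
    then have "(SOME v. v \<in> component h) \<in> component h" by (rule someI)
    then have "(inc F h, SOME v. v \<in> component h) \<in> conn F" by (simp add: component_def)
    then have "f (inc F h) = f (SOME v. v \<in> component h)" by (rule conn_invariant[OF wf]) (rule fm)
    then show ?thesis using f[OF h] by (simp add: \<phi>_def)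
  qed
  then show ?L using R unfolding factor_space_def by blast
qed

lemma invariant_space_circuits:
  assumes P: "circuit_partition F P" and tau: "tau F P = X"
  obtains circ where "circ ` H = P"
    "\<And>\<kappa>. \<kappa> \<in> factor_space H circ \<longleftrightarrow> (\<forall>h. h \<notin> H \<longrightarrow> \<kappa> h = 0) \<and> invariant X \<kappa>"
proof -
  note PX = X P tau
  obtain circ where c: "\<And>h. h \<in> H \<Longrightarrow> circ h \<in> P \<and> h \<in> \<Union>(sts (circ h))" "circ ` H = P"
    "\<And>C h. C \<in> P \<Longrightarrow> h \<in> \<Union>(sts C) \<Longrightarrow> circ h = C"
    using circuit_of_half_edge[OF PX] by metis
  have "\<kappa> \<in> factor_space H circ \<longleftrightarrow> (\<forall>h. h \<notin> H \<longrightarrow> \<kappa> h = 0) \<and> invariant X \<kappa>" (is "?L \<longleftrightarrow> ?R") for \<kappa>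
  proof
    assume ?L
    then obtain \<phi> where k: "\<forall>h. h \<notin> H \<longrightarrow> \<kappa> h = 0" "\<forall>h\<in>H. \<kappa> h = \<phi> (circ h)"
      by (auto simp: factor_space_def)
    have "circ (m h) = circ h" "circ (mate (\<Union>X) h) = circ h" if h: "h \<in> H" for h
    proof -
      have C: "circ h \<in> P" "h \<in> \<Union>(sts (circ h))" using c(1)[OF h] by simp_all
      show "circ (m h) = circ h" by (rule c(3)[OF C(1) circuit_closed(3)[OF PX C]])
      show "circ (mate (\<Union>X) h) = circ h" by (rule c(3)[OF C(1) circuit_closed(4)[OF PX C]])
    qed
    then show ?R using k m_in mate_in[OF pairing_transversal[OF X]] by (simp add: invariant_def)
  next
    assume R: ?R
    define \<phi> where "\<phi> C = \<kappa> (SOME h. h \<in> \<Union>(sts C))" for C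
    have "\<kappa> h = \<phi> (circ h)" if h: "h \<in> H" for h
    proof -
      have C: "circ h \<in> P" "h \<in> \<Union>(sts (circ h))" using c(1)[OF h] by simp_all
      have s: "(SOME k. k \<in> \<Union>(sts (circ h))) \<in> \<Union>(sts (circ h))" using C(2) by (rule someI)
      have "\<kappa> h = \<kappa> (SOME k. k \<in> \<Union>(sts (circ h)))"
      proof (rule circuit_closed(5)[OF PX C(1) _ _ C(2) s])
        fix h assume "h \<in> H"
        then show "\<kappa> (m h) = \<kappa> h" "\<kappa> (mate (\<Union>X) h) = \<kappa> h" using R by (simp_all add: invariant_def)
      qed
      then show ?thesis by (simp add: \<phi>_def)
    qed
    then show ?L using R unfolding factor_space_def by blast
  qed
  then show ?thesis using that[of circ] c(2) by blast
qed

text \<open>Rank-nullity is applied twice. \<Phi> maps coefficient vectors to combinations of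
  columns; its kernel is the image of \<open>L\<close>, which maps an invariant function to its
  jumps. The kernel of \<open>L\<close> consists of the functions constant on components.\<close>

lemma dim_column_transversal:
  assumes P: "circuit_partition F P" and tau: "tau F P = X"
  shows "int (qv.dim (column ` X)) = int (card V) - (int (card P) - int (ncomp F))"
proof -
  obtain circ where circ: "circ ` H = P"
    "\<And>\<kappa>. \<kappa> \<in> factor_space H circ \<longleftrightarrow> (\<forall>h. h \<notin> H \<longrightarrow> \<kappa> h = 0) \<and> invariant X \<kappa>"
    using invariant_space_circuits[OF P tau] by metis
  note finX = transversal_finite[OF X] and finH = wf_graph_finite(2)[OF wf]
  define \<Phi> where "\<Phi> c = (\<Sum>t\<in>X. qscale (c t) (column t))" for c
  define L where "L \<kappa> = (\<lambda>t. if t \<in> X then \<kappa> (oh t) - \<kappa> (nh t) else 0)" for \<kappa> :: "'h \<Rightarrow> rat"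
  define K where "K = factor_space X (\<lambda>t. t)"
  have K: "c \<in> K \<longleftrightarrow> (\<forall>t. t \<notin> X \<longrightarrow> c t = 0)" for c
    unfolding K_def factor_space_def by auto
  have lin: "Vector_Spaces.linear qscale qscale \<Phi>" "Vector_Spaces.linear qscale qscale L"
    by (rule linear_qscaleI;
        simp add: \<Phi>_def L_def fun_eq_iff sum_fun_apply sum.distrib sum_distrib_left algebra_simps)+
  have "\<Phi> ` K = qv.span (column ` X)"
  proof
    have "\<Phi> c \<in> qv.span (column ` X)" for c
      unfolding \<Phi>_def by (intro qv.span_sum qv.span_scale qv.span_base imageI)
    then show "\<Phi> ` K \<subseteq> qv.span (column ` X)" by blast
    show "qv.span (column ` X) \<subseteq> \<Phi> ` K"
    proof
      fix y assume "y \<in> qv.span (column ` X)"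
      then obtain c where y: "y = (\<Sum>t\<in>X. qscale (c t) (column t))" using in_span_image_iff[OF finX] by blast
      define d where "d t = (if t \<in> X then c t else 0)" for t
      have "y = \<Phi> d" unfolding y \<Phi>_def by (intro sum.cong) (simp_all add: d_def)
      moreover have "d \<in> K" by (simp add: K d_def)
      ultimately show "y \<in> \<Phi> ` K" by blast
    qed
  qed
  then have 1: "card X = qv.dim (column ` X) + qv.dim {c \<in> K. \<Phi> c = 0}"
    using factor_space_rank_nullity[OF finX lin(1), of "\<lambda>t. t"] by (simp add: K_def)
  have "{c \<in> K. \<Phi> c = 0} = L ` factor_space H circ"
  proof
    show "{c \<in> K. \<Phi> c = 0} \<subseteq> L ` factor_space H circ"
    proof
      fix c assume "c \<in> {c \<in> K. \<Phi> c = 0}"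
      then have c: "\<forall>t. t \<notin> X \<longrightarrow> c t = 0" "\<Phi> c = 0" using K by auto
      then obtain \<kappa> where k: "invariant X \<kappa>" "\<forall>t\<in>X. c t = \<kappa> (oh t) - \<kappa> (nh t)"
        using dependency_iff_invariant[OF X] unfolding \<Phi>_def by blast
      \<comment> \<open>An invariant function is unconstrained outside \<open>H\<close>, where
        members of \<open>factor_space\<close> must vanish.\<close>
      define \<kappa>' where "\<kappa>' h = (if h \<in> H then \<kappa> h else 0)" for h
      have "\<kappa>' \<in> factor_space H circ"
        unfolding circ(2) using k(1) m_in mate_in[OF pairing_transversal[OF X]]
        by (simp add: \<kappa>'_def invariant_def)
      moreover have "c = L \<kappa>'"
        using c(1) k(2) transversal_ends(6,7)[OF X] by (auto simp: L_def \<kappa>'_def)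
      ultimately show "c \<in> L ` factor_space H circ" by blast
    qed
    show "L ` factor_space H circ \<subseteq> {c \<in> K. \<Phi> c = 0}"
    proof
      fix c assume "c \<in> L ` factor_space H circ"
      then obtain \<kappa> where k: "invariant X \<kappa>" "c = L \<kappa>" using circ(2) by blast
      have "\<Phi> c = 0" unfolding \<Phi>_def dependency_iff_invariant[OF X] using k by (auto simp: L_def)
      then show "c \<in> {c \<in> K. \<Phi> c = 0}" using k(2) by (simp add: K L_def)
    qed
  qed
  moreover have "{\<kappa> \<in> factor_space H circ. L \<kappa> = 0} = factor_space H component"
  proof (rule set_eqI)
    fix \<kappa>
    have "L \<kappa> = 0 \<longleftrightarrow> (\<forall>t\<in>X. \<kappa> (oh t) = \<kappa> (nh t))" by (auto simp: L_def fun_eq_iff)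
    then show "\<kappa> \<in> {\<kappa> \<in> factor_space H circ. L \<kappa> = 0} \<longleftrightarrow> \<kappa> \<in> factor_space H component"
      using circ(2) component_space_iff by simp
  qed
  ultimately have 2: "card P = qv.dim {c \<in> K. \<Phi> c = 0} + ncomp F"
    using factor_space_rank_nullity[OF finH lin(2), of circ] dim_factor_space[OF finH, of component]
    by (simp add: circ(1) component_image ncomp_def)
  show ?thesis using 1 2 card_transversal[OF X] by simp
qed

end

subsection \<open>The rank function\<close>

text \<open>The value 0 outside subtransversals matches the normalisation in \<open>Q_rank\<close>,
  so that the two can be equal as total functions.\<close>

definition column_rank :: "'h set set set \<Rightarrow> nat" where
  "column_rank S = (if subtransversal (Q_skew F) S then qv.dim (column ` S) else 0)"

lemma col_rank_eq: "col_rank \<Gamma> (CM_Delta F T ori) S = qv.dim (column ` S)"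
  by (simp add: col_rank_def column_def[abs_def])

lemma subtransversal_subset: "subtransversal \<Omega> S \<Longrightarrow> S' \<subseteq> S \<Longrightarrow> subtransversal \<Omega> S'"
  unfolding subtransversal_def by blast

lemma subtransversal_finite: "subtransversal (Q_skew F) S \<Longrightarrow> finite S"
  unfolding subtransversal_def using transversal_finite finite_subset by blast

lemma multimatroid_column_rank: "multimatroid (transitions F) (Q_skew F) column_rank"
proof -
  have 1: "matroid_rank_on S column_rank" if S: "subtransversal (Q_skew F) S" for S
  proof -
    have "column_rank X = qv.dim (column ` X)" if "X \<subseteq> S" for X
      using subtransversal_subset[OF S that] by (simp add: column_rank_def)
    then show ?thesis
      using matroid_rank_on_dim_image[OF subtransversal_finite[OF S], of column]
        matroid_rank_on_cong[of S column_rank "\<lambda>X. qv.dim (column ` X)"] by simp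
  qed
  have 2: "column_rank S < max (column_rank (S \<union> {x})) (column_rank (S \<union> {y}))"
    if w: "\<omega> \<in> Q_skew F" "x \<in> \<omega>" "y \<in> \<omega>" and S: "subtransversal (Q_skew F) S" "S \<inter> \<omega> = {}" "x \<noteq> y" for S \<omega> x y
  proof (rule ccontr)
    assume neg: "\<not> ?thesis"
    obtain v where v: "v \<in> V" "\<omega> = transitions_at F v" using w(1) by (auto simp: Q_skew_def)
    note fin = subtransversal_finite[OF S(1)]
    have sp: "column z \<in> qv.span (column ` S)" if z: "z \<in> \<omega>" "column_rank (S \<union> {z}) \<le> column_rank S" for z
    proof -
      have "subtransversal (Q_skew F) (insert z S)"
        by (rule subtransversal_insert[OF Q_skew_disjoint S(1) w(1) z(1) S(2)])
      then have "qv.dim (insert (column z) (column ` S)) \<le> qv.dim (column ` S)"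
        using z(2) S(1) by (simp add: column_rank_def)
      moreover have "qv.dim (column ` S) \<le> qv.dim (insert (column z) (column ` S))"
        using fin by (intro qv.dim_mono_finite) (auto intro: qv.span_base)
      ultimately show ?thesis using fin by (intro qv.dim_insert_eq_imp_in_span) auto
    qed
    have "column_rank (S \<union> {x}) \<le> column_rank S" "column_rank (S \<union> {y}) \<le> column_rank S" using neg by auto
    then have "column x \<in> qv.span (column ` S)" "column y \<in> qv.span (column ` S)"
      using sp[OF w(2)] sp[OF w(3)] by blast+
    then show False
      using column_nondegenerate[OF S(1) v(1) S(2)[unfolded v(2)] w(2)[unfolded v(2)] w(3)[unfolded v(2)] S(3)] by blast
  qed
  show ?thesis
    unfolding multimatroid_def
  proof (intro conjI finite_transitions Q_skew_nonempty Q_skew_Union Q_skew_disjoint)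
    show "\<forall>S. subtransversal (Q_skew F) S \<longrightarrow> matroid_rank_on S column_rank" using 1 by blast
  qed (intro allI ballI impI, elim conjE, rule 2)
qed

text \<open>Every transversal comes from a circuit partition, which fixes the value of any competing
  rank function there; the values on transversals determine all others.\<close>

lemma Q_rank_eq: "Q_rank F = column_rank"
  unfolding Q_rank_def
proof (rule the_equality)
  show "multimatroid (transitions F) (Q_skew F) column_rank
      \<and> (\<forall>T P. transversal (Q_skew F) T \<and> circuit_partition F P \<and> tau F P = T
             \<longrightarrow> int (column_rank T) = int (card (verts F)) - (int (card P) - int (ncomp F)))
      \<and> (\<forall>X. \<not> subtransversal (Q_skew F) X \<longrightarrow> column_rank X = 0)"
  proof (intro conjI allI impI; (elim conjE)?)
    fix Y P assume Y: "transversal (Q_skew F) Y" "circuit_partition F P" "tau F P = Y"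
    have "subtransversal (Q_skew F) Y" using Y(1) by (auto simp: subtransversal_def)
    then show "int (column_rank Y) = int (card V) - (int (card P) - int (ncomp F))"
      using dim_column_transversal[OF Y] by (simp add: column_rank_def)
  qed (simp_all add: multimatroid_column_rank column_rank_def)
next
  fix r assume r: "multimatroid (transitions F) (Q_skew F) r
      \<and> (\<forall>T P. transversal (Q_skew F) T \<and> circuit_partition F P \<and> tau F P = T
             \<longrightarrow> int (r T) = int (card (verts F)) - (int (card P) - int (ncomp F)))
      \<and> (\<forall>X. \<not> subtransversal (Q_skew F) X \<longrightarrow> r X = 0)"
  then have r1: "multimatroid (transitions F) (Q_skew F) r"
    and r3: "\<And>S. \<not> subtransversal (Q_skew F) S \<Longrightarrow> r S = 0"
    by simp_all
  have r2: "int (r Y) = int (card V) - (int (card P) - int (ncomp F))"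
    if "transversal (Q_skew F) Y" "circuit_partition F P" "tau F P = Y" for Y P
    using r[THEN conjunct2, THEN conjunct1, rule_format, of Y P] that by blast
  have eq: "r Y = column_rank Y" if Y: "transversal (Q_skew F) Y" for Y
  proof -
    obtain P where P: "circuit_partition F P" "tau F P = Y" using circuit_partition_exists[OF Y] by blast
    have "subtransversal (Q_skew F) Y" using Y by (auto simp: subtransversal_def)
    then have "int (column_rank Y) = int (r Y)"
      using dim_column_transversal[OF Y P] r2[OF Y P] by (simp add: column_rank_def)
    then show ?thesis by simp
  qed
  show "r = column_rank"
  proof
    fix S
    show "r S = column_rank S"
    proof (cases "subtransversal (Q_skew F) S")
      case True
      show ?thesis
        using multimatroid_rank_le[OF r1 multimatroid_column_rank Q_skew_two _ True]
          multimatroid_rank_le[OF multimatroid_column_rank r1 Q_skew_two _ True] eq by (simp add: le_antisym)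
    next
      case False
      then show ?thesis using r3 by (simp add: column_rank_def)
    qed
  qed
qed

lemma represents_Q: "represents (Q_skew F) (Q_rank F) \<Gamma> (CM_Delta F T ori)"
  unfolding represents_def Q_rank_eq col_rank_eq by (simp add: column_rank_def)

end

context four_regular_representation
begin

subsection \<open>Strictness\<close>

text \<open>Pigeonhole: distinct edges of \<open>E\<close> lie in distinct components, so as many
  edges as components leave no component out.\<close>

lemma component_meets_E:
  assumes card: "card E = ncomp F" and h: "h \<in> H"
  obtains e k where "e \<in> E" "k \<in> e" "k \<in> H" "component k = component h"
proof -
  define r where "r e = (SOME k. k \<in> e)" for e :: "'h set"
  have r: "r e \<in> e" "r e \<in> H" if "e \<in> E" for e
  proof -
    have eF: "e \<in> edges F" using E_sub that by blast
    then have "e \<noteq> {}" using pairingD(1)[OF pairing_edges[OF wf]] by fastforce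
    then show "r e \<in> e" unfolding r_def by (simp add: some_in_eq)
    then show "r e \<in> H" by (rule pairingD(3)[OF pairing_edges[OF wf] eF])
  qed
  define g where "g e = component (r e)" for e
  have inj: "inj_on g E"
  proof (rule inj_onI)
    fix e e' assume e: "e \<in> E" "e' \<in> E" "g e = g e'"
    then have "(inc F (r e), inc F (r e')) \<in> conn F"
      using component_eq_iff[OF r(2) r(2), of e e'] by (simp add: g_def)
    then have "\<exists>h1\<in>e. \<exists>h2\<in>e'. (inc F h1, inc F h2) \<in> conn F" using r(1)[OF e(1)] r(1)[OF e(2)] by blast
    then show "e = e'" by (rule E_uniq[rule_format, OF e(1,2)])
  qed
  have "finite (V // conn F)" unfolding component_image[symmetric] using wf_graph_finite(2)[OF wf] by simp
  moreover have "g ` E \<subseteq> V // conn F" unfolding component_image[symmetric] using r(2) by (auto simp: g_def)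
  moreover have "card (g ` E) = card (V // conn F)" using card_image[OF inj] card by (simp add: ncomp_def)
  ultimately have "g ` E = V // conn F" by (rule card_subset_eq)
  then have "component h \<in> g ` E" unfolding component_image[symmetric] using h by simp
  then obtain e where "e \<in> E" "component h = g e" by (rule imageE)
  then show ?thesis using that[of e "r e"] r by (simp add: g_def)
qed

context
  fixes X :: "'h set set set"
  assumes X: "transversal (Q_skew F) X"
begin

lemma transversal_hat_split:
  assumes "t \<in> X"
  shows "ori t = {oh t, mate (\<Union>X) (oh t)}" "hat F (inc F (oh t)) - ori t = {nh t, mate (\<Union>X) (nh t)}"
proof -
  note o = transversal_ends[OF X assms] and pX = pairing_transversal[OF X]
  have oX: "ori t \<in> \<Union>X" using o(1) assms by blast
  show 1: "ori t = {oh t, mate (\<Union>X) (oh t)}" using pair_eq_mate[OF pX oX o(2)] .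
  have at: "t \<in> transitions_at F (inc F (oh t))" using transversal_transition_at(1)[OF X assms o(3)] .
  have mo: "mate t (oh t) = mate (\<Union>X) (oh t)" using mate_transversal_transition(1)[OF X assms o(3)] by simp
  have hat: "oh t \<in> hat F (inc F (oh t))" "nh t \<in> hat F (inc F (oh t))" using o by (simp_all add: in_hat_iff)
  have "{nh t, mate t (nh t)} \<in> t" using mate_pair_in[OF pairing_transition[OF at] hat(2)] .
  then have "{nh t, mate (\<Union>X) (nh t)} \<in> t" using mate_transversal_transition(1)[OF X assms o(4)] by simp
  then have "{nh t, mate (\<Union>X) (nh t)} \<in> {ori t, hat F (inc F (oh t)) - ori t}"
    using equalityD1[OF transition_eq_mate[OF at hat(1)], THEN subsetD] unfolding mo 1[symmetric] by blast
  moreover have "{nh t, mate (\<Union>X) (nh t)} \<noteq> ori t" using o(5) by blast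
  ultimately show "hat F (inc F (oh t)) - ori t = {nh t, mate (\<Union>X) (nh t)}" by simp
qed

text \<open>A cycle vector orthogonal to a transversal of full rank has constant absolute value on each
  component, and it vanishes on the deleted edges.\<close>
lemma orthogonal_cycle_zero:
  assumes ind: "\<forall>c. (\<Sum>t\<in>X. qscale (c t) (column t)) = 0 \<longrightarrow> (\<forall>t\<in>X. c t = 0)"
    and card: "card E = ncomp F"
    and z: "z \<in> Z" "\<forall>t\<in>X. pairing_value z t = 0"
    and h: "h \<in> H"
  shows "z {h, m h} = 0"
proof -
  note pX = pairing_transversal[OF X] and finH = wf_graph_finite(2)[OF wf]
  \<comment> \<open>The amount of the flow \<open>z\<close> that leaves the vertex of
    \<open>h\<close> through \<open>h\<close>.\<close>
  define \<zeta> where "\<zeta> h = sgnh T h * z {h, m h}" for h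
  have mz: "\<zeta> (m h) = - \<zeta> h" if "h \<in> H" for h
    using sgnh_mate[OF wf dir that] m_m[OF that] by (simp add: \<zeta>_def insert_commute)
  have on_ori: "(\<Sum>h\<in>ori t. \<zeta> h) = 0" if t: "t \<in> X" for t
  proof -
    have "ori t \<subseteq> H" using transversal_ends(1)[OF X t] transversal_transition_at(2)[OF X t] by blast
    then have "(\<Sum>h\<in>ori t. \<zeta> h) = (\<Sum>h\<in>H. if h \<in> ori t then \<zeta> h else 0)"
      using finH by (simp add: sum.If_cases Int_absorb1)
    also have "\<dots> = pairing_value z t"
      unfolding pairing_value_eq_sum by (intro sum.cong) (simp_all add: \<zeta>_def)
    finally show ?thesis using z(2) t by simp
  qed
  have on_hat: "(\<Sum>h\<in>hat F v. \<zeta> h) = 0" if v: "v \<in> V" for v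
  proof -
    have "0 = (\<Sum>e\<in>edges F - E. incmat F T v e * z e)" using z(1) v Z_iff by simp
    also have "\<dots> = (\<Sum>e\<in>edges F. incmat F T v e * z e)"
      using z(1) Z_iff wf_graph_finite(3)[OF wf] by (intro sum.mono_neutral_left) auto
    also have "\<dots> = (\<Sum>e\<in>edges F. z e * (\<Sum>h\<in>e. if inc F h = v then - sgnh T h else 0))"
      using incmat_eq_sum[OF wf dir] by (intro sum.cong) simp_all
    also have "\<dots> = (\<Sum>h\<in>H. z {h, m h} * (if inc F h = v then - sgnh T h else 0))"
      by (rule sum_edges_half_edges[OF wf dir])
    also have "\<dots> = (\<Sum>h\<in>H. if inc F h = v then - \<zeta> h else 0)"
      by (intro sum.cong) (simp_all add: \<zeta>_def)
    also have "\<dots> = (\<Sum>h\<in>hat F v. - \<zeta> h)"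
      using finH by (simp add: sum.If_cases hat_def Int_def)
    finally show ?thesis by (simp add: sum_negf)
  qed
  \<comment> \<open>Orthogonality makes the flow through the chosen pair balance, and Kirchhoff's
    law makes the flow through all four half-edges balance. So the other pair balances too, and
    partners carry opposite values.\<close>
  have pz: "\<zeta> (mate (\<Union>X) h) = - \<zeta> h" if h: "h \<in> H" for h
  proof -
    obtain t where t: "t \<in> X" "t \<in> transitions_at F (inc F h)" "h \<in> \<Union>t"
      using transversal_transition[OF X h] .
    note o = transversal_ends[OF X t(1)] and s = transversal_hat_split[OF t(1)]
    let ?o = "oh t" and ?n = "nh t" and ?p = "mate (\<Union>X)"
    have ho: "oh t \<in> hat F (inc F h)" using Union_transition[OF t(2)] o(3) by simp
    then have inc: "inc F (oh t) = inc F h" by (simp add: in_hat_iff)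
    have ne: "?p ?o \<noteq> ?o" "?p ?n \<noteq> ?n" using mate_neq[OF pX] o(6,7) by auto
    have 1: "\<zeta> ?o + \<zeta> (?p ?o) = 0" using on_ori[OF t(1)] ne(1) unfolding s(1) by simp
    have osub: "ori t \<subseteq> hat F (inc F ?o)"
      unfolding s(1) using o(6) mate_in[OF pX o(6)] inc_mate_transversal[OF X o(6)] by (simp add: in_hat_iff)
    have fin: "finite (hat F (inc F ?o))" using finH by (simp add: hat_def)
    have "(\<Sum>h\<in>hat F (inc F ?o). \<zeta> h) = 0" using on_hat[OF inc_in_verts[OF wf o(6)]] .
    then have "(\<Sum>h\<in>hat F (inc F ?o) - ori t. \<zeta> h) = 0"
      using sum.subset_diff[OF osub fin, of \<zeta>] on_ori[OF t(1)] by simp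
    then have 2: "\<zeta> ?n + \<zeta> (?p ?n) = 0" using ne(2) unfolding s(2) by simp
    have "h \<in> hat F (inc F ?o)" using h inc by (simp add: in_hat_iff)
    then have "h \<in> ori t \<or> h \<in> hat F (inc F ?o) - ori t" by blast
    then have "h \<in> {?o, ?p ?o} \<or> h \<in> {?n, ?p ?n}" unfolding s(2) using s(1) by blast
    then consider "h = ?o" | "h = ?p ?o" | "h = ?n" | "h = ?p ?n" by blast
    then show ?thesis
    proof cases
      case 1
      then show ?thesis using \<open>\<zeta> ?o + \<zeta> (?p ?o) = 0\<close> by (simp add: eq_neg_iff_add_eq_0 add.commute)
    next
      case 2
      have "?p h = ?o" unfolding 2 by (rule mate_mate[OF pX o(6)])
      then show ?thesis using 2 1 by (simp add: eq_neg_iff_add_eq_0)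
    next
      case 3
      then show ?thesis using 2 by (simp add: eq_neg_iff_add_eq_0 add.commute)
    next
      case 4
      have "?p h = ?n" unfolding 4 by (rule mate_mate[OF pX o(7)])
      then show ?thesis using 4 2 by (simp add: eq_neg_iff_add_eq_0)
    qed
  qed
  \<comment> \<open>Both matchings only reverse the sign of \<zeta>, so its absolute value is
    invariant; independence of the columns then forbids jumps.\<close>
  define \<kappa> where "\<kappa> h = (if h \<in> H then \<bar>\<zeta> h\<bar> else 0)" for h
  have inv: "invariant X \<kappa>"
    using mz pz m_in mate_in[OF pX] by (simp add: invariant_def \<kappa>_def)
  then have "(\<Sum>t\<in>X. qscale (\<kappa> (oh t) - \<kappa> (nh t)) (column t)) = 0"
    unfolding dependency_iff_invariant[OF X] by blast
  then have "\<forall>t\<in>X. \<kappa> (oh t) - \<kappa> (nh t) = 0" by (rule ind[rule_format, THEN ballI])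
  then have "\<forall>t\<in>X. \<kappa> (oh t) = \<kappa> (nh t)" by simp
  then have "\<kappa> \<in> factor_space H component"
    unfolding component_space_iff[OF X] using inv by (simp add: \<kappa>_def)
  then obtain \<phi> where phi: "\<forall>h\<in>H. \<kappa> h = \<phi> (component h)" by (auto simp: factor_space_def)
  obtain e k where e: "e \<in> E" "k \<in> e" "k \<in> H" "component k = component h"
    using component_meets_E[OF card h] .
  have "e \<in> edges F" using e(1) E_sub by blast
  then have "e = {k, m k}" using pair_eq_mate[OF pairing_edges[OF wf]] e(2) by blast
  then have "z {k, m k} = 0" using z(1) e(1) Z_iff by simp
  then have "\<kappa> k = 0" by (simp add: \<kappa>_def \<zeta>_def)
  then have "\<kappa> h = 0" using phi e(3,4) h by simp
  then have "sgnh T h * z {h, m h} = 0" using h by (simp add: \<kappa>_def \<zeta>_def)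
  then show ?thesis by (simp add: sgnh_def split: if_splits)
qed

text \<open>Duality is applied to the incidence rows together with the columns of
  \<open>Delta\<close> at \<open>X\<close>, on the edges outside \<open>E\<close>. A vector killed
  by all of them is zero by \<open>orthogonal_cycle_zero\<close>, so the column of
  \<open>Delta\<close> at \<open>y\<close> is a combination of them; its incidence part is a
  potential and disappears in the product.\<close>

lemma column_in_span_full_rank:
  assumes full: "qv.dim (column ` X) = card X" and card: "card E = ncomp F"
  shows "column y \<in> qv.span (column ` X)"
proof (cases "y \<in> X")
  case True
  then show ?thesis by (intro qv.span_base imageI)
next
  case False
  let ?D = "edges F - E"
  note finX = transversal_finite[OF X]
  have fin: "finite V" "finite ?D" using wf_graph_finite[OF wf] by auto
  have ii: "inj_on column X" "qv.independent (column ` X)"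
    using qv.dim_image_eq_card_imp_inj_independent[OF finX full] by auto
  have ind: "c t = 0" if c: "(\<Sum>t\<in>X. qscale (c t) (column t)) = 0" and t: "t \<in> X" for c t
  proof -
    \<comment> \<open>Independence speaks of vectors, the relation of indices; injectivity carries
      the coefficients over.\<close>
    define u where "u = c \<circ> the_inv_into X column"
    have u: "u (column t) = c t" if "t \<in> X" for t using the_inv_into_f_f[OF ii(1) that] by (simp add: u_def)
    have "(\<Sum>x\<in>column ` X. qscale (u x) x) = (\<Sum>t\<in>X. qscale (c t) (column t))"
      using ii(1) u by (simp add: sum.reindex)
    then have "u (column t) = 0"
      using qv.independentD[OF ii(2) _ subset_refl, of u "column t"] c t finX by simp
    then show ?thesis using u[OF t] by simp
  qed
  have ind': "\<forall>c. (\<Sum>t\<in>X. qscale (c t) (column t)) = 0 \<longrightarrow> (\<forall>t\<in>X. c t = 0)"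
    by (intro allI impI ballI, rule ind)
  define A where "A i e = (case i of Inl v \<Rightarrow> incmat F T v e | Inr t \<Rightarrow> Delta T ori e t)"
    for i :: "'v + 'h set set" and e
  have "\<exists>\<pi>. \<forall>e\<in>?D. Delta T ori e y = (\<Sum>i\<in>V <+> X. \<pi> i * A i e)"
  proof (rule functional_in_row_space)
    show "finite (V <+> X)" using fin(1) finX by simp
    show "finite ?D" by (rule fin(2))
    fix z assume z: "\<And>i. i \<in> V <+> X \<Longrightarrow> (\<Sum>e\<in>?D. A i e * z e) = 0"
    define z' where "z' e = (if e \<in> ?D then z e else 0)" for e
    have "(\<Sum>e\<in>?D. incmat F T v e * z' e) = 0" if "v \<in> V" for v
      using z[OF InlI[OF that]] by (simp add: A_def z'_def)
    then have zZ: "z' \<in> Z" unfolding Z_iff by (simp add: z'_def)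
    have pv: "pairing_value z' t = (\<Sum>e\<in>?D. Delta T ori e t * z e)" for t
    proof -
      have "pairing_value z' t = (\<Sum>e\<in>?D. z' e * Delta T ori e t)"
        unfolding pairing_value_def using wf_graph_finite(3)[OF wf]
        by (intro sum.mono_neutral_right) (auto simp: z'_def)
      then show ?thesis by (simp add: z'_def mult.commute)
    qed
    have orth: "\<forall>t\<in>X. pairing_value z' t = 0"
    proof
      fix t assume "t \<in> X"
      then show "pairing_value z' t = 0" unfolding pv using z[OF InrI, of t] by (simp add: A_def)
    qed
    have zero: "z' {h, m h} = 0" if "h \<in> H" for h
      by (rule orthogonal_cycle_zero[OF ind' card zZ orth that])
    have "z e = 0" if e: "e \<in> ?D" for e
    proof -
      obtain h where h: "h \<in> H" "e = {h, m h}" using edge_tailE[OF wf dir, of e] e by auto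
      then have "z' e = 0" using zero[OF h(1)] by simp
      then show ?thesis using e by (simp add: z'_def)
    qed
    then show "(\<Sum>e\<in>?D. Delta T ori e y * z e) = 0" by simp
  qed
  then obtain \<pi> where p: "\<forall>e\<in>?D. Delta T ori e y = (\<Sum>i\<in>V <+> X. \<pi> i * A i e)" by blast
  \<comment> \<open>With 1 at \<open>y\<close> and negated coefficients on \<open>X\<close>, only
    the potential remains on the other side.\<close>
  define c where "c t = (if t = y then 1 else - \<pi> (Inr t))" for t
  have cX: "c t = - \<pi> (Inr t)" if "t \<in> X" for t using that False by (auto simp: c_def)
  have cy: "c y = 1" by (simp add: c_def)
  have "\<forall>e\<in>?D. (\<Sum>t\<in>insert y X. c t * Delta T ori e t) = (\<Sum>v\<in>V. \<pi> (Inl v) * incmat F T v e)"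
  proof
    fix e assume e: "e \<in> ?D"
    have "(\<Sum>i\<in>V <+> X. \<pi> i * A i e)
        = (\<Sum>v\<in>V. \<pi> (Inl v) * incmat F T v e) + (\<Sum>t\<in>X. \<pi> (Inr t) * Delta T ori e t)"
      using fin(1) finX by (simp add: sum.Plus A_def)
    moreover have "(\<Sum>t\<in>insert y X. c t * Delta T ori e t)
        = Delta T ori e y + (\<Sum>t\<in>X. c t * Delta T ori e t)"
      using finX False cy by simp
    moreover have "(\<Sum>t\<in>X. c t * Delta T ori e t) = - (\<Sum>t\<in>X. \<pi> (Inr t) * Delta T ori e t)"
      unfolding sum_negf[symmetric] using cX by (intro sum.cong) simp_all
    ultimately show "(\<Sum>t\<in>insert y X. c t * Delta T ori e t) = (\<Sum>v\<in>V. \<pi> (Inl v) * incmat F T v e)"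
      using p e by simp
  qed
  then have "\<exists>\<pi>. \<forall>e\<in>?D. (\<Sum>t\<in>insert y X. c t * Delta T ori e t) = (\<Sum>v\<in>V. \<pi> v * incmat F T v e)"
    by (rule exI[of _ "\<lambda>v. \<pi> (Inl v)"])
  then have "(\<Sum>t\<in>insert y X. qscale (c t) (column t)) = 0"
    by (rule iffD2[OF column_dependency_iff_potential, rotated]) (simp add: finX)
  moreover have "(\<Sum>t\<in>insert y X. qscale (c t) (column t)) = column y + (\<Sum>t\<in>X. qscale (c t) (column t))"
    using finX False cy by simp
  ultimately have "column y = - (\<Sum>t\<in>X. qscale (c t) (column t))" by (simp only: eq_neg_iff_add_eq_0)
  also have "\<dots> \<in> qv.span (column ` X)"
    by (intro qv.span_neg qv.span_sum qv.span_scale qv.span_base imageI)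
  finally show ?thesis .
qed

end

text \<open>All transversals have as many elements as \<open>F\<close> has vertices, which bounds
  every rank by that of \<open>X\<close>. The columns of \<open>X\<close> already span all columns,
  so the matrix rank has the same value.\<close>

lemma strict_rep_Q:
  assumes card: "card E = ncomp F"
  shows "strict_rep (transitions F) (Q_skew F) (Q_rank F) \<Gamma> (CM_Delta F T ori)"
proof -
  obtain X where X: "transversal (Q_skew F) X" "column_rank X = card X"
    using multimatroid_full_rank_transversal[OF multimatroid_column_rank Q_skew_two] .
  have sX: "subtransversal (Q_skew F) X" using X(1) by (auto simp: subtransversal_def)
  then have full: "qv.dim (column ` X) = card X" using X(2) by (simp add: column_rank_def)
  note finX = transversal_finite[OF X(1)]
  have "qv.dim (column ` transitions F) \<le> qv.dim (column ` X)"
    using column_in_span_full_rank[OF X(1) full card] finX by (intro qv.dim_mono_finite) auto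
  moreover have "qv.dim (column ` X) \<le> qv.dim (column ` transitions F)"
    using transversal_sub[OF X(1)] finite_transitions by (intro qv.dim_mono_finite) (auto intro: qv.span_base)
  ultimately have U: "qv.dim (column ` transitions F) = card X" using full by simp
  have "Max {column_rank S |S. subtransversal (Q_skew F) S} = card X"
  proof (rule Max_eqI)
    have sub: "S \<subseteq> transitions F" if "subtransversal (Q_skew F) S" for S
      using that transversal_sub unfolding subtransversal_def by blast
    have "{column_rank S |S. subtransversal (Q_skew F) S} \<subseteq> column_rank ` Pow (transitions F)" using sub by blast
    then show "finite {column_rank S |S. subtransversal (Q_skew F) S}"
      by (rule finite_subset) (simp add: finite_transitions)
    show "card X \<in> {column_rank S |S. subtransversal (Q_skew F) S}" using X(2) sX by force
    fix r assume "r \<in> {column_rank S |S. subtransversal (Q_skew F) S}"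
    then obtain S where S: "r = column_rank S" "subtransversal (Q_skew F) S" by blast
    obtain Y where Y: "transversal (Q_skew F) Y" "S \<subseteq> Y" using S(2) by (auto simp: subtransversal_def)
    have "r \<le> card S"
      using qv.dim_le_card'[of "column ` S"] card_image_le[of S column] subtransversal_finite[OF S(2)] S
      by (simp add: column_rank_def)
    also have "\<dots> \<le> card Y" using Y transversal_finite by (intro card_mono) auto
    also have "\<dots> = card X" using card_transversal X(1) Y(1) by simp
    finally show "r \<le> card X" .
  qed
  then show ?thesis
    unfolding strict_rep_def using represents_Q by (simp add: col_rank_eq U Q_rank_eq)
qed

end

theorem mainTheorem10:
  fixes F :: "('v,'h) graph" and T :: "'h set" and ori :: "'h set set \<Rightarrow> 'h set"
    and E :: "'h set set" and \<Gamma> :: "('h \<times> 'h) list set set"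
  assumes "wf_graph F" and "four_regular F"
    and "directed_version F T"
    and "transitional_orientation F ori"
    and "E \<subseteq> edges F"
    and "\<forall>e1\<in>E. \<forall>e2\<in>E. (\<exists>h1\<in>e1. \<exists>h2\<in>e2. (inc F h1, inc F h2) \<in> conn F) \<longrightarrow> e1 = e2"
    and "cycle_spanning_set (del_edges F E) (T \<inter> hedges (del_edges F E)) \<Gamma>"
  shows "represents (Q_skew F) (Q_rank F) \<Gamma> (CM_Delta F T ori)
    \<and> (card E = ncomp F \<longrightarrow>
         strict_rep (transitions F) (Q_skew F) (Q_rank F) \<Gamma> (CM_Delta F T ori))"
proof -
  interpret four_regular_representation F T ori E \<Gamma>
    using assms by unfold_locales
  show ?thesis using represents_Q strict_rep_Q by blast
qed

end
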